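(* Let $\Theta\subset\mathbb R^+=(0,\infty)$ be compact, let $G_0$ be a probability measure on $\Theta$, and let $(\alpha_n)_{n\ge1}\subset(0,1)$ be non-increasing with $\sum_{n\ge1}\alpha_n=+\infty$, $\sum_{n\ge1}\alpha_n^2<+\infty$ and $$\sum_{n\ge1}\Big(\frac{\alpha_n^2}{\sum_{k\ge n}\alpha_k^2}\Big)^2<+\infty.$$ Let $b_n=\big(\sum_{k\ge n}\alpha_k^2\big)^{-1}$. Let $(Y_n)_{n\ge1}$ follow the learning model with learning rate $(\alpha_n)$ and initial guess $G_0$, with associated random measures $(G_n)$ and $\mathbb P$-a.s. weak limit $\tilde G$ (see context). Then, for every $y\in\mathbb N_0$ and every $\theta\in\Theta$, the conditional distribution of $b_n^{1/2}\big(F_{G_n}(\theta\mid y)-F_{\tilde G}(\theta\mid y)\big)$ given $\mathcal G_n$ converges weakly, $\mathbb P$-a.s., as $n\to\infty$, to a centered Gaussian kernel with random variance $$W'_{\tilde G,y}(\theta)=\sum_{z\in\mathbb N_0}p_{\tilde G}(z)\,\frac{p_{\tilde G(\cdot\mid z)}(y)^2}{p_{\tilde G}(y)^2}\Big(F_{\tilde G(\cdot\mid z)}(\theta\mid y)-F_{\tilde G}(\theta\mid y)\Big)^2,$$ where $\tilde G(d\theta\mid z)\propto\mathrm{Poisson}(z\mid\theta)\,\tilde G(d\theta)$.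
   Context: $\mathbb N_0=\{0,1,2,\dots\}$ and $\mathrm{Poisson}(y\mid\theta)=e^{-\theta}\theta^y/y!$. $(Y_n)_{n\ge1}$ is an $\mathbb N_0$-valued sequence on $(\Omega,\mathcal F,\mathbb P)$, $\mathcal G_n=\sigma(Y_1,\dots,Y_n)$, $\mathcal G_0$ trivial. For a probability measure $G$ on $\Theta$, $p_G(y)=\int_\Theta\mathrm{Poisson}(y\mid\theta)\,G(d\theta)$ and $$F_G(\theta\mid y)=\frac{\int_0^\theta\mathrm{Poisson}(y\mid\vartheta)\,G(d\vartheta)}{\int_\Theta\mathrm{Poisson}(y\mid\vartheta)\,G(d\vartheta)},$$ the distribution function at $\theta$ of the posterior given $y$ (the integral in the numerator is over $\Theta\cap(0,\theta]$). In particular $p_{\tilde G(\cdot\mid z)}$ and $F_{\tilde G(\cdot\mid z)}$ are these objects for the measure $\tilde G(\cdot\mid z)$. Learning model: for each $n\ge0$, $\mathbb P(Y_{n+1}=y\mid\mathcal G_n)=p_{G_n}(y)$ for $y\in\mathbb N_0$, where the random measures $G_n$ are defined recursively from $G_0$ by $$G_{n+1}(d\theta)=(1-\alpha_{n+1})G_n(d\theta)+\alpha_{n+1}\frac{\mathrm{Poisson}(Y_{n+1}\mid\theta)\,G_n(d\theta)}{\int_\Theta\mathrm{Poisson}(Y_{n+1}\mid\vartheta)\,G_n(d\vartheta)}.$$ Under this model $G_n$ converges weakly $\mathbb P$-a.s. to a random probability measure $\tilde G$ on $\Theta$. A centered Gaussian kernel with random variance $U\ge0$ is the map $\omega\mapsto\mathcal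 N(0,U(\omega))$ (a point mass at $0$ when $U(\omega)=0$). The convergence means that, for a regular version $K_n(\cdot,\omega)$ of the conditional distribution given $\mathcal G_n$, for $\mathbb P$-almost every $\omega$ the measures $K_n(\cdot,\omega)$ converge weakly to $\mathcal N(0,U(\omega))$. *)

theory Defs
  imports "HOL-Probability.Probability"
begin

text \<open>A probability measure on \<open>\<Theta> \<subseteq> \<real>\<close> is represented by a Borel probability measure on the
  whole line that gives \<open>\<Theta>\<close> mass one, so that integrals over \<open>\<Theta>\<close> are integrals over the line
  and weak convergence on the compact set \<open>\<Theta>\<close> is \<open>weak_conv_m\<close>.\<close>

definition prob_measures_on :: "real set \<Rightarrow> real measure set" where
  "prob_measures_on \<Theta> = {G. sets G = sets borel \<and> prob_space G \<and> emeasure G \<Theta> = 1}"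

definition random_prob_measure_on :: "'a measure \<Rightarrow> real set \<Rightarrow> ('a \<Rightarrow> real measure) \<Rightarrow> bool" where
  "random_prob_measure_on M \<Theta> K \<longleftrightarrow>
     K \<in> M \<rightarrow>\<^sub>M prob_algebra borel \<and> (\<forall>\<omega>\<in>space M. K \<omega> \<in> prob_measures_on \<Theta>)"

definition poisson :: "nat \<Rightarrow> real \<Rightarrow> real" where
  "poisson y \<theta> = exp (- \<theta>) * \<theta> ^ y / fact y"

lemma poisson_eq_pmf: "0 < \<theta> \<Longrightarrow> poisson y \<theta> = pmf (poisson_pmf \<theta>) y"
  by (simp add: poisson_def)

definition marg :: "real measure \<Rightarrow> nat \<Rightarrow> real" where
  "marg G y = (\<integral>\<theta>. poisson y \<theta> \<partial>G)"

definition posterior :: "nat \<Rightarrow> real measure \<Rightarrow> real measure" where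
  "posterior z G = density G (\<lambda>\<theta>. ennreal (poisson z \<theta> / marg G z))"

definition post_cdf :: "real measure \<Rightarrow> real \<Rightarrow> nat \<Rightarrow> real" where
  "post_cdf G \<theta> y = (LINT t:{0<..\<theta>}|G. poisson y t) / (\<integral>t. poisson y t \<partial>G)"

definition learn_step :: "real \<Rightarrow> nat \<Rightarrow> real measure \<Rightarrow> real measure" where
  "learn_step a y G = measure_of (space G) (sets G)
     (\<lambda>A. ennreal (1 - a) * emeasure G A + ennreal a * emeasure (posterior y G) A)"

lemma sets_posterior [simp]: "sets (posterior y G) = sets G"
  by (simp add: posterior_def)

lemma sets_learn_step [simp]: "sets (learn_step a y G) = sets G"
  by (simp add: learn_step_def)

lemma emeasure_learn_step:
  assumes "A \<in> sets G"
  shows "emeasure (learn_step a y G) A =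
    ennreal (1 - a) * emeasure G A + ennreal a * emeasure (posterior y G) A"
proof (rule emeasure_measure_of[OF learn_step_def])
  show "positive (sets (learn_step a y G))
    (\<lambda>A. ennreal (1 - a) * emeasure G A + ennreal a * emeasure (posterior y G) A)"
    by (simp add: positive_def)
  show "countably_additive (sets (learn_step a y G))
    (\<lambda>A. ennreal (1 - a) * emeasure G A + ennreal a * emeasure (posterior y G) A)"
  proof (rule countably_additiveI)
    fix A :: "nat \<Rightarrow> real set"
    assume A: "range A \<subseteq> sets (learn_step a y G)" "disjoint_family A"
    then show "(\<Sum>i. ennreal (1 - a) * emeasure G (A i)
        + ennreal a * emeasure (posterior y G) (A i)) =
      ennreal (1 - a) * emeasure G (\<Union>i. A i)
        + ennreal a * emeasure (posterior y G) (\<Union>i. A i)"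
      by (simp add: suminf_add[symmetric] suminf_emeasure)
  qed
qed (use assms sets.space_closed in auto)

primrec learn :: "(nat \<Rightarrow> real) \<Rightarrow> real measure \<Rightarrow> (nat \<Rightarrow> nat) \<Rightarrow> nat \<Rightarrow> real measure" where
  "learn \<alpha> G0 ys 0 = G0"
| "learn \<alpha> G0 ys (Suc n) = learn_step (\<alpha> (Suc n)) (ys (Suc n)) (learn \<alpha> G0 ys n)"

text \<open>\<open>\<sigma>(Y\<^sub>1, \<dots>, Y\<^sub>n)\<close>, which is trivial on \<open>space M\<close> for \<open>n = 0\<close>. The sequences \<open>Y\<close> and \<open>\<alpha>\<close> are
  indexed from one: \<open>Y 0\<close> is never used, and \<open>\<alpha> 0\<close> occurs only in the irrelevant value
  \<open>b_seq \<alpha> 0\<close>.\<close>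

definition gen_filtration :: "'a measure \<Rightarrow> (nat \<Rightarrow> 'a \<Rightarrow> nat) \<Rightarrow> nat \<Rightarrow> 'a measure" where
  "gen_filtration M Y n = sigma (space M) {Y i -` A \<inter> space M | i A. 1 \<le> i \<and> i \<le> n}"

definition learning_model ::
  "'a measure \<Rightarrow> (nat \<Rightarrow> real) \<Rightarrow> real measure \<Rightarrow> (nat \<Rightarrow> 'a \<Rightarrow> nat) \<Rightarrow> bool" where
  "learning_model M \<alpha> G0 Y \<longleftrightarrow>
     prob_space M \<and>
     (\<forall>n\<ge>1. Y n \<in> M \<rightarrow>\<^sub>M count_space UNIV) \<and>
     (\<forall>n y. AE \<omega> in M.
        real_cond_exp M (gen_filtration M Y n) (indicator {\<omega>\<in>space M. Y (Suc n) \<omega> = y}) \<omega>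
          = marg (learn \<alpha> G0 (\<lambda>k. Y k \<omega>) n) y)"

definition tail_sq :: "(nat \<Rightarrow> real) \<Rightarrow> nat \<Rightarrow> real" where
  "tail_sq \<alpha> n = (\<Sum>k. (\<alpha> (n + k))\<^sup>2)"

definition b_seq :: "(nat \<Rightarrow> real) \<Rightarrow> nat \<Rightarrow> real" where
  "b_seq \<alpha> n = inverse (tail_sq \<alpha> n)"

definition regular_cond_distr ::
  "'a measure \<Rightarrow> 'a measure \<Rightarrow> ('a \<Rightarrow> real) \<Rightarrow> ('a \<Rightarrow> real measure) \<Rightarrow> bool" where
  "regular_cond_distr M F X K \<longleftrightarrow>
     K \<in> F \<rightarrow>\<^sub>M prob_algebra borel \<and>
     (\<forall>B\<in>sets borel. AE \<omega> in M.
        measure (K \<omega>) B = real_cond_exp M F (indicator (X -` B \<inter> space M)) \<omega>)"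

definition centered_gaussian :: "real \<Rightarrow> real measure" where
  "centered_gaussian v =
     (if v = 0 then return borel 0 else density lborel (\<lambda>x. ennreal (normal_density 0 (sqrt v) x)))"

text \<open>Regular versions are unique up to null sets, so it does not matter which one is taken; the
  first conjunct makes sure that the second is not vacuous.\<close>

definition cond_distr_converges_gaussian ::
  "'a measure \<Rightarrow> (nat \<Rightarrow> 'a measure) \<Rightarrow> (nat \<Rightarrow> 'a \<Rightarrow> real) \<Rightarrow> ('a \<Rightarrow> real) \<Rightarrow> bool" where
  "cond_distr_converges_gaussian M F X U \<longleftrightarrow>
     (\<exists>K. \<forall>n. regular_cond_distr M (F n) (X n) (K n)) \<and>
     (\<forall>K. (\<forall>n. regular_cond_distr M (F n) (X n) (K n)) \<longrightarrow>
        (AE \<omega> in M. weak_conv_m (\<lambda>n. K n \<omega>) (centered_gaussian (U \<omega>))))"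

definition limit_variance :: "real measure \<Rightarrow> nat \<Rightarrow> real \<Rightarrow> real" where
  "limit_variance G y \<theta> =
     (\<Sum>z. marg G z * ((marg (posterior z G) y)\<^sup>2 / (marg G y)\<^sup>2)
        * (post_cdf (posterior z G) \<theta> y - post_cdf G \<theta> y)\<^sup>2)"

end

theory Submission
  imports Defs
begin

text \<open>
  Since \<open>Y\<close> is discrete, the \<open>\<sigma>\<close>-algebra generated by \<open>Y\<^sub>1, \<dots>, Y\<^sub>n\<close> is atomic, and conditioning on
  it amounts to restarting the learning recursion at time \<open>n\<close> from a fixed measure \<open>G\<^sub>n\<close>. For every
  bounded \<open>f\<close> the integrals \<open>G\<^sub>n f\<close> form a martingale with conditional increment variance
  \<open>\<alpha>\<^sub>n\<^sub>+\<^sub>1\<^sup>2 v(G\<^sub>n, f)\<close>, and \<open>v\<close> is Lipschitz in the integrals against \<open>G\<close>. Expanding the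
  characteristic function along the recursion shows that, given the past, \<open>b\<^sub>n\<^sup>1\<^sup>/\<^sup>2 (G f - G\<^sub>n f)\<close> is
  Gaussian with variance \<open>v(G\<^sub>n, f)\<close>, where \<open>G\<close> is the limit, up to an error that depends only on \<open>n\<close>
  and tends to \<open>0\<close>.

  Let \<open>F\<^sub>n\<close> and \<open>D\<^sub>n\<close> be the posterior distribution function and the marginal at \<open>y\<close>, and let
  \<open>h = Poisson(y | \<cdot>) (1\<^bsub>(0, \<theta>]\<^esub> - F\<^sub>n)\<close>. Then \<open>G\<^sub>n h = 0\<close> and \<open>F\<^sub>n - F = - G h / D\<close>. Replacing \<open>D\<close> by \<open>D\<^sub>n\<close>
  costs an expected error of order \<open>b\<^sub>n\<^sup>-\<^sup>1\<close> before rescaling, so the expansion applies with \<open>f = h\<close>.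
  The variances converge because \<open>G\<^sub>n f\<close> tends to \<open>G f\<close> almost surely even for the discontinuous
  integrands involved, by Kolmogorov's maximal inequality and upper semicontinuity.
\<close>

section \<open>Poisson mixtures on a compact interval\<close>

text \<open>The integrand \<open>h\<close> changes with the observed history, so every estimate must
  be uniform in the current measure; the final error then depends on \<open>n\<close> alone.
  Compactness of \<Theta> in the positive half line makes this possible: with extremes
  \<open>lo\<close> and \<open>hi\<close>, the likelihood of z lies between \<open>pois_lb z\<close>
  > 0 and \<open>pois_ub z\<close>, and the upper bounds sum to \<open>exp hi\<close>. The marginals
  \<open>marg G z\<close> have no lower bound uniform in z, so the quotients in the variance are
  compared by an estimate that never divides by them. The rates enter through two scalings.
  Monotonicity bounds all later rates by the next one, a, so the cubic Taylor terms are of order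
  b_n^(1/2) a after rescaling. And b_n starts its tail at n, whereas conditioning on the first n
  observations leaves only the rates from n + 1 on. Both effects are controlled by the ratios of a
  squared rate to its tail, which tend to 0 because their squares are summable.\<close>

lemma borel_measurable_poisson [measurable]: "poisson y \<in> borel_measurable borel"
  unfolding poisson_def by measurable

lemma isCont_poisson: "isCont (poisson y) x"
  unfolding poisson_def by (auto intro!: continuous_intros)

lemma sums_poisson: "(\<lambda>y. poisson y x) sums 1"
proof -
  have "(\<lambda>y. exp (- x) * (inverse (fact y) *\<^sub>R x ^ y)) sums (exp (- x) * exp x)"
    by (intro sums_mult exp_converges)
  then show ?thesis
    by (simp add: poisson_def exp_minus field_simps)
qed

section \<open>Expectations under a probability mass function\<close>

lemma integral_measure_pmf_nat:
  fixes p :: "nat pmf" and f :: "nat \<Rightarrow> real"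
  assumes "summable (\<lambda>z. \<bar>pmf p z * f z\<bar>)"
  shows "measure_pmf.expectation p f = (\<Sum>z. pmf p z * f z)"
proof -
  have "measure_pmf.expectation p f = (\<integral>z. pmf p z *\<^sub>R f z \<partial>count_space UNIV)"
    unfolding measure_pmf_eq_density by (rule integral_density) auto
  also have "\<dots> = (\<Sum>z. pmf p z * f z)"
    using assms by (subst integral_count_space_nat) (auto simp: integrable_count_space_nat_iff)
  finally show ?thesis .
qed

lemma integrable_measure_pmf_bounded:
  fixes f :: "'a \<Rightarrow> 'b::{banach, second_countable_topology}"
  assumes "\<And>x. x \<in> set_pmf p \<Longrightarrow> norm (f x) \<le> B"
  shows "integrable (measure_pmf p) f"
  using assms by (intro measure_pmf.integrable_const_bound[where B = B]) (auto simp: AE_measure_pmf_iff)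

lemma norm_integral_measure_pmf_le:
  fixes f :: "'a \<Rightarrow> 'b::{banach, second_countable_topology}"
  assumes "\<And>x. x \<in> set_pmf p \<Longrightarrow> norm (f x) \<le> B"
  shows "norm (measure_pmf.expectation p f) \<le> B"
proof -
  have i: "integrable (measure_pmf p) f"
    by (rule integrable_measure_pmf_bounded) (rule assms)
  have "norm (measure_pmf.expectation p f) \<le> measure_pmf.expectation p (\<lambda>x. norm (f x))"
    by (rule integral_norm_bound)
  also have "\<dots> \<le> measure_pmf.expectation p (\<lambda>_. B)"
    using assms
    by (intro integral_mono_AE integrable_norm i) (auto simp: AE_measure_pmf_iff)
  finally show ?thesis by simp
qed

lemma integral_measure_pmf_mono:
  fixes f g :: "'a \<Rightarrow> real"
  assumes "\<And>x. x \<in> set_pmf p \<Longrightarrow> f x \<le> g x"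
    and "\<And>x. x \<in> set_pmf p \<Longrightarrow> \<bar>f x\<bar> \<le> B" and "\<And>x. x \<in> set_pmf p \<Longrightarrow> \<bar>g x\<bar> \<le> B"
  shows "measure_pmf.expectation p f \<le> measure_pmf.expectation p g"
  using assms
  by (intro integral_mono_AE integrable_measure_pmf_bounded[where B = B]) (auto simp: AE_measure_pmf_iff)

lemma integral_bind_pmf_real:
  fixes f :: "'a \<Rightarrow> real"
  assumes "\<And>x. \<bar>f x\<bar> \<le> B"
  shows "measure_pmf.expectation (bind_pmf p q) f
    = measure_pmf.expectation p (\<lambda>x. measure_pmf.expectation (q x) f)"
  unfolding measure_pmf_bind
  by (rule integral_bind[where K = "count_space UNIV" and B = B and B' = 1])
     (use assms in \<open>auto simp: measure_pmf.emeasure_eq_measure intro: measure_pmf.finite_measure_axioms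
         simp: space_subprob_algebra subprob_space_measure_pmf\<close>)

lemma integral_bind_pmf_complex:
  fixes f :: "'a \<Rightarrow> complex"
  assumes B: "\<And>x. norm (f x) \<le> B"
  shows "measure_pmf.expectation (bind_pmf p q) f
    = measure_pmf.expectation p (\<lambda>x. measure_pmf.expectation (q x) f)"
proof (rule complex_eqI)
  have i: "integrable (measure_pmf r) f" for r
    by (rule integrable_measure_pmf_bounded) (rule B)
  have i': "integrable (measure_pmf p) (\<lambda>x. measure_pmf.expectation (q x) f)"
    by (rule integrable_measure_pmf_bounded[where B = B]) (rule norm_integral_measure_pmf_le, rule B)
  have "\<bar>Re (f x)\<bar> \<le> B" "\<bar>Im (f x)\<bar> \<le> B" for x
    using abs_Re_le_cmod[of "f x"] abs_Im_le_cmod[of "f x"] B[of x] by auto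
  note * = integral_bind_pmf_real[OF this(1)] integral_bind_pmf_real[OF this(2)]
  show "Re (measure_pmf.expectation (bind_pmf p q) f)
      = Re (measure_pmf.expectation p (\<lambda>x. measure_pmf.expectation (q x) f))"
    by (simp add: integral_Re[OF i, symmetric] integral_Re[OF i', symmetric] *)
  show "Im (measure_pmf.expectation (bind_pmf p q) f)
      = Im (measure_pmf.expectation p (\<lambda>x. measure_pmf.expectation (q x) f))"
    by (simp add: integral_Im[OF i, symmetric] integral_Im[OF i', symmetric] *)
qed

section \<open>Measures carried by a compact interval of positive numbers\<close>

locale poisson_interval =
  fixes lo hi :: real
  assumes lo_pos: "0 < lo" and lo_le_hi: "lo \<le> hi"
begin

abbreviation priors :: "real measure set" where
  "priors \<equiv> prob_measures_on {lo..hi}"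

text \<open>Boundedness is asked for on the carrier only: the Poisson likelihoods with y > 0 and
  their products are unbounded on the negative half line, which has no mass. Measurability is global
  because the measures live on the whole line.\<close>

definition bdd :: "real \<Rightarrow> (real \<Rightarrow> real) \<Rightarrow> bool" where
  "bdd H f \<longleftrightarrow> f \<in> borel_measurable borel \<and> (\<forall>x\<in>{lo..hi}. \<bar>f x\<bar> \<le> H)"

text \<open>The factor exp (- x) of the likelihood is at most 1. Dropping it leaves a series with
  sum \<open>exp hi\<close>, which dominates all sums over observations.\<close>

definition pois_ub :: "nat \<Rightarrow> real" where
  "pois_ub z = hi ^ z / fact z"

definition pois_lb :: "nat \<Rightarrow> real" where
  "pois_lb z = exp (- hi) * lo ^ z / fact z"

lemma hi_pos: "0 < hi"
  using lo_pos lo_le_hi by simp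

lemma pois_lb_pos: "0 < pois_lb z"
  by (simp add: pois_lb_def lo_pos)

lemma pois_ub_pos: "0 < pois_ub z"
  by (simp add: pois_ub_def hi_pos)

lemma sums_pois_ub: "pois_ub sums exp hi"
  using exp_converges[of hi] by (simp add: pois_ub_def[abs_def] field_simps)

lemma poisson_bounds:
  assumes "x \<in> {lo..hi}"
  shows "pois_lb z \<le> poisson z x" "poisson z x \<le> pois_ub z" "0 < poisson z x"
proof -
  have x: "0 < x" "lo \<le> x" "x \<le> hi" using assms lo_pos by auto
  show lb: "pois_lb z \<le> poisson z x"
    unfolding pois_lb_def poisson_def
    using x lo_pos by (intro divide_right_mono mult_mono power_mono) auto
  have "exp (- x) * x ^ z \<le> 1 * hi ^ z"
    using x by (intro mult_mono power_mono) auto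
  then show "poisson z x \<le> pois_ub z"
    unfolding pois_ub_def poisson_def by (simp add: divide_right_mono)
  show "0 < poisson z x" using lb pois_lb_pos[of z] by simp
qed

lemma bdd_measurable: "bdd H f \<Longrightarrow> f \<in> borel_measurable borel"
  by (simp add: bdd_def)

lemma bdd_nonneg: "bdd H f \<Longrightarrow> 0 \<le> H"
  using lo_le_hi unfolding bdd_def by (auto dest!: bspec[where x = lo])

lemma bdd_poisson: "bdd (pois_ub z) (poisson z)"
  unfolding bdd_def using poisson_bounds by (auto simp: abs_of_pos)

lemma bdd_mult: "bdd H f \<Longrightarrow> bdd K g \<Longrightarrow> bdd (H * K) (\<lambda>x. f x * g x)"
  unfolding bdd_def by (auto simp: abs_mult intro!: mult_mono intro: order_trans[OF abs_ge_zero])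

lemma bdd_abs: "bdd H f \<Longrightarrow> bdd H (\<lambda>x. \<bar>f x\<bar>)"
  unfolding bdd_def by auto

lemma bdd_const: "bdd \<bar>c\<bar> (\<lambda>x. c)"
  unfolding bdd_def by auto

context
  fixes G assumes G: "G \<in> priors"
begin

lemma priors_sets: "sets G = sets borel"
  using G by (simp add: prob_measures_on_def)

lemma priors_space: "space G = UNIV"
  using sets_eq_imp_space_eq[OF priors_sets] by simp

lemma priors_prob_space: "prob_space G"
  using G by (simp add: prob_measures_on_def)

lemma priors_real_distribution: "real_distribution G"
  using priors_prob_space priors_sets priors_space by (simp add: real_distribution_def real_distribution_axioms_def)

lemma priors_measurable: "f \<in> borel_measurable borel \<Longrightarrow> f \<in> borel_measurable G"
  using priors_sets by (simp cong: measurable_cong_sets)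

lemma AE_priors: "AE x in G. x \<in> {lo..hi}"
proof -
  interpret prob_space G by (rule priors_prob_space)
  have "prob {lo..hi} = 1"
    using G by (simp add: prob_measures_on_def measure_def)
  then show ?thesis
    using priors_sets by (subst (asm) prob_eq_1) auto
qed

lemma AE_priors_I: "(\<And>x. x \<in> {lo..hi} \<Longrightarrow> Q x) \<Longrightarrow> AE x in G. Q x"
  using AE_priors by (rule eventually_mono)

lemma integrable_bdd: "bdd H f \<Longrightarrow> integrable G f"
proof -
  interpret prob_space G by (rule priors_prob_space)
  show "bdd H f \<Longrightarrow> integrable G f"
    using AE_priors by (intro integrable_const_bound[where B = H]) (auto simp: bdd_def priors_measurable elim: eventually_mono)
qed

lemma integral_mono_priors:
  assumes "bdd H f" "bdd K g" "\<And>x. x \<in> {lo..hi} \<Longrightarrow> f x \<le> g x"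
  shows "integral\<^sup>L G f \<le> integral\<^sup>L G g"
  using assms AE_priors by (intro integral_mono_AE integrable_bdd) (auto elim: eventually_mono)

lemma measure_space_priors: "measure G (space G) = 1"
  using prob_space.prob_space[OF priors_prob_space] .

lemma integral_le_priors:
  assumes "bdd H f" "\<And>x. x \<in> {lo..hi} \<Longrightarrow> f x \<le> c"
  shows "integral\<^sup>L G f \<le> c"
  using integral_mono_priors[OF assms(1) bdd_const[of c]] assms(2) by (simp add: measure_space_priors)

lemma integral_ge_priors:
  assumes "bdd H f" "\<And>x. x \<in> {lo..hi} \<Longrightarrow> c \<le> f x"
  shows "c \<le> integral\<^sup>L G f"
  using integral_mono_priors[OF bdd_const[of c] assms(1)] assms(2) by (simp add: measure_space_priors)

lemma abs_integral_le_priors: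
  assumes "bdd H f"
  shows "\<bar>integral\<^sup>L G f\<bar> \<le> H"
proof -
  have *: "\<bar>f x\<bar> \<le> H" if "x \<in> {lo..hi}" for x using assms that by (auto simp: bdd_def)
  have "f x \<le> H \<and> - H \<le> f x" if "x \<in> {lo..hi}" for x using *[OF that] by auto
  then show ?thesis
    using integral_le_priors[OF assms, of H] integral_ge_priors[OF assms, of "- H"] by auto
qed

lemma marg_bounds: "pois_lb z \<le> marg G z" "marg G z \<le> pois_ub z" "0 < marg G z"
proof -
  show "pois_lb z \<le> marg G z" unfolding marg_def
    by (rule integral_ge_priors[OF bdd_poisson]) (rule poisson_bounds)
  then show "0 < marg G z" using pois_lb_pos[of z] by simp
  show "marg G z \<le> pois_ub z" unfolding marg_def
    by (rule integral_le_priors[OF bdd_poisson]) (rule poisson_bounds)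
qed

text \<open>The likelihoods sum to 1 at each point, and \<open>pois_ub z * H\<close> dominates the
  exchange of sum and integral. The constant function 1 gives the total mass of the predictive law,
  a general \<open>f\<close> the martingale property.\<close>

lemma sums_integral_poisson:
  assumes "bdd H f"
  shows "(\<lambda>z. \<integral>x. poisson z x * f x \<partial>G) sums integral\<^sup>L G f"
proof -
  have b: "bdd (pois_ub z * H) (\<lambda>x. poisson z x * f x)" for z
    by (intro bdd_mult bdd_poisson assms)
  have sm: "summable (\<lambda>z. pois_ub z * H)" using sums_pois_ub by (intro summable_mult2) (rule sums_summable)
  have "(\<lambda>z. \<integral>x. poisson z x * f x \<partial>G) sums (\<integral>x. (\<Sum>z. poisson z x * f x) \<partial>G)"
  proof (rule sums_integral)
    show "integrable G (\<lambda>x. poisson z x * f x)" for z by (rule integrable_bdd[OF b])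
    show "AE x in G. summable (\<lambda>z. norm (poisson z x * f x))"
    proof (rule AE_priors_I)
      fix x assume x: "x \<in> {lo..hi}"
      have "norm (poisson z x * f x) \<le> pois_ub z * H" for z
        using b[of z] x unfolding bdd_def by (simp only: real_norm_def)
      then show "summable (\<lambda>z. norm (poisson z x * f x))"
        by (intro summable_comparison_test'[OF sm, of 0]) simp
    qed
    have "norm (\<integral>x. norm (poisson z x * f x) \<partial>G) \<le> pois_ub z * H" for z
      using abs_integral_le_priors[OF bdd_abs[OF b[of z]]] by simp
    then show "summable (\<lambda>z. \<integral>x. norm (poisson z x * f x) \<partial>G)"
      by (intro summable_comparison_test'[OF sm, of 0]) simp
  qed
  also have "(\<lambda>x. \<Sum>z. poisson z x * f x) = f"
    using sums_mult2[OF sums_poisson] by (auto simp: fun_eq_iff dest: sums_unique[symmetric])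
  finally show ?thesis .
qed

lemma sums_marg: "marg G sums 1"
  using sums_integral_poisson[OF bdd_const[of 1]] by (simp add: marg_def[abs_def] measure_space_priors)

lemma integral_posterior:
  assumes "bdd H f"
  shows "integral\<^sup>L (posterior z G) f = (\<integral>x. poisson z x * f x \<partial>G) / marg G z"
proof -
  have m: "(\<lambda>x. poisson z x / marg G z) \<in> borel_measurable G" "f \<in> borel_measurable G"
    using assms by (auto intro!: priors_measurable borel_measurable_divide borel_measurable_poisson simp: bdd_def)
  have "0 \<le> poisson z x / marg G z" if "x \<in> {lo..hi}" for x
    using poisson_bounds(3)[OF that, of z] marg_bounds(3)[of z] by simp
  then have "AE x in G. 0 \<le> poisson z x / marg G z"
    by (rule AE_priors_I)
  then have "integral\<^sup>L (posterior z G) f = (\<integral>x. (poisson z x / marg G z) *\<^sub>R f x \<partial>G)"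
    unfolding posterior_def using m by (intro integral_density)
  also have "\<dots> = (\<integral>x. (poisson z x * f x) / marg G z \<partial>G)" by simp
  finally show ?thesis by simp
qed

lemma posterior_in_priors: "posterior z G \<in> priors"
proof -
  have m: "(\<lambda>x. ennreal (poisson z x / marg G z)) \<in> borel_measurable G"
    by (intro measurable_compose[OF _ measurable_ennreal] priors_measurable) measurable
  have bd: "bdd (pois_ub z * \<bar>inverse (marg G z)\<bar>) (\<lambda>x. poisson z x * inverse (marg G z))"
    by (intro bdd_mult bdd_poisson bdd_const)
  have eq: "emeasure (posterior z G) A = 1" if A: "A \<in> sets borel" "AE x in G. x \<in> A" for A
  proof -
    have "emeasure (posterior z G) A = (\<integral>\<^sup>+x. ennreal (poisson z x / marg G z) * indicator A x \<partial>G)"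
      unfolding posterior_def using A m by (intro emeasure_density) (auto simp: priors_sets)
    also have "\<dots> = (\<integral>\<^sup>+x. ennreal (poisson z x / marg G z) \<partial>G)"
      using A(2) by (intro nn_integral_cong_AE) (auto elim!: eventually_mono)
    also have "\<dots> = ennreal (\<integral>x. poisson z x / marg G z \<partial>G)"
    proof (rule nn_integral_eq_integral)
      show "integrable G (\<lambda>x. poisson z x / marg G z)"
        using integrable_bdd[OF bd] by (simp add: divide_inverse)
      show "AE x in G. 0 \<le> poisson z x / marg G z"
        using marg_bounds(3)[of z] poisson_bounds(3) by (intro AE_priors_I) (simp add: less_imp_le)
    qed
    also have "(\<integral>x. poisson z x / marg G z \<partial>G) = 1"
      using marg_bounds(3)[of z] by (simp add: marg_def)
    finally show ?thesis by simp
  qed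
  have "emeasure (posterior z G) (space (posterior z G)) = 1"
    using eq[of UNIV] by (simp add: posterior_def priors_space)
  then show ?thesis
    using eq[of "{lo..hi}"] AE_priors by (auto simp: prob_measures_on_def priors_sets intro!: prob_spaceI)
qed

text \<open>The update is defined set by set; a density with respect to the prior makes integrals of
  functions accessible.\<close>

lemma learn_step_eq_density:
  assumes a: "0 \<le> a" "a \<le> 1"
  shows "learn_step a z G = density G (\<lambda>x. ennreal (1 - a) + ennreal a * ennreal (poisson z x / marg G z))"
proof (rule measure_eqI)
  have m: "(\<lambda>x. ennreal (poisson z x / marg G z)) \<in> borel_measurable G"
    by (intro measurable_compose[OF _ measurable_ennreal] priors_measurable) measurable
  fix A assume "A \<in> sets (learn_step a z G)"
  then have A: "A \<in> sets G" by simp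
  note m[measurable]
  have "emeasure (density G (\<lambda>x. ennreal (1 - a) + ennreal a * ennreal (poisson z x / marg G z))) A
    = (\<integral>\<^sup>+x. ennreal (1 - a) * indicator A x + ennreal a * (ennreal (poisson z x / marg G z) * indicator A x) \<partial>G)"
    using A by (subst emeasure_density) (auto simp: algebra_simps)
  also have "\<dots> = ennreal (1 - a) * emeasure G A + ennreal a * emeasure (posterior z G) A"
    unfolding posterior_def using A
    by (subst nn_integral_add) (auto simp: nn_integral_cmult emeasure_density)
  finally show "emeasure (learn_step a z G) A = emeasure (density G (\<lambda>x. ennreal (1 - a) + ennreal a * ennreal (poisson z x / marg G z))) A"
    using A by (simp add: emeasure_learn_step)
qed simp

lemma learn_step_in_priors:
  assumes a: "0 \<le> a" "a \<le> 1"
  shows "learn_step a z G \<in> priors"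
proof -
  have P: "posterior z G \<in> priors" by (rule posterior_in_priors)
  have 1: "ennreal (1 - a) + ennreal a = 1" using a by (simp flip: ennreal_plus)
  have e: "emeasure G UNIV = 1" "emeasure (posterior z G) UNIV = 1"
    using P G prob_space.emeasure_space_1[of G] prob_space.emeasure_space_1[of "posterior z G"]
      priors_space sets_eq_imp_space_eq[of "posterior z G" borel]
    by (auto simp: prob_measures_on_def)
  have "space (learn_step a z G) = UNIV"
    using sets_eq_imp_space_eq[OF sets_learn_step[of a z G]] priors_space by simp
  then show ?thesis
    using 1 e P G by (auto simp: prob_measures_on_def emeasure_learn_step intro!: prob_spaceI)
qed

text \<open>Written as old value plus increment: the increment is the rate times a quantity whose
  predictive mean is 0.\<close>

lemma integral_learn_step:
  assumes a: "0 \<le> a" "a \<le> 1" and f: "bdd H f"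
  shows "integral\<^sup>L (learn_step a z G) f = integral\<^sup>L G f + a * (integral\<^sup>L (posterior z G) f - integral\<^sup>L G f)"
proof -
  have m: "0 < marg G z" by (rule marg_bounds)
  have nn: "0 \<le> poisson z x / marg G z" if "x \<in> {lo..hi}" for x
    using poisson_bounds(3)[OF that, of z] m by simp
  have [measurable]: "(\<lambda>x. poisson z x / marg G z) \<in> borel_measurable G" "f \<in> borel_measurable G"
    using f by (auto intro!: priors_measurable borel_measurable_divide borel_measurable_poisson simp: bdd_def)
  have "learn_step a z G = density G (\<lambda>x. ennreal ((1 - a) + a * (poisson z x / marg G z)))"
    unfolding learn_step_eq_density[OF a]
  proof (rule density_cong)
    show "AE x in G. ennreal (1 - a) + ennreal a * ennreal (poisson z x / marg G z)
        = ennreal (1 - a + a * (poisson z x / marg G z))"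
    proof (rule AE_priors_I)
      fix x assume x: "x \<in> {lo..hi}"
      show "ennreal (1 - a) + ennreal a * ennreal (poisson z x / marg G z)
        = ennreal (1 - a + a * (poisson z x / marg G z))"
        unfolding ennreal_mult[OF a(1) nn[OF x], symmetric]
        by (rule ennreal_plus[symmetric]) (use a nn[OF x] in \<open>auto intro: mult_nonneg_nonneg simp del: times_divide_eq_right\<close>)
    qed
  qed measurable
  moreover have "0 \<le> (1 - a) + a * (poisson z x / marg G z)" if "x \<in> {lo..hi}" for x
    using a nn[OF that] by (intro add_nonneg_nonneg mult_nonneg_nonneg) auto
  then have "AE x in G. 0 \<le> (1 - a) + a * (poisson z x / marg G z)"
    by (rule AE_priors_I)
  ultimately have "integral\<^sup>L (learn_step a z G) f
      = (\<integral>x. ((1 - a) + a * (poisson z x / marg G z)) *\<^sub>R f x \<partial>G)"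
    by (simp only:) (intro integral_density; measurable)
  also have "\<dots> = (\<integral>x. (1 - a) * f x + (a / marg G z) * (poisson z x * f x) \<partial>G)"
    by (simp add: algebra_simps)
  also have "\<dots> = (1 - a) * integral\<^sup>L G f + (a / marg G z) * (\<integral>x. poisson z x * f x \<partial>G)"
    by (subst Bochner_Integration.integral_add)
       (auto intro: integrable_bdd[OF f] integrable_bdd[OF bdd_mult[OF bdd_poisson f]] simp del: times_divide_eq_left)
  finally show ?thesis
    by (simp add: integral_posterior[OF f] algebra_simps)
qed

end

end

section \<open>The predictive distribution and the one-step variance\<close>

context poisson_interval
begin

definition predictive :: "real measure \<Rightarrow> nat pmf" where
  "predictive G = embed_pmf (marg G)"

text \<open>One update with rate a gives the learned integral of \<open>f\<close> conditional
  variance a^2 times this number, which is the v(G, f) of the overview.\<close>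

definition predictive_variance :: "real measure \<Rightarrow> (real \<Rightarrow> real) \<Rightarrow> real" where
  "predictive_variance G f = measure_pmf.expectation (predictive G)
     (\<lambda>z. (integral\<^sup>L (posterior z G) f - integral\<^sup>L G f)\<^sup>2)"

context
  fixes G assumes G: "G \<in> priors"
begin

lemma pmf_predictive: "pmf (predictive G) z = marg G z"
  unfolding predictive_def
proof (rule pmf_embed_pmf)
  show "0 \<le> marg G x" for x using marg_bounds(3)[OF G, of x] by simp
  then have "(\<integral>\<^sup>+x. ennreal (marg G x) \<partial>count_space UNIV) = ennreal (\<Sum>x. marg G x)"
    using sums_marg[OF G] by (simp add: nn_integral_count_space_nat suminf_ennreal2 sums_summable)
  then show "(\<integral>\<^sup>+x. ennreal (marg G x) \<partial>count_space UNIV) = 1"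
    using sums_marg[OF G] by (simp add: sums_unique[symmetric])
qed

lemma summable_marg_mult:
  assumes "\<And>z. \<bar>f z\<bar> \<le> (B :: real)"
  shows "summable (\<lambda>z. \<bar>marg G z * f z\<bar>)"
proof (rule summable_comparison_test')
  show "summable (\<lambda>z. marg G z * B)"
    using sums_marg[OF G] by (intro summable_mult2) (rule sums_summable)
  show "norm \<bar>marg G z * f z\<bar> \<le> marg G z * B" if "0 \<le> z" for z
    using assms[of z] marg_bounds(3)[OF G, of z] by (simp add: abs_mult)
qed

lemma expectation_predictive:
  assumes "\<And>z. \<bar>f z\<bar> \<le> (B :: real)"
  shows "measure_pmf.expectation (predictive G) f = (\<Sum>z. marg G z * f z)"
  using summable_marg_mult[OF assms] by (subst integral_measure_pmf_nat) (auto simp: pmf_predictive)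

context
  fixes f H assumes f: "bdd H f"
begin

lemma abs_posterior_le: "\<bar>integral\<^sup>L (posterior z G) f\<bar> \<le> H"
  by (rule abs_integral_le_priors[OF posterior_in_priors[OF G] f])

lemma abs_posterior_diff_le: "\<bar>integral\<^sup>L (posterior z G) f - integral\<^sup>L G f\<bar> \<le> 2 * H"
  using abs_posterior_le[of z] abs_integral_le_priors[OF G f] by linarith

lemma marg_mult_posterior: "marg G z * integral\<^sup>L (posterior z G) f = (\<integral>x. poisson z x * f x \<partial>G)"
  using marg_bounds(3)[OF G, of z] by (simp add: integral_posterior[OF G f])

lemma integrable_predictive_posterior:
  "integrable (predictive G) (\<lambda>z. integral\<^sup>L (posterior z G) f)"
  "integrable (predictive G) (\<lambda>z. (integral\<^sup>L (posterior z G) f)\<^sup>2)"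
proof -
  show "integrable (predictive G) (\<lambda>z. integral\<^sup>L (posterior z G) f)"
    by (rule integrable_measure_pmf_bounded[where B = H]) (use abs_posterior_le in auto)
  have "(integral\<^sup>L (posterior z G) f)\<^sup>2 \<le> H\<^sup>2" for z
    using power_mono[OF abs_posterior_le abs_ge_zero, of z 2] by simp
  then show "integrable (predictive G) (\<lambda>z. (integral\<^sup>L (posterior z G) f)\<^sup>2)"
    by (intro integrable_measure_pmf_bounded[where B = "H\<^sup>2"]) auto
qed

text \<open>The weight \<open>marg G z\<close> cancels the normalising constant of the posterior,
  and the likelihoods then sum to 1: averaging the posteriors over the predictive law returns the
  prior.\<close>

lemma expectation_predictive_posterior:
  "measure_pmf.expectation (predictive G) (\<lambda>z. integral\<^sup>L (posterior z G) f) = integral\<^sup>L G f"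
  using sums_integral_poisson[OF G f] abs_posterior_le
  by (subst expectation_predictive) (auto simp: marg_mult_posterior dest: sums_unique[symmetric])

text \<open>Each summand is \<open>marg G z\<close> times the squared posterior mean. In this form
  numerator root and denominator are both linear in \<open>G\<close>, which is what the Lipschitz
  estimate needs.\<close>

lemma sums_predictive_variance:
  "(\<lambda>z. (\<integral>x. poisson z x * f x \<partial>G)\<^sup>2 / marg G z) sums (predictive_variance G f + (integral\<^sup>L G f)\<^sup>2)"
proof -
  let ?m = "\<lambda>z. integral\<^sup>L (posterior z G) f" and ?\<mu> = "integral\<^sup>L G f"
  have b: "\<bar>(?m z)\<^sup>2\<bar> \<le> H\<^sup>2" for z
    using power_mono[OF abs_posterior_le abs_ge_zero, of z 2] by simp
  have "predictive_variance G f = measure_pmf.expectation (predictive G) (\<lambda>z. (?m z)\<^sup>2 - 2 * ?\<mu> * ?m z + ?\<mu>\<^sup>2)"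
    by (simp add: predictive_variance_def power2_diff algebra_simps)
  also have "\<dots> = measure_pmf.expectation (predictive G) (\<lambda>z. (?m z)\<^sup>2) - ?\<mu>\<^sup>2"
    using integrable_predictive_posterior expectation_predictive_posterior by (simp add: power2_eq_square)
  also have "measure_pmf.expectation (predictive G) (\<lambda>z. (?m z)\<^sup>2) = (\<Sum>z. marg G z * (?m z)\<^sup>2)"
    by (rule expectation_predictive) (rule b)
  finally have "predictive_variance G f + ?\<mu>\<^sup>2 = (\<Sum>z. marg G z * (?m z)\<^sup>2)" by simp
  moreover have "summable (\<lambda>z. marg G z * (?m z)\<^sup>2)"
    using summable_marg_mult[OF b] by (rule summable_rabs_cancel)
  moreover have "marg G z * (?m z)\<^sup>2 = (\<integral>x. poisson z x * f x \<partial>G)\<^sup>2 / marg G z" for z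
    using marg_bounds(3)[OF G, of z]
    by (simp add: integral_posterior[OF G f] power2_eq_square)
  ultimately show ?thesis by (simp add: summable_sums)
qed

lemma predictive_variance_nonneg: "0 \<le> predictive_variance G f"
  unfolding predictive_variance_def by (rule Bochner_Integration.integral_nonneg) simp

lemma predictive_variance_le: "predictive_variance G f \<le> 4 * H\<^sup>2"
proof -
  have "\<bar>(integral\<^sup>L (posterior z G) f - integral\<^sup>L G f)\<^sup>2\<bar> \<le> 4 * H\<^sup>2" for z
    using power_mono[OF abs_posterior_diff_le abs_ge_zero, of z 2] by simp
  then show ?thesis
    using norm_integral_measure_pmf_le[of "predictive G" "\<lambda>z. (integral\<^sup>L (posterior z G) f - integral\<^sup>L G f)\<^sup>2" "4 * H\<^sup>2"]
    by (simp add: predictive_variance_def)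
qed

context
  fixes a :: real assumes a: "0 \<le> a" "a \<le> 1"
begin

text \<open>The cross term vanishes by the martingale property, whatever the reference value
  \<open>x\<close>.\<close>

lemma expectation_learn_step_square:
  "measure_pmf.expectation (predictive G) (\<lambda>z. (integral\<^sup>L (learn_step a z G) f - x)\<^sup>2)
    = (integral\<^sup>L G f - x)\<^sup>2 + a\<^sup>2 * predictive_variance G f"
proof -
  let ?m = "\<lambda>z. integral\<^sup>L (posterior z G) f" and ?\<mu> = "integral\<^sup>L G f"
  have i: "integrable (predictive G) (\<lambda>z. (?m z - ?\<mu>)\<^sup>2)"
    using integrable_predictive_posterior by (simp add: power2_diff)
  have "measure_pmf.expectation (predictive G) (\<lambda>z. (integral\<^sup>L (learn_step a z G) f - x)\<^sup>2)
    = measure_pmf.expectation (predictive G) (\<lambda>z. (?\<mu> - x)\<^sup>2 + 2 * a * (?\<mu> - x) * (?m z - ?\<mu>) + a\<^sup>2 * (?m z - ?\<mu>)\<^sup>2)"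
    by (simp add: integral_learn_step[OF G a f] power2_eq_square algebra_simps)
  also have "\<dots> = (?\<mu> - x)\<^sup>2 + a\<^sup>2 * predictive_variance G f"
    using i integrable_predictive_posterior expectation_predictive_posterior
    by (simp add: predictive_variance_def del: Bochner_Integration.integral_mult_right_zero)
  finally show ?thesis .
qed

text \<open>Second-order Taylor expansion with a mean-zero increment. The cubic remainder is uniform
  because an increment never exceeds 2 * H * a.\<close>

lemma expectation_learn_step_iexp:
  "cmod (measure_pmf.expectation (predictive G) (\<lambda>z. iexp (s * (integral\<^sup>L (learn_step a z G) f - integral\<^sup>L G f)))
     - (1 - s\<^sup>2 * a\<^sup>2 * predictive_variance G f / 2)) \<le> (2 * H * a * \<bar>s\<bar>) ^ 3 / 6"
proof -
  let ?d = "\<lambda>z. s * a * (integral\<^sup>L (posterior z G) f - integral\<^sup>L G f)"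
  let ?E = "measure_pmf.expectation (predictive G)"
  have d: "\<bar>?d z\<bar> \<le> 2 * H * a * \<bar>s\<bar>" for z
    using mult_left_mono[OF abs_posterior_diff_le[of z], of "\<bar>s\<bar> * a"] a
    by (simp add: abs_mult mult_ac)
  have i1: "integrable (predictive G) (\<lambda>z. ?d z)"
    using integrable_predictive_posterior by simp
  have i2: "integrable (predictive G) (\<lambda>z. (?d z)\<^sup>2)"
    using integrable_predictive_posterior by (simp add: power_mult_distrib power2_diff)
  have ie: "integrable (predictive G) (\<lambda>z. iexp (?d z))"
    by (rule integrable_measure_pmf_bounded[where B = 1]) simp
  have ic: "integrable (predictive G) (\<lambda>z. 1 + \<i> * ?d z - complex_of_real ((?d z)\<^sup>2 / 2))"
    by (intro Bochner_Integration.integrable_diff Bochner_Integration.integrable_add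
          measure_pmf.integrable_const integrable_mult_right integrable_of_real integrable_divide i1 i2)
  have E1: "?E ?d = 0"
    using integrable_predictive_posterior expectation_predictive_posterior by simp
  have E2: "?E (\<lambda>z. (?d z)\<^sup>2) = s\<^sup>2 * a\<^sup>2 * predictive_variance G f"
    by (simp add: predictive_variance_def power_mult_distrib)
  have "?E (\<lambda>z. 1 + \<i> * ?d z - complex_of_real ((?d z)\<^sup>2 / 2))
    = ?E (\<lambda>z. 1 + \<i> * complex_of_real (?d z)) - ?E (\<lambda>z. complex_of_real ((?d z)\<^sup>2 / 2))"
    by (intro Bochner_Integration.integral_diff Bochner_Integration.integrable_add
          measure_pmf.integrable_const integrable_mult_right integrable_of_real integrable_divide i1 i2)
  also have "?E (\<lambda>z. 1 + \<i> * complex_of_real (?d z)) = ?E (\<lambda>z. 1) + ?E (\<lambda>z. \<i> * complex_of_real (?d z))"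
    by (intro Bochner_Integration.integral_add
          measure_pmf.integrable_const integrable_mult_right integrable_of_real i1)
  also have "?E (\<lambda>z. \<i> * complex_of_real (?d z)) = \<i> * complex_of_real (?E ?d)"
    unfolding Bochner_Integration.integral_mult_right_zero integral_complex_of_real ..
  also have "?E (\<lambda>z. complex_of_real ((?d z)\<^sup>2 / 2)) = complex_of_real (?E (\<lambda>z. (?d z)\<^sup>2) / 2)"
    unfolding integral_complex_of_real Bochner_Integration.integral_divide_zero ..
  also have "?E (\<lambda>z. 1) + \<i> * complex_of_real (?E ?d) - complex_of_real (?E (\<lambda>z. (?d z)\<^sup>2) / 2)
    = 1 - s\<^sup>2 * a\<^sup>2 * predictive_variance G f / 2"
    unfolding E1 E2 by (simp add: measure_pmf.prob_space)
  finally have *: "?E (\<lambda>z. iexp (?d z)) - (1 - s\<^sup>2 * a\<^sup>2 * predictive_variance G f / 2)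
    = ?E (\<lambda>z. iexp (?d z) - (1 + \<i> * ?d z - complex_of_real ((?d z)\<^sup>2 / 2)))"
    using ie ic by (subst Bochner_Integration.integral_diff) auto
  have "cmod (iexp (?d z) - (1 + \<i> * ?d z - complex_of_real ((?d z)\<^sup>2 / 2))) \<le> (2 * H * a * \<bar>s\<bar>) ^ 3 / 6" for z
  proof -
    have "(\<Sum>k\<le>2. (\<i> * complex_of_real (?d z)) ^ k / fact k) = 1 + \<i> * ?d z - complex_of_real ((?d z)\<^sup>2 / 2)"
      by (simp add: numeral_2_eq_2 power_mult_distrib)
    then have "cmod (iexp (?d z) - (1 + \<i> * ?d z - complex_of_real ((?d z)\<^sup>2 / 2))) \<le> \<bar>?d z\<bar> ^ 3 / 6"
      using iexp_approx1[of "?d z" 2] by (simp add: fact_numeral)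
    also have "\<dots> \<le> (2 * H * a * \<bar>s\<bar>) ^ 3 / 6"
      using d[of z] by (intro divide_right_mono power_mono) auto
    finally show ?thesis .
  qed
  then have "cmod (?E (\<lambda>z. iexp (?d z)) - (1 - s\<^sup>2 * a\<^sup>2 * predictive_variance G f / 2)) \<le> (2 * H * a * \<bar>s\<bar>) ^ 3 / 6"
    unfolding * by (rule norm_integral_measure_pmf_le)
  then show ?thesis
    by (simp add: integral_learn_step[OF G a f] mult.assoc)
qed

end

end

end

text \<open>With a = m p and b = n q, the identity m^2 p - n^2 q = (m + n)(a - b) - m n (p - q)
  replaces the quotients by the means m and n, which are bounded by \<open>H\<close>. No lower bound
  on p or q enters the estimate.\<close>

lemma abs_square_div_diff_le:
  fixes a b p q H :: real
  assumes "0 < p" "0 < q" "\<bar>a\<bar> \<le> H * p" "\<bar>b\<bar> \<le> H * q"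
  shows "\<bar>a\<^sup>2 / p - b\<^sup>2 / q\<bar> \<le> 2 * H * \<bar>a - b\<bar> + H\<^sup>2 * \<bar>p - q\<bar>"
proof -
  define m n where "m = a / p" and "n = b / q"
  have mn: "\<bar>m\<bar> \<le> H" "\<bar>n\<bar> \<le> H" "a = m * p" "b = n * q"
    using assms by (auto simp: m_def n_def abs_mult field_simps)
  have "a\<^sup>2 / p - b\<^sup>2 / q = m\<^sup>2 * p - n\<^sup>2 * q"
    using assms unfolding mn by (simp add: power2_eq_square)
  also have "\<dots> = (m + n) * (a - b) - m * n * (p - q)"
    unfolding mn by (simp add: power2_eq_square algebra_simps)
  finally have "\<bar>a\<^sup>2 / p - b\<^sup>2 / q\<bar> \<le> \<bar>m + n\<bar> * \<bar>a - b\<bar> + \<bar>m\<bar> * \<bar>n\<bar> * \<bar>p - q\<bar>"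
    by (metis abs_mult abs_triangle_ineq4)
  also have "\<dots> \<le> (2 * H) * \<bar>a - b\<bar> + H * H * \<bar>p - q\<bar>"
    using mn by (intro add_mono mult_right_mono mult_mono) auto
  finally show ?thesis by (simp add: power2_eq_square)
qed

text \<open>The previous inequality, summed over the observations, bounds the difference of the
  second moments; the last term accounts for the squared means. The uniform summable bound 6 * H^2 *
  \<open>pois_ub z\<close> later justifies exchanging the sum with an expectation.\<close>

lemma abs_predictive_variance_diff_le:
  assumes G: "G \<in> priors" and G': "G' \<in> priors" and f: "bdd H f"
  shows "\<bar>predictive_variance G f - predictive_variance G' f\<bar>
    \<le> (\<Sum>z. 2 * H * \<bar>(\<integral>x. poisson z x * f x \<partial>G) - (\<integral>x. poisson z x * f x \<partial>G')\<bar> + H\<^sup>2 * \<bar>marg G z - marg G' z\<bar>)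
      + 2 * H * \<bar>integral\<^sup>L G f - integral\<^sup>L G' f\<bar>"
    and "summable (\<lambda>z. 2 * H * \<bar>(\<integral>x. poisson z x * f x \<partial>G) - (\<integral>x. poisson z x * f x \<partial>G')\<bar> + H\<^sup>2 * \<bar>marg G z - marg G' z\<bar>)"
    and "2 * H * \<bar>(\<integral>x. poisson z x * f x \<partial>G) - (\<integral>x. poisson z x * f x \<partial>G')\<bar> + H\<^sup>2 * \<bar>marg G z - marg G' z\<bar> \<le> 6 * H\<^sup>2 * pois_ub z"
proof -
  let ?A = "\<lambda>z. \<integral>x. poisson z x * f x \<partial>G" and ?A' = "\<lambda>z. \<integral>x. poisson z x * f x \<partial>G'"
  let ?u = "\<lambda>z. 2 * H * \<bar>?A z - ?A' z\<bar> + H\<^sup>2 * \<bar>marg G z - marg G' z\<bar>"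
  have H: "0 \<le> H" by (rule bdd_nonneg[OF f])
  show ub: "?u z \<le> 6 * H\<^sup>2 * pois_ub z" for z
  proof -
    have "\<bar>?A z\<bar> \<le> pois_ub z * H" "\<bar>?A' z\<bar> \<le> pois_ub z * H"
      using abs_integral_le_priors[OF _ bdd_mult[OF bdd_poisson f]] G G' by auto
    then have "\<bar>?A z - ?A' z\<bar> \<le> 2 * (pois_ub z * H)" by linarith
    then have 1: "2 * H * \<bar>?A z - ?A' z\<bar> \<le> 2 * H * (2 * (pois_ub z * H))"
      using H by (intro mult_left_mono) auto
    have "\<bar>marg G z - marg G' z\<bar> \<le> 2 * pois_ub z"
      using marg_bounds[OF G, of z] marg_bounds[OF G', of z] by linarith
    then have "H\<^sup>2 * \<bar>marg G z - marg G' z\<bar> \<le> H\<^sup>2 * (2 * pois_ub z)"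
      by (intro mult_left_mono) auto
    with 1 show ?thesis by (simp add: power2_eq_square algebra_simps)
  qed
  have sm: "summable (\<lambda>z. 6 * H\<^sup>2 * pois_ub z)"
    using sums_pois_ub by (intro summable_mult) (rule sums_summable)
  show su: "summable ?u"
    by (rule summable_comparison_test'[OF sm, of 0]) (use ub H in auto)
  have trm: "\<bar>(?A z)\<^sup>2 / marg G z - (?A' z)\<^sup>2 / marg G' z\<bar> \<le> ?u z" for z
  proof (rule abs_square_div_diff_le)
    show "0 < marg G z" "0 < marg G' z" using marg_bounds[OF G] marg_bounds[OF G'] by auto
    then show "\<bar>?A z\<bar> \<le> H * marg G z" "\<bar>?A' z\<bar> \<le> H * marg G' z"
      using abs_posterior_le[OF G f, of z] abs_posterior_le[OF G' f, of z]
      by (auto simp: marg_mult_posterior[OF G f, symmetric] marg_mult_posterior[OF G' f, symmetric] abs_mult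
          mult.commute[of H] intro!: mult_left_mono)
  qed
  have sd: "summable (\<lambda>z. \<bar>(?A z)\<^sup>2 / marg G z - (?A' z)\<^sup>2 / marg G' z\<bar>)"
    by (rule summable_comparison_test'[OF su, of 0]) (simp only: real_norm_def abs_abs trm)
  have "(predictive_variance G f + (integral\<^sup>L G f)\<^sup>2) - (predictive_variance G' f + (integral\<^sup>L G' f)\<^sup>2)
      = (\<Sum>z. (?A z)\<^sup>2 / marg G z - (?A' z)\<^sup>2 / marg G' z)"
    by (rule sums_unique) (intro sums_diff sums_predictive_variance[OF G f] sums_predictive_variance[OF G' f])
  also have "\<bar>\<dots>\<bar> \<le> (\<Sum>z. \<bar>(?A z)\<^sup>2 / marg G z - (?A' z)\<^sup>2 / marg G' z\<bar>)"
    by (rule summable_rabs[OF sd])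
  also have "\<dots> \<le> suminf ?u"
    by (rule suminf_le[OF trm sd su])
  finally have 1: "\<bar>(predictive_variance G f + (integral\<^sup>L G f)\<^sup>2) - (predictive_variance G' f + (integral\<^sup>L G' f)\<^sup>2)\<bar> \<le> suminf ?u" .
  have "\<bar>(integral\<^sup>L G f)\<^sup>2 - (integral\<^sup>L G' f)\<^sup>2\<bar> = \<bar>integral\<^sup>L G f + integral\<^sup>L G' f\<bar> * \<bar>integral\<^sup>L G f - integral\<^sup>L G' f\<bar>"
    by (simp add: abs_mult[symmetric] power2_eq_square algebra_simps)
  also have "\<dots> \<le> (2 * H) * \<bar>integral\<^sup>L G f - integral\<^sup>L G' f\<bar>"
    using abs_integral_le_priors[OF G f] abs_integral_le_priors[OF G' f] by (intro mult_right_mono) auto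
  finally show "\<bar>predictive_variance G f - predictive_variance G' f\<bar> \<le> suminf ?u + 2 * H * \<bar>integral\<^sup>L G f - integral\<^sup>L G' f\<bar>"
    using 1 by linarith
qed

end

section \<open>The chain of learned measures\<close>

lemma abs_exp_minus_linear_le:
  fixes x :: real
  assumes "0 \<le> x"
  shows "\<bar>exp (- x) - (1 - x)\<bar> \<le> x\<^sup>2 / 2"
proof -
  \<comment> \<open>The product equals 1 + x^4 / 4.\<close>
  have "1 \<le> (1 - x + x\<^sup>2 / 2) * (1 + x + x\<^sup>2 / 2)"
    using assms by (simp add: power2_eq_square algebra_simps)
  also have "\<dots> \<le> (1 - x + x\<^sup>2 / 2) * exp x"
  proof (rule mult_left_mono)
    show "1 + x + x\<^sup>2 / 2 \<le> exp x" using exp_lower_Taylor_quadratic[OF assms] by simp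
    have "0 \<le> ((1 - x)\<^sup>2 + 1) / 2" by simp
    then show "0 \<le> 1 - x + x\<^sup>2 / 2" by (simp add: power2_eq_square field_simps)
  qed
  finally have "exp (- x) \<le> 1 - x + x\<^sup>2 / 2"
    by (simp add: exp_minus field_simps)
  moreover have "1 - x \<le> exp (- x)" using exp_ge_add_one_self[of "- x"] by simp
  ultimately show ?thesis by simp
qed

text \<open>Jensen's inequality for the square, read off from the nonnegativity of the variance of
  the absolute value.\<close>

lemma expectation_pmf_abs_le_sqrt:
  fixes f :: "'a \<Rightarrow> real"
  assumes "\<And>x. \<bar>f x\<bar> \<le> B" "measure_pmf.expectation p (\<lambda>x. (f x)\<^sup>2) \<le> c"
  shows "measure_pmf.expectation p (\<lambda>x. \<bar>f x\<bar>) \<le> sqrt c"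
proof -
  have "integrable p (\<lambda>x. \<bar>f x\<bar>)"
    by (rule integrable_measure_pmf_bounded[where B = B]) (use assms in simp)
  moreover have "integrable p (\<lambda>x. \<bar>f x\<bar>\<^sup>2)"
  proof (rule integrable_measure_pmf_bounded)
    show "norm (\<bar>f x\<bar>\<^sup>2) \<le> B\<^sup>2" for x
      using power_mono[OF assms(1) abs_ge_zero, of x 2] by simp
  qed
  ultimately have "(measure_pmf.expectation p (\<lambda>x. \<bar>f x\<bar>))\<^sup>2 \<le> measure_pmf.expectation p (\<lambda>x. \<bar>f x\<bar>\<^sup>2)"
    using measure_pmf.variance_eq[of p "\<lambda>x. \<bar>f x\<bar>"] measure_pmf.variance_positive[of p "\<lambda>x. \<bar>f x\<bar>"]
    by simp
  with assms(2) show ?thesis by (intro real_le_rsqrt) simp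
qed

locale poisson_learning = poisson_interval lo hi for lo hi +
  fixes \<alpha> :: "nat \<Rightarrow> real" and G0 :: "real measure"
  assumes G0_in_priors: "G0 \<in> priors" and rate: "\<And>n. 0 \<le> \<alpha> (Suc n)" "\<And>n. \<alpha> (Suc n) \<le> 1"
begin

text \<open>Observation histories are lists with the most recent observation first.\<close>

primrec learned :: "nat list \<Rightarrow> real measure" where
  "learned [] = G0"
| "learned (z # l) = learn_step (\<alpha> (Suc (length l))) z (learned l)"

text \<open>The law of the history after \<open>k\<close> further observations when \<open>l\<close>
  has been seen. It refers to no underlying probability space, so moments and characteristic
  functions can be treated by induction on \<open>k\<close>.\<close>

primrec hist_law :: "nat list \<Rightarrow> nat \<Rightarrow> nat list pmf" where
  "hist_law l 0 = return_pmf l"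
| "hist_law l (Suc k) = bind_pmf (hist_law l k) (\<lambda>l'. map_pmf (\<lambda>z. z # l') (predictive (learned l')))"

definition sqsum :: "nat \<Rightarrow> nat \<Rightarrow> real" where
  "sqsum n k = (\<Sum>j<k. (\<alpha> (Suc (n + j)))\<^sup>2)"

lemma learned_in_priors: "learned l \<in> priors"
  by (induction l) (auto intro: G0_in_priors learn_step_in_priors rate)

lemma sqsum_nonneg: "0 \<le> sqsum n k"
  unfolding sqsum_def by (intro sum_nonneg) simp

lemma sqsum_Suc: "sqsum n (Suc k) = sqsum n k + (\<alpha> (Suc (n + k)))\<^sup>2"
  by (simp add: sqsum_def)

lemma sqsum_Suc_shift: "sqsum n (Suc k) = (\<alpha> (Suc n))\<^sup>2 + sqsum (Suc n) k"
  unfolding sqsum_def by (subst sum.lessThan_Suc_shift) simp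

lemma set_hist_law: "l' \<in> set_pmf (hist_law l k) \<Longrightarrow> length l' = length l + k \<and> drop k l' = l"
  by (induction k arbitrary: l') auto

text \<open>The recursion splits off the last observation; this form splits off the first new one,
  as the maximal inequality requires.\<close>

lemma hist_law_first_step: "hist_law l (Suc k) = bind_pmf (predictive (learned l)) (\<lambda>z. hist_law (z # l) k)"
proof (induction k)
  case 0
  show ?case by (simp add: bind_return_pmf map_pmf_def)
next
  case (Suc k)
  have "hist_law l (Suc (Suc k)) = bind_pmf (hist_law l (Suc k)) (\<lambda>l'. map_pmf (\<lambda>z. z # l') (predictive (learned l')))"
    by simp
  also have "\<dots> = bind_pmf (predictive (learned l)) (\<lambda>z. hist_law (z # l) (Suc k))"
    unfolding Suc bind_assoc_pmf by simp
  finally show ?case .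
qed

lemma hist_law_add: "hist_law l (m + k) = bind_pmf (hist_law l m) (\<lambda>l'. hist_law l' k)"
  by (induction k) (simp_all add: bind_return_pmf' bind_assoc_pmf)

lemma expectation_hist_law_Suc:
  fixes \<phi> :: "nat list \<Rightarrow> real"
  assumes "\<And>l. \<bar>\<phi> l\<bar> \<le> B"
  shows "measure_pmf.expectation (hist_law l (Suc k)) \<phi>
    = measure_pmf.expectation (hist_law l k) (\<lambda>l'. measure_pmf.expectation (predictive (learned l')) (\<lambda>z. \<phi> (z # l')))"
  unfolding hist_law.simps by (subst integral_bind_pmf_real[OF assms]) simp

lemma expectation_hist_law_Suc_complex:
  fixes \<phi> :: "nat list \<Rightarrow> complex"
  assumes "\<And>l. cmod (\<phi> l) \<le> B"
  shows "measure_pmf.expectation (hist_law l (Suc k)) \<phi>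
    = measure_pmf.expectation (hist_law l k) (\<lambda>l'. measure_pmf.expectation (predictive (learned l')) (\<lambda>z. \<phi> (z # l')))"
  unfolding hist_law.simps by (subst integral_bind_pmf_complex[OF assms]) simp

section \<open>Moments and characteristic functions along the chain\<close>

context
  fixes f H assumes f: "bdd H f"
begin

lemma abs_learned_le: "\<bar>integral\<^sup>L (learned l) f\<bar> \<le> H"
  by (rule abs_integral_le_priors[OF learned_in_priors f])

lemma abs_learned_diff_le: "\<bar>integral\<^sup>L (learned l) f - x\<bar> \<le> H + \<bar>x\<bar>"
  using abs_learned_le[of l] by linarith

lemma square_learned_diff_le: "\<bar>(integral\<^sup>L (learned l) f - x)\<^sup>2\<bar> \<le> (H + \<bar>x\<bar>)\<^sup>2"
  using power_mono[OF abs_learned_diff_le abs_ge_zero, of l x 2] by simp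

lemma expectation_learned: "measure_pmf.expectation (hist_law l k) (\<lambda>l'. integral\<^sup>L (learned l') f) = integral\<^sup>L (learned l) f"
proof (induction k)
  case (Suc k)
  have "measure_pmf.expectation (predictive (learned l')) (\<lambda>z. integral\<^sup>L (learned (z # l')) f) = integral\<^sup>L (learned l') f" for l'
    using integrable_predictive_posterior[OF learned_in_priors f, of l'] expectation_predictive_posterior[OF learned_in_priors f, of l']
    by (simp add: integral_learn_step[OF learned_in_priors rate f])
  then show ?case
    using Suc by (subst expectation_hist_law_Suc[OF abs_learned_le]) simp
qed simp

text \<open>Orthogonality of the increments: the step with rate a adds a^2 times a predictive
  variance, and the latter is at most 4 * H^2.\<close>

lemma second_moment_le:
  "measure_pmf.expectation (hist_law l k) (\<lambda>l'. (integral\<^sup>L (learned l') f - x)\<^sup>2)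
    \<le> (integral\<^sup>L (learned l) f - x)\<^sup>2 + 4 * H\<^sup>2 * sqsum (length l) k"
proof (induction k)
  case (Suc k)
  let ?E = "measure_pmf.expectation (hist_law l k)" and ?a = "\<alpha> (Suc (length l + k))"
  have "measure_pmf.expectation (hist_law l (Suc k)) (\<lambda>l'. (integral\<^sup>L (learned l') f - x)\<^sup>2)
    = ?E (\<lambda>l'. (integral\<^sup>L (learned l') f - x)\<^sup>2 + (\<alpha> (Suc (length l')))\<^sup>2 * predictive_variance (learned l') f)"
    by (subst expectation_hist_law_Suc[OF square_learned_diff_le])
       (simp add: expectation_learn_step_square[OF learned_in_priors f rate])
  also have "\<dots> \<le> ?E (\<lambda>l'. (integral\<^sup>L (learned l') f - x)\<^sup>2 + ?a\<^sup>2 * (4 * H\<^sup>2))"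
  proof (rule integral_measure_pmf_mono)
    fix l' assume "l' \<in> set_pmf (hist_law l k)"
    then have len: "length l' = length l + k" using set_hist_law by blast
    have v: "0 \<le> ?a\<^sup>2 * predictive_variance (learned l') f" "?a\<^sup>2 * predictive_variance (learned l') f \<le> ?a\<^sup>2 * (4 * H\<^sup>2)"
      using predictive_variance_le[OF learned_in_priors f, of l'] predictive_variance_nonneg[OF learned_in_priors f, of l']
      by (auto intro: mult_left_mono)
    then show "(integral\<^sup>L (learned l') f - x)\<^sup>2 + (\<alpha> (Suc (length l')))\<^sup>2 * predictive_variance (learned l') f
        \<le> (integral\<^sup>L (learned l') f - x)\<^sup>2 + ?a\<^sup>2 * (4 * H\<^sup>2)"
      unfolding len by simp
    show "\<bar>(integral\<^sup>L (learned l') f - x)\<^sup>2 + (\<alpha> (Suc (length l')))\<^sup>2 * predictive_variance (learned l') f\<bar>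
        \<le> (H + \<bar>x\<bar>)\<^sup>2 + ?a\<^sup>2 * (4 * H\<^sup>2)"
      unfolding len using square_learned_diff_le[of l' x] v by simp
    show "\<bar>(integral\<^sup>L (learned l') f - x)\<^sup>2 + ?a\<^sup>2 * (4 * H\<^sup>2)\<bar> \<le> (H + \<bar>x\<bar>)\<^sup>2 + ?a\<^sup>2 * (4 * H\<^sup>2)"
      using square_learned_diff_le[of l' x] v by simp
  qed
  also have "\<dots> = ?E (\<lambda>l'. (integral\<^sup>L (learned l') f - x)\<^sup>2) + ?a\<^sup>2 * (4 * H\<^sup>2)"
  proof -
    have "integrable (hist_law l k) (\<lambda>l'. (integral\<^sup>L (learned l') f - x)\<^sup>2)"
      by (rule integrable_measure_pmf_bounded) (simp only: real_norm_def, rule square_learned_diff_le)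
    then show ?thesis by (simp add: measure_pmf.prob_space)
  qed
  finally show ?case using Suc by (simp add: sqsum_Suc algebra_simps)
qed (simp add: sqsum_def)

lemma first_moment_le:
  "measure_pmf.expectation (hist_law l k) (\<lambda>l'. \<bar>integral\<^sup>L (learned l') f - integral\<^sup>L (learned l) f\<bar>)
    \<le> 2 * H * sqrt (sqsum (length l) k)"
proof -
  have "measure_pmf.expectation (hist_law l k) (\<lambda>l'. \<bar>integral\<^sup>L (learned l') f - integral\<^sup>L (learned l) f\<bar>)
    \<le> sqrt (4 * H\<^sup>2 * sqsum (length l) k)"
    using second_moment_le[of l k "integral\<^sup>L (learned l) f"]
    by (intro expectation_pmf_abs_le_sqrt[OF abs_learned_diff_le]) simp
  also have "\<dots> = 2 * H * sqrt (sqsum (length l) k)"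
    using bdd_nonneg[OF f] by (simp add: real_sqrt_mult)
  finally show ?thesis .
qed

end

context
  fixes f H assumes f: "bdd H f"
begin

text \<open>Each integral in the Lipschitz bound is itself a martingale and moves by at most 2 *
  (its bound) * sqrt (\<open>sqsum\<close>) in mean. Summing 6 * H^2 * \<open>pois_ub z\<close> over
  z yields 6 * exp hi; the remaining 4 comes from the squared means.\<close>

lemma predictive_variance_moment_le:
  "measure_pmf.expectation (hist_law l k) (\<lambda>l'. \<bar>predictive_variance (learned l') f - predictive_variance (learned l) f\<bar>)
    \<le> (6 * exp hi + 4) * H\<^sup>2 * sqrt (sqsum (length l) k)"
proof -
  let ?E = "measure_pmf.expectation (hist_law l k)" and ?r = "sqrt (sqsum (length l) k)"
  let ?a = "\<lambda>z l'. \<bar>(\<integral>x. poisson z x * f x \<partial>learned l') - (\<integral>x. poisson z x * f x \<partial>learned l)\<bar>"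
  let ?p = "\<lambda>z l'. \<bar>marg (learned l') z - marg (learned l) z\<bar>"
  let ?u = "\<lambda>z l'. 2 * H * ?a z l' + H\<^sup>2 * ?p z l'"
  let ?m = "\<lambda>l'. \<bar>integral\<^sup>L (learned l') f - integral\<^sup>L (learned l) f\<bar>"
  have H: "0 \<le> H" by (rule bdd_nonneg[OF f])
  have u: "0 \<le> ?u z l'" "?u z l' \<le> 6 * H\<^sup>2 * pois_ub z" for z l'
    using H abs_predictive_variance_diff_le(3)[OF learned_in_priors learned_in_priors f] by auto
  have sm: "summable (\<lambda>z. 6 * H\<^sup>2 * pois_ub z)"
    using sums_pois_ub by (intro summable_mult) (rule sums_summable)
  have iu: "integrable (hist_law l k) (?u z)" for z
    by (rule integrable_measure_pmf_bounded[where B = "6 * H\<^sup>2 * pois_ub z"]) (use u in simp)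
  have su: "summable (\<lambda>z. ?u z l')" for l'
    by (rule abs_predictive_variance_diff_le(2)[OF learned_in_priors learned_in_priors f])
  have sus: "summable (\<lambda>z. norm (?u z l'))" for l'
    using su[of l'] by (simp only: real_norm_def abs_of_nonneg[OF u(1)])
  have Eu: "?E (?u z) \<le> 6 * H\<^sup>2 * ?r * pois_ub z" for z
  proof -
    have 1: "?E (?a z) \<le> 2 * (pois_ub z * H) * ?r"
      by (rule first_moment_le[OF bdd_mult[OF bdd_poisson f]])
    have 2: "?E (?p z) \<le> 2 * pois_ub z * ?r"
      unfolding marg_def by (rule first_moment_le[OF bdd_poisson])
    have 3: "integrable (hist_law l k) (?a z)"
      by (rule integrable_measure_pmf_bounded) (simp, rule abs_learned_diff_le[OF bdd_mult[OF bdd_poisson f]])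
    have 4: "integrable (hist_law l k) (?p z)"
      unfolding marg_def
      by (rule integrable_measure_pmf_bounded) (simp, rule abs_learned_diff_le[OF bdd_poisson])
    have "?E (?u z) = 2 * H * ?E (?a z) + H\<^sup>2 * ?E (?p z)"
      using 3 4 by simp
    also have "\<dots> \<le> 2 * H * (2 * (pois_ub z * H) * ?r) + H\<^sup>2 * (2 * pois_ub z * ?r)"
      using H 1 2 by (intro add_mono mult_left_mono) auto
    finally have "?E (?u z) \<le> 2 * H * (2 * (pois_ub z * H) * ?r) + H\<^sup>2 * (2 * pois_ub z * ?r)" .
    then show ?thesis by (simp add: power2_eq_square algebra_simps)
  qed
  have sEu: "summable (\<lambda>z. ?E (?u z))"
  proof (rule summable_comparison_test'[OF sm, of 0])
    show "norm (?E (?u z)) \<le> 6 * H\<^sup>2 * pois_ub z" for z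
      by (rule norm_integral_measure_pmf_le) (use u in simp)
  qed
  have 1: "(\<lambda>z. ?E (?u z)) sums ?E (\<lambda>l'. \<Sum>z. ?u z l')"
    using sEu u(1) by (intro sums_integral iu AE_I2 sus) simp
  have sEu': "summable (\<lambda>z. 6 * H\<^sup>2 * ?r * pois_ub z)"
    using sums_pois_ub by (intro summable_mult) (rule sums_summable)
  have "?E (\<lambda>l'. \<Sum>z. ?u z l') = (\<Sum>z. ?E (?u z))"
    by (rule sums_unique[OF 1])
  also have "\<dots> \<le> (\<Sum>z. 6 * H\<^sup>2 * ?r * pois_ub z)"
    by (rule suminf_le[OF Eu sEu sEu'])
  also have "\<dots> = 6 * H\<^sup>2 * ?r * exp hi"
    by (rule sums_unique[symmetric]) (intro sums_mult sums_pois_ub)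
  finally have 2: "?E (\<lambda>l'. \<Sum>z. ?u z l') \<le> 6 * H\<^sup>2 * ?r * exp hi" .
  have bu: "\<bar>\<Sum>z. ?u z l'\<bar> \<le> (\<Sum>z. 6 * H\<^sup>2 * pois_ub z)" for l'
    using suminf_le[OF u(2) su[of l'] sm] suminf_nonneg[OF su[of l'] u(1)] by simp
  then have ius: "integrable (hist_law l k) (\<lambda>l'. \<Sum>z. ?u z l')"
    by (intro integrable_measure_pmf_bounded) simp
  have bm: "\<bar>?m l'\<bar> \<le> 2 * H" for l'
    using abs_learned_le[OF f, of l] abs_learned_le[OF f, of l'] by linarith
  then have im: "integrable (hist_law l k) ?m"
    by (intro integrable_measure_pmf_bounded) simp
  have bv: "\<bar>predictive_variance (learned l') f - predictive_variance (learned l) f\<bar> \<le> 8 * H\<^sup>2" for l'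
    using predictive_variance_le[OF learned_in_priors f, of l] predictive_variance_le[OF learned_in_priors f, of l'] predictive_variance_nonneg[OF learned_in_priors f, of l] predictive_variance_nonneg[OF learned_in_priors f, of l']
    by linarith
  then have iv: "integrable (hist_law l k) (\<lambda>l'. \<bar>predictive_variance (learned l') f - predictive_variance (learned l) f\<bar>)"
    by (intro integrable_measure_pmf_bounded) simp
  have "?E (\<lambda>l'. \<bar>predictive_variance (learned l') f - predictive_variance (learned l) f\<bar>) \<le> ?E (\<lambda>l'. (\<Sum>z. ?u z l') + 2 * H * ?m l')"
    using abs_predictive_variance_diff_le(1)[OF learned_in_priors learned_in_priors f]
    by (intro integral_mono iv Bochner_Integration.integrable_add ius integrable_mult_right im) simp
  also have "\<dots> = ?E (\<lambda>l'. \<Sum>z. ?u z l') + 2 * H * ?E ?m"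
    using ius im by simp
  also have "\<dots> \<le> 6 * H\<^sup>2 * ?r * exp hi + 2 * H * (2 * H * ?r)"
    using H 2 first_moment_le[OF f, of l k] by (intro add_mono mult_left_mono) auto
  finally show ?thesis by (simp add: power2_eq_square algebra_simps)
qed

text \<open>The Gaussian target uses the variance frozen at \<open>l\<close>. Each step with rate b
  costs at most b^2 times a fixed factor, whose three terms come from freezing the variance, from
  the cubic Taylor remainder, and from replacing 1 - x by exp (- x). Pulling out b^2 makes the
  accumulated cost proportional to \<open>sqsum\<close>.\<close>

lemma char_bound:
  assumes R: "\<And>k. sqsum (length l) k \<le> R" and a: "\<And>j. \<alpha> (Suc (length l + j)) \<le> a"
  shows "cmod (measure_pmf.expectation (hist_law l k) (\<lambda>l'. iexp (s * (integral\<^sup>L (learned l') f - integral\<^sup>L (learned l) f)))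
      - exp (- (s\<^sup>2 * predictive_variance (learned l) f * sqsum (length l) k / 2)))
    \<le> sqsum (length l) k *
      (s\<^sup>2 / 2 * ((6 * exp hi + 4) * H\<^sup>2 * sqrt R) + (2 * H * \<bar>s\<bar>) ^ 3 * a / 6 + 2 * s ^ 4 * a\<^sup>2 * H ^ 4)"
    (is "_ \<le> _ * ?err")
proof (induction k)
  case 0
  show ?case by (simp add: sqsum_def)
next
  case (Suc k)
  let ?E = "measure_pmf.expectation (hist_law l k)" and ?b = "\<alpha> (Suc (length l + k))" and ?V = "predictive_variance (learned l) f"
  let ?e = "\<lambda>l'. iexp (s * (integral\<^sup>L (learned l') f - integral\<^sup>L (learned l) f))"
  let ?c = "\<lambda>l'. measure_pmf.expectation (predictive (learned l'))
    (\<lambda>z. iexp (s * (integral\<^sup>L (learn_step (\<alpha> (Suc (length l'))) z (learned l')) f - integral\<^sup>L (learned l') f)))"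
  \<comment> \<open>The factor by which the Gaussian target changes in one step.\<close>
  define g where "g = exp (- (s\<^sup>2 * ?V * ?b\<^sup>2 / 2))"
  define D where "D = (2 * H * ?b * \<bar>s\<bar>) ^ 3 / 6 + 2 * s ^ 4 * ?b ^ 4 * H ^ 4"
  have H: "0 \<le> H" by (rule bdd_nonneg[OF f])
  have b: "0 \<le> ?b" "?b \<le> a" using rate a by auto
  have V: "0 \<le> ?V" "?V \<le> 4 * H\<^sup>2" using predictive_variance_nonneg[OF learned_in_priors f] predictive_variance_le[OF learned_in_priors f] by auto
  have e1: "cmod (?e l') \<le> 1" for l' by simp
  have c1: "cmod (?c l') \<le> 1" for l'
    by (rule norm_integral_measure_pmf_le) simp
  have g1: "0 \<le> g" "g \<le> 1" using V by (auto simp: g_def)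
  have split: "?e (z # l') = ?e l' * iexp (s * (integral\<^sup>L (learn_step (\<alpha> (Suc (length l'))) z (learned l')) f - integral\<^sup>L (learned l') f))" for z l'
    by (simp add: exp_add[symmetric] algebra_simps)
  have "measure_pmf.expectation (hist_law l (Suc k)) ?e = ?E (\<lambda>l'. ?e l' * ?c l')"
    by (subst expectation_hist_law_Suc_complex[OF e1], unfold split) simp
  moreover have "?E (\<lambda>l'. ?e l' * complex_of_real g) = ?E ?e * complex_of_real g"
    by simp
  moreover have "integrable (hist_law l k) (\<lambda>l'. ?e l' * ?c l')"
    by (rule integrable_measure_pmf_bounded[where B = 1])
       (use c1 in \<open>simp add: norm_mult\<close>)
  moreover have "integrable (hist_law l k) (\<lambda>l'. ?e l' * complex_of_real g)"
    by (rule integrable_measure_pmf_bounded[where B = 1]) (use g1 in \<open>simp add: norm_mult\<close>)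
  ultimately have eq: "measure_pmf.expectation (hist_law l (Suc k)) ?e - ?E ?e * complex_of_real g
      = ?E (\<lambda>l'. ?e l' * (?c l' - complex_of_real g))"
    by (simp add: right_diff_distrib)
  have taylor: "\<bar>g - (1 - s\<^sup>2 * ?V * ?b\<^sup>2 / 2)\<bar> \<le> 2 * s ^ 4 * ?b ^ 4 * H ^ 4"
  proof -
    have "\<bar>g - (1 - s\<^sup>2 * ?V * ?b\<^sup>2 / 2)\<bar> \<le> (s\<^sup>2 * ?V * ?b\<^sup>2 / 2)\<^sup>2 / 2"
      unfolding g_def using V by (intro abs_exp_minus_linear_le) simp
    also have "\<dots> \<le> (s\<^sup>2 * (4 * H\<^sup>2) * ?b\<^sup>2 / 2)\<^sup>2 / 2"
      using V by (intro divide_right_mono power_mono mult_right_mono mult_left_mono) auto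
    also have "\<dots> = 2 * s ^ 4 * ?b ^ 4 * H ^ 4"
      by (simp add: power_mult_distrib power_divide)
    finally show ?thesis .
  qed
  have pw: "cmod (?e l' * (?c l' - complex_of_real g)) \<le> D + s\<^sup>2 * ?b\<^sup>2 / 2 * \<bar>predictive_variance (learned l') f - ?V\<bar>"
    if "l' \<in> set_pmf (hist_law l k)" for l'
  proof -
    have len: "length l' = length l + k" using set_hist_law[OF that] by simp
    let ?q = "s\<^sup>2 * ?b\<^sup>2 * predictive_variance (learned l') f / 2" and ?Q = "s\<^sup>2 * ?V * ?b\<^sup>2 / 2"
    have "cmod (?c l' - complex_of_real (1 - ?q)) \<le> (2 * H * ?b * \<bar>s\<bar>) ^ 3 / 6"
      using expectation_learn_step_iexp[OF learned_in_priors[of l'] f rate(1)[of "length l'"] rate(2)[of "length l'"], of s] unfolding len by simp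
    moreover have tri: "cmod (u + v - w) \<le> cmod u + cmod v + cmod w" for u v w
      using norm_triangle_ineq4[of "u + v" w] norm_triangle_ineq[of u v] by linarith
    have split': "?c l' - complex_of_real g = (?c l' - complex_of_real (1 - ?q))
       + complex_of_real (?Q - ?q) - complex_of_real (g - (1 - ?Q))"
      by simp
    have "cmod (?c l' - complex_of_real g) \<le> cmod (?c l' - complex_of_real (1 - ?q))
       + cmod (complex_of_real (?Q - ?q)) + cmod (complex_of_real (g - (1 - ?Q)))"
      unfolding split' by (rule tri)
    then have "cmod (?c l' - complex_of_real g) \<le> cmod (?c l' - complex_of_real (1 - ?q)) + \<bar>?Q - ?q\<bar> + \<bar>g - (1 - ?Q)\<bar>"
      unfolding norm_of_real .
    moreover have "\<bar>?Q - ?q\<bar> = s\<^sup>2 * ?b\<^sup>2 / 2 * \<bar>predictive_variance (learned l') f - ?V\<bar>"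
    proof -
      have "?Q - ?q = - (s\<^sup>2 * ?b\<^sup>2 / 2 * (predictive_variance (learned l') f - ?V))" by (simp add: field_simps)
      then show ?thesis by (simp only: abs_minus_cancel abs_mult) simp
    qed
    ultimately show ?thesis using taylor by (simp add: norm_mult D_def)
  qed
  have bv: "\<bar>predictive_variance (learned l') f - predictive_variance (learned l) f\<bar> \<le> 8 * H\<^sup>2" for l'
    using predictive_variance_le[OF learned_in_priors f, of l] predictive_variance_le[OF learned_in_priors f, of l'] predictive_variance_nonneg[OF learned_in_priors f, of l] predictive_variance_nonneg[OF learned_in_priors f, of l']
    by linarith
  then have iv: "integrable (hist_law l k) (\<lambda>l'. \<bar>predictive_variance (learned l') f - ?V\<bar>)"
    by (intro integrable_measure_pmf_bounded) simp
  have ie: "integrable (hist_law l k) (\<lambda>l'. ?e l' * (?c l' - complex_of_real g))"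
  proof (rule integrable_measure_pmf_bounded[where B = 2])
    show "cmod (?e l' * (?c l' - complex_of_real g)) \<le> 2" for l'
      using norm_triangle_ineq4[of "?c l'" "complex_of_real g"] c1[of l'] g1 by (simp add: norm_mult)
  qed
  have "cmod (?E (\<lambda>l'. ?e l' * (?c l' - complex_of_real g))) \<le> ?E (\<lambda>l'. cmod (?e l' * (?c l' - complex_of_real g)))"
    by (rule integral_norm_bound)
  also have "\<dots> \<le> ?E (\<lambda>l'. D + s\<^sup>2 * ?b\<^sup>2 / 2 * \<bar>predictive_variance (learned l') f - ?V\<bar>)"
    using pw by (intro integral_mono_AE integrable_norm ie Bochner_Integration.integrable_add
        measure_pmf.integrable_const integrable_mult_right iv) (simp add: AE_measure_pmf_iff)
  also have "\<dots> = D + s\<^sup>2 * ?b\<^sup>2 / 2 * ?E (\<lambda>l'. \<bar>predictive_variance (learned l') f - ?V\<bar>)"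
    using iv by (simp add: measure_pmf.prob_space)
  also have "\<dots> \<le> D + s\<^sup>2 * ?b\<^sup>2 / 2 * ((6 * exp hi + 4) * H\<^sup>2 * sqrt R)"
  proof -
    have "?E (\<lambda>l'. \<bar>predictive_variance (learned l') f - ?V\<bar>) \<le> (6 * exp hi + 4) * H\<^sup>2 * sqrt (sqsum (length l) k)"
      by (rule predictive_variance_moment_le)
    also have "\<dots> \<le> (6 * exp hi + 4) * H\<^sup>2 * sqrt R"
      using R[of k] by (intro mult_left_mono) (auto intro: add_nonneg_nonneg)
    finally show ?thesis by (intro add_left_mono mult_left_mono) auto
  qed
  also have "\<dots> \<le> ?b\<^sup>2 * ?err"
  proof -
    have "(2 * H * ?b * \<bar>s\<bar>) ^ 3 / 6 = ?b\<^sup>2 * ((2 * H * \<bar>s\<bar>) ^ 3 * ?b / 6)"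
      by (simp add: power_mult_distrib power3_eq_cube power2_eq_square)
    also have "\<dots> \<le> ?b\<^sup>2 * ((2 * H * \<bar>s\<bar>) ^ 3 * a / 6)"
      using b H by (intro mult_left_mono divide_right_mono) auto
    finally have 1: "(2 * H * ?b * \<bar>s\<bar>) ^ 3 / 6 \<le> ?b\<^sup>2 * ((2 * H * \<bar>s\<bar>) ^ 3 * a / 6)" .
    have "2 * s ^ 4 * ?b ^ 4 * H ^ 4 = ?b\<^sup>2 * (2 * s ^ 4 * ?b\<^sup>2 * H ^ 4)"
      by (simp add: power4_eq_xxxx power2_eq_square)
    also have "\<dots> \<le> ?b\<^sup>2 * (2 * s ^ 4 * a\<^sup>2 * H ^ 4)"
      using b by (intro mult_left_mono mult_right_mono power_mono) auto
    finally show ?thesis using 1 unfolding D_def by (simp add: algebra_simps)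
  qed
  finally have step: "cmod (measure_pmf.expectation (hist_law l (Suc k)) ?e - ?E ?e * complex_of_real g) \<le> ?b\<^sup>2 * ?err"
    unfolding eq .
  let ?g = "\<lambda>k. exp (- (s\<^sup>2 * ?V * sqsum (length l) k / 2))"
  have gS: "?g (Suc k) = ?g k * g"
    unfolding g_def sqsum_Suc exp_add[symmetric] by (simp add: algebra_simps add_divide_distrib)
  \<comment> \<open>The new error is the one-step error plus the old error times \<open>g\<close>.
    Since \<open>g\<close> is at most 1, errors add up without growing.\<close>
  have "measure_pmf.expectation (hist_law l (Suc k)) ?e - complex_of_real (?g (Suc k))
      = (measure_pmf.expectation (hist_law l (Suc k)) ?e - ?E ?e * complex_of_real g)
        + (?E ?e - complex_of_real (?g k)) * complex_of_real g"
    unfolding gS by (simp add: algebra_simps)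
  moreover have "cmod (u + v * complex_of_real g) \<le> cmod u + cmod v * g" for u v
    using norm_triangle_ineq[of u "v * complex_of_real g"] g1(1) by (simp add: norm_mult)
  ultimately have "cmod (measure_pmf.expectation (hist_law l (Suc k)) ?e - complex_of_real (?g (Suc k)))
      \<le> cmod (measure_pmf.expectation (hist_law l (Suc k)) ?e - ?E ?e * complex_of_real g)
        + cmod (?E ?e - complex_of_real (?g k)) * g"
    by (simp only:)
  also have "\<dots> \<le> ?b\<^sup>2 * ?err + cmod (?E ?e - complex_of_real (?g k)) * 1"
    using step g1 by (intro add_mono mult_left_mono) auto
  also have "\<dots> \<le> ?b\<^sup>2 * ?err + sqsum (length l) k * ?err"
    using Suc by simp
  also have "\<dots> = sqsum (length l) (Suc k) * ?err"
    unfolding sqsum_Suc distrib_right by (rule add.commute)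
  finally show ?case .
qed

text \<open>Kolmogorov's inequality without stopping times. The right-hand side is at least 1 if the
  starting value already deviates by \<epsilon>; otherwise the induction hypothesis is averaged over
  the first observation, and the second moment grows by at most one term of
  \<open>sqsum\<close>.\<close>

lemma maximal_inequality:
  assumes "0 < \<epsilon>"
  shows "measure_pmf.prob (hist_law l k) {l'. \<exists>j\<le>k. \<epsilon> \<le> \<bar>integral\<^sup>L (learned (drop j l')) f - x\<bar>}
    \<le> ((integral\<^sup>L (learned l) f - x)\<^sup>2 + 4 * H\<^sup>2 * sqsum (length l) k) / \<epsilon>\<^sup>2"
proof (induction k arbitrary: l)
  case 0
  have "1 \<le> (integral\<^sup>L (learned l) f - x)\<^sup>2 / \<epsilon>\<^sup>2" if "\<epsilon> \<le> \<bar>integral\<^sup>L (learned l) f - x\<bar>"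
    using power_mono[OF that, of 2] assms by simp
  then show ?case
    by (auto simp: sqsum_def indicator_def)
next
  case (Suc k)
  let ?A = "\<lambda>k. {l'. \<exists>j\<le>k. \<epsilon> \<le> \<bar>integral\<^sup>L (learned (drop j l')) f - x\<bar>}"
  let ?G = "integral\<^sup>L (learned l) f - x"
  show ?case
  proof (cases "\<epsilon> \<le> \<bar>?G\<bar>")
    case True
    have "1 \<le> ?G\<^sup>2 / \<epsilon>\<^sup>2"
      using power_mono[OF True, of 2] assms by simp
    also have "\<dots> \<le> (?G\<^sup>2 + 4 * H\<^sup>2 * sqsum (length l) (Suc k)) / \<epsilon>\<^sup>2"
      using sqsum_nonneg by (intro divide_right_mono) auto
    finally show ?thesis
      using measure_pmf.prob_le_1 order_trans by blast
  next
    case False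
    \<comment> \<open>Dropping \<open>Suc k\<close> entries leads back to \<open>l\<close>, whose
      value is closer to \<open>x\<close> than \<epsilon> in this case, so that index adds nothing
      to the event.\<close>
    have eq: "measure_pmf.prob (hist_law (z # l) k) (?A (Suc k)) = measure_pmf.prob (hist_law (z # l) k) (?A k)" for z
    proof (rule measure_pmf.finite_measure_eq_AE)
      show "AE l' in hist_law (z # l) k. (l' \<in> ?A (Suc k)) = (l' \<in> ?A k)"
      proof (rule AE_pmfI)
        fix l' assume "l' \<in> set_pmf (hist_law (z # l) k)"
        then have "drop k l' = z # l" using set_hist_law by blast
        then have "drop (Suc k) l' = l" by (metis drop_Suc tl_drop list.sel(3))
        then show "(l' \<in> ?A (Suc k)) = (l' \<in> ?A k)" using False by (auto simp: le_Suc_eq)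
      qed
    qed auto
    let ?E = "measure_pmf.expectation (predictive (learned l))"
    let ?B = "\<lambda>z. ((integral\<^sup>L (learned (z # l)) f - x)\<^sup>2 + 4 * H\<^sup>2 * sqsum (Suc (length l)) k) / \<epsilon>\<^sup>2"
    have iG: "integrable (predictive (learned l)) (\<lambda>z. (integral\<^sup>L (learned (z # l)) f - x)\<^sup>2)"
      by (rule integrable_measure_pmf_bounded) (simp only: real_norm_def, rule square_learned_diff_le[OF f])
    have "measure_pmf.prob (hist_law l (Suc k)) (?A (Suc k))
        = measure_pmf.expectation (hist_law l (Suc k)) (indicator (?A (Suc k)))"
      by simp
    also have "\<dots> = ?E (\<lambda>z. measure_pmf.expectation (hist_law (z # l) k) (indicator (?A (Suc k))))"
      unfolding hist_law_first_step by (rule integral_bind_pmf_real[where B = 1]) (simp add: indicator_def)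
    also have "\<dots> = ?E (\<lambda>z. measure_pmf.prob (hist_law (z # l) k) (?A k))"
      by (simp add: eq)
    also have "\<dots> \<le> ?E ?B"
    proof (rule integral_mono)
      show "integrable (predictive (learned l)) (\<lambda>z. measure_pmf.prob (hist_law (z # l) k) (?A k))"
        by (rule integrable_measure_pmf_bounded[where B = 1]) simp
      show "integrable (predictive (learned l)) ?B"
        using iG by simp
      show "measure_pmf.prob (hist_law (z # l) k) (?A k) \<le> ?B z" for z
        using Suc.IH[of "z # l"] by simp
    qed
    also have "?E ?B = (?E (\<lambda>z. (integral\<^sup>L (learned (z # l)) f - x)\<^sup>2) + 4 * H\<^sup>2 * sqsum (Suc (length l)) k) / \<epsilon>\<^sup>2"
      using iG by (simp add: measure_pmf.prob_space)
    also have "?E (\<lambda>z. (integral\<^sup>L (learned (z # l)) f - x)\<^sup>2) = ?G\<^sup>2 + (\<alpha> (Suc (length l)))\<^sup>2 * predictive_variance (learned l) f"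
      by (simp add: expectation_learn_step_square[OF learned_in_priors f rate])
    also have "\<dots> \<le> ?G\<^sup>2 + (\<alpha> (Suc (length l)))\<^sup>2 * (4 * H\<^sup>2)"
      using predictive_variance_le[OF learned_in_priors f, of l] by (intro add_left_mono mult_left_mono) auto
    finally show ?thesis
      by (simp add: sqsum_Suc_shift algebra_simps divide_right_mono)
  qed
qed

end

end

section \<open>The learning model on a probability space\<close>

lemma pmf_map_inj_Cons: "pmf (map_pmf (\<lambda>z. z # l) p) (z # l') = (if l = l' then pmf p z else 0)"
proof (cases "l = l'")
  case True
  have "inj (\<lambda>z. z # l)" by (auto simp: inj_def)
  then show ?thesis using True pmf_map_inj'[of "\<lambda>z. z # l" p z] by simp
next
  case False
  then show ?thesis by (auto simp: pmf_eq_0_set_pmf)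
qed

locale learning_process = poisson_learning lo hi \<alpha> G0 for lo hi \<alpha> G0 +
  fixes M :: "'a measure" and Y :: "nat \<Rightarrow> 'a \<Rightarrow> nat"
  assumes model: "learning_model M \<alpha> G0 Y"
    and square_summable: "summable (\<lambda>n. (\<alpha> (Suc n))\<^sup>2)"

sublocale learning_process \<subseteq> prob_space M
  using model by (simp add: learning_model_def)

context learning_process
begin

abbreviation F :: "nat \<Rightarrow> 'a measure" where
  "F \<equiv> gen_filtration M Y"

primrec hist :: "nat \<Rightarrow> 'a \<Rightarrow> nat list" where
  "hist 0 \<omega> = []"
| "hist (Suc n) \<omega> = Y (Suc n) \<omega> # hist n \<omega>"

section \<open>Atoms of the filtration and conditional laws on them\<close>

definition atom :: "nat list \<Rightarrow> 'a set" where
  "atom l = {\<omega>\<in>space M. hist (length l) \<omega> = l}"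

abbreviation U :: "nat list \<Rightarrow> 'a measure" where
  "U l \<equiv> uniform_measure M (atom l)"

lemma length_hist [simp]: "length (hist n \<omega>) = n"
  by (induction n) auto

lemma drop_hist: "drop k (hist (n + k) \<omega>) = hist n \<omega>"
  by (induction k) auto

lemma learned_hist: "learned (hist n \<omega>) = learn \<alpha> G0 (\<lambda>k. Y k \<omega>) n"
  by (induction n) auto

lemma Y_measurable: "Y (Suc n) \<in> M \<rightarrow>\<^sub>M count_space UNIV"
  using model by (auto simp: learning_model_def)

lemma space_F [simp]: "space (F n) = space M"
  unfolding gen_filtration_def by (rule space_measure_of) auto

lemma sets_F: "sets (F n) = sigma_sets (space M) {Y i -` A \<inter> space M | i A. 1 \<le> i \<and> i \<le> n}"
  unfolding gen_filtration_def by (rule sets_measure_of) auto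

lemma hist_measurable_F: "k \<le> n \<Longrightarrow> hist k \<in> F n \<rightarrow>\<^sub>M count_space UNIV"
proof (induction k)
  case 0
  have "hist 0 = (\<lambda>_. [])" by (simp add: fun_eq_iff)
  then show ?case by simp
next
  case (Suc k)
  have IH: "hist k -` {l} \<inter> space M \<in> sets (F n)" for l
    using measurable_sets[OF Suc.IH, of "{l}"] Suc.prems by simp
  have Y: "Y (Suc k) -` {z} \<inter> space M \<in> sets (F n)" for z
    unfolding sets_F using Suc.prems by (intro sigma_sets.Basic) auto
  show ?case
  proof (subst measurable_count_space_eq_countable, simp, intro conjI ballI)
    fix l :: "nat list"
    show "hist (Suc k) -` {l} \<inter> space (F n) \<in> sets (F n)"
    proof (cases l)
      case (Cons z l')
      then have "hist (Suc k) -` {l} \<inter> space (F n) = (Y (Suc k) -` {z} \<inter> space M) \<inter> (hist k -` {l'} \<inter> space M)"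
        by auto
      then show ?thesis using sets.Int[OF Y IH] by simp
    next
      case Nil
      then have "hist (Suc k) -` {l} \<inter> space (F n) = {}" by auto
      then show ?thesis by (simp only: sets.empty_sets)
    qed
  qed auto
qed

text \<open>The generators depend on \<omega> only through the first \<open>n\<close> observations,
  and this property passes through complements and countable unions.\<close>

lemma sets_F_saturated:
  assumes "E \<in> sets (F n)" "\<omega> \<in> space M" "\<omega>' \<in> space M" "hist n \<omega> = hist n \<omega>'"
  shows "\<omega> \<in> E \<longleftrightarrow> \<omega>' \<in> E"
proof -
  have *: "Y i \<omega> = Y i \<omega>'" if "1 \<le> i" "i \<le> n" for i
    using assms(4) that
  proof (induction n)
    case (Suc n)
    then show ?case by (cases "i = Suc n") auto
  qed simp
  from assms(1) show ?thesis
    unfolding sets_F using assms(2,3) by (induction rule: sigma_sets.induct) (auto simp: *)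
qed

lemma subalgebra_F: "subalgebra M (F n)"
proof -
  have "{Y i -` A \<inter> space M | i A. 1 \<le> i \<and> i \<le> n} \<subseteq> sets M"
  proof clarify
    fix i :: nat and A :: "nat set" assume "1 \<le> i"
    then show "Y i -` A \<inter> space M \<in> sets M"
      using measurable_sets[OF Y_measurable[of "i - 1"], of A] by simp
  qed
  then show ?thesis
    unfolding subalgebra_def by (simp add: sets_F sets.sigma_sets_subset)
qed

lemma hist_measurable [measurable]: "hist n \<in> M \<rightarrow>\<^sub>M count_space UNIV"
  using measurable_from_subalg[OF subalgebra_F hist_measurable_F[OF order_refl]] .

lemma measurable_F_const:
  assumes "f \<in> borel_measurable (F n)" "\<omega> \<in> space M" "\<omega>' \<in> space M" "hist n \<omega> = hist n \<omega>'"
  shows "f \<omega>' = (f \<omega> :: real)"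
proof -
  have "f -` {f \<omega>} \<inter> space (F n) \<in> sets (F n)"
    using assms(1) by (rule measurable_sets) simp
  from sets_F_saturated[OF this assms(2-4)] show ?thesis using assms(2,3) by simp
qed

lemma atom_in_F: "atom l \<in> sets (F (length l))"
proof -
  have "atom l = hist (length l) -` {l} \<inter> space (F (length l))" by (auto simp: atom_def)
  then show ?thesis using measurable_sets[OF hist_measurable_F[OF order_refl]] by simp
qed

lemma atom_measurable [measurable]: "atom l \<in> sets M"
  using atom_in_F[of l] subalgebra_F[of "length l"] by (auto simp: subalgebra_def)

text \<open>A conditional expectation is constant on the atom, so integrating it over the atom
  identifies its value. The multiplied form also covers null atoms.\<close>

lemma real_cond_exp_atom:
  assumes E: "E \<in> sets M" and \<omega>: "\<omega> \<in> atom l"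
  shows "real_cond_exp M (F (length l)) (indicator E) \<omega> * prob (atom l) = prob (atom l \<inter> E)"
proof -
  interpret finite_measure_subalgebra M "F (length l)"
    using subalgebra_F by unfold_locales
  have ae: "real_cond_exp M (F (length l)) (indicator E) x = real_cond_exp M (F (length l)) (indicator E) \<omega>"
    if "x \<in> atom l" for x
    using \<omega> that by (intro measurable_F_const[of _ "length l"]) (auto simp: atom_def)
  have "(\<integral>x\<in>atom l. indicator E x \<partial>M) = (\<integral>x\<in>atom l. real_cond_exp M (F (length l)) (indicator E) x \<partial>M)"
    using E by (intro real_cond_exp_intA atom_in_F) (auto simp: integrable_indicator_iff emeasure_eq_measure)
  also have "\<dots> = (\<integral>x\<in>atom l. real_cond_exp M (F (length l)) (indicator E) \<omega> \<partial>M)"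
    using ae by (intro set_lebesgue_integral_cong) auto
  also have "\<dots> = real_cond_exp M (F (length l)) (indicator E) \<omega> * prob (atom l)"
    by (simp add: set_lebesgue_integral_def)
  also have "(\<integral>x\<in>atom l. indicator E x \<partial>M) = prob (atom l \<inter> E)"
    using E by (simp add: set_lebesgue_integral_def indicator_inter_arith[symmetric])
  finally show ?thesis by simp
qed

text \<open>An almost sure identity between quantities constant on an atom becomes exact there: one
  good point suffices, and an atom of positive probability contains one.\<close>

lemma ex_atom_AE:
  assumes "prob (atom l) \<noteq> 0" and ae: "AE \<omega> in M. P \<omega>"
  shows "\<exists>\<omega>\<in>atom l. P \<omega>"
proof (rule ccontr)
  assume "\<not> ?thesis"
  then have "\<omega> \<notin> atom l" if "P \<omega>" for \<omega> using that by blast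
  then have "AE \<omega> in M. \<omega> \<notin> atom l" by (rule eventually_mono[OF ae])
  then show False
    using assms(1) by (subst (asm) AE_iff_measurable[of "atom l"]) (auto simp: atom_def emeasure_eq_measure)
qed

text \<open>The model equation evaluated at one good point of the atom gives the chain rule; a null
  atom makes both sides 0.\<close>

lemma prob_atom_Cons: "prob (atom (z # l)) = prob (atom l) * marg (learned l) z"
proof (cases "prob (atom l) = 0")
  case True
  have "atom (z # l) \<subseteq> atom l" by (auto simp: atom_def)
  then have "prob (atom (z # l)) \<le> prob (atom l)" by (intro finite_measure_mono) auto
  with True show ?thesis by (simp add: measure_le_0_iff)
next
  case False
  let ?n = "length l" and ?E = "{\<omega>\<in>space M. Y (Suc (length l)) \<omega> = z}"
  have E: "?E \<in> sets M"
  proof -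
    have "?E = Y (Suc ?n) -` {z} \<inter> space M" by auto
    then show ?thesis using measurable_sets[OF Y_measurable, of "{z}"] by simp
  qed
  have "AE \<omega> in M. real_cond_exp M (F ?n) (indicator ?E) \<omega> = marg (learn \<alpha> G0 (\<lambda>k. Y k \<omega>) ?n) z"
    using model by (auto simp: learning_model_def)
  then have ae: "AE \<omega> in M. real_cond_exp M (F ?n) (indicator ?E) \<omega> = marg (learned (hist ?n \<omega>)) z"
    by (simp add: learned_hist)
  obtain \<omega> where \<omega>: "\<omega> \<in> atom l" "real_cond_exp M (F ?n) (indicator ?E) \<omega> = marg (learned (hist ?n \<omega>)) z"
    using ex_atom_AE[OF False ae] by blast
  have "marg (learned l) z * prob (atom l) = prob (atom l \<inter> ?E)"
    using real_cond_exp_atom[OF E \<omega>(1)] \<omega> by (simp add: atom_def)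
  also have "atom l \<inter> ?E = atom (z # l)" by (auto simp: atom_def)
  finally show ?thesis by (simp add: mult.commute)
qed

lemma prob_atom_hist_law:
  assumes "length l' = length l + k" "drop k l' = l"
  shows "prob (atom l') = prob (atom l) * pmf (hist_law l k) l'"
  using assms
proof (induction k arbitrary: l')
  case 0
  then show ?case by simp
next
  case (Suc k)
  then obtain z l'' where l': "l' = z # l''" by (cases l') auto
  have "pmf (hist_law l (Suc k)) l' = measure_pmf.expectation (hist_law l k) (\<lambda>l1. indicator {l''} l1 * pmf (predictive (learned l'')) z)"
    unfolding hist_law.simps pmf_bind l'
    by (intro Bochner_Integration.integral_cong) (auto simp: pmf_map_inj_Cons)
  also have "\<dots> = pmf (hist_law l k) l'' * marg (learned l'') z"
    by (simp add: pmf_predictive[OF learned_in_priors] measure_pmf_single)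
  finally show ?case
    using Suc.IH[of l''] Suc.prems unfolding l' prob_atom_Cons by simp
qed

context
  fixes l assumes pos: "0 < prob (atom l)"
begin

lemma prob_space_U: "prob_space (U l)"
  using pos by (intro prob_space_uniform_measure) (auto simp: emeasure_eq_measure)

lemma measure_U: "E \<in> sets M \<Longrightarrow> measure (U l) E = prob (atom l \<inter> E) / prob (atom l)"
  using pos by (intro measure_uniform_measure) (auto simp: emeasure_eq_measure)

lemma AE_U: "AE x in M. P x \<Longrightarrow> AE x in U l. P x"
  by (rule AE_uniform_measureI[OF atom_measurable]) (erule eventually_mono, simp)

text \<open>Transfers statements about \<open>hist_law\<close> to the probability space: conditioned
  on the atom of \<open>l\<close>, the future histories follow the recursion restarted at
  \<open>l\<close>. By countability it is enough to compare single histories.\<close>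

lemma distr_hist: "distr (U l) (count_space UNIV) (hist (length l + k)) = measure_pmf (hist_law l k)"
proof (rule measure_eqI_countable[where A = UNIV])
  interpret U: prob_space "U l" by (rule prob_space_U)
  fix l' :: "nat list"
  have m: "hist (length l + k) \<in> U l \<rightarrow>\<^sub>M count_space UNIV" by simp
  let ?E = "hist (length l + k) -` {l'} \<inter> space M"
  have E: "?E \<in> sets M" by (rule measurable_sets[OF hist_measurable]) simp
  have "measure (U l) ?E = pmf (hist_law l k) l'"
  proof (cases "length l' = length l + k \<and> drop k l' = l")
    case True
    then have len: "length l' = length l + k" and d: "drop k l' = l" by auto
    have "hist (length l) \<omega> = l" if "hist (length l + k) \<omega> = l'" for \<omega>
      using drop_hist[of k "length l" \<omega>] unfolding that d by simp
    then have "atom l \<inter> ?E = atom l'"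
      unfolding atom_def len by blast
    then show ?thesis
      using prob_atom_hist_law[OF len d] pos by (simp add: measure_U[OF E])
  next
    case False
    then have "l' \<notin> set_pmf (hist_law l k)" using set_hist_law by blast
    moreover have "hist (length l) \<omega> \<noteq> l" if "hist (length l + k) \<omega> = l'" for \<omega>
      using drop_hist[of k "length l" \<omega>] length_hist[of "length l + k" \<omega>] False unfolding that by metis
    then have "atom l \<inter> ?E = {}"
      unfolding atom_def by blast
    ultimately show ?thesis by (simp add: measure_U[OF E] pmf_eq_0_set_pmf)
  qed
  then show "emeasure (distr (U l) (count_space UNIV) (hist (length l + k))) {l'} = emeasure (hist_law l k) {l'}"
    using m by (simp add: emeasure_distr U.emeasure_eq_measure emeasure_pmf_single)
qed auto

lemma integral_hist:
  fixes \<phi> :: "nat list \<Rightarrow> 'b::{banach, second_countable_topology}"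
  shows "(\<integral>\<omega>. \<phi> (hist (length l + k) \<omega>) \<partial>U l) = measure_pmf.expectation (hist_law l k) \<phi>"
  unfolding distr_hist[symmetric] by (rule integral_distr[symmetric]) auto

end

lemma atom_Nil: "atom [] = space M"
  by (auto simp: atom_def)

lemma U_Nil: "U [] = M"
proof (rule measure_eqI)
  fix E assume "E \<in> sets (U [])"
  then show "emeasure (U []) E = emeasure M E"
    using sets.sets_into_space[of E M] by (simp add: atom_Nil emeasure_space_1 Int_absorb1 divide_ennreal_def)
qed simp

lemma distr_hist_M: "distr M (count_space UNIV) (hist k) = measure_pmf (hist_law [] k)"
  using distr_hist[of "[]" k] U_Nil by (simp add: atom_Nil prob_space)

lemma integral_hist_M:
  fixes \<phi> :: "nat list \<Rightarrow> 'b::{banach, second_countable_topology}"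
  shows "(\<integral>\<omega>. \<phi> (hist k \<omega>) \<partial>M) = measure_pmf.expectation (hist_law [] k) \<phi>"
  using integral_hist[of "[]" \<phi> k] U_Nil by (simp add: atom_Nil prob_space)

lemma learned_hist_measurable [measurable]: "(\<lambda>\<omega>. integral\<^sup>L (learned (hist n \<omega>)) f) \<in> borel_measurable M"
  by (rule measurable_compose[OF hist_measurable]) simp

lemma increment_ge_measurable:
  fixes f :: "real \<Rightarrow> real"
  shows "{\<omega>\<in>space M. \<epsilon> \<le> \<bar>integral\<^sup>L (learned (hist m \<omega>)) f - integral\<^sup>L (learned (hist n \<omega>)) f\<bar>} \<in> sets M"
    (is "?A \<in> _")
proof -
  let ?d = "\<lambda>\<omega>. \<bar>integral\<^sup>L (learned (hist m \<omega>)) f - integral\<^sup>L (learned (hist n \<omega>)) f\<bar>"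
  have "?d \<in> borel_measurable M"
    by (rule borel_measurable_abs, rule borel_measurable_diff) (rule learned_hist_measurable)+
  moreover have "?A = ?d -` {\<epsilon>..} \<inter> space M" by auto
  ultimately show ?thesis using measurable_sets[of ?d M borel "{\<epsilon>..}"] by simp
qed

section \<open>Tails of the squared rates and oscillation of the learned integrals\<close>

lemma sums_tail: "(\<lambda>j. (\<alpha> (Suc (n + j)))\<^sup>2) sums tail_sq \<alpha> (Suc n)"
proof -
  have "summable (\<lambda>j. (\<alpha> (Suc (n + j)))\<^sup>2)"
    using summable_ignore_initial_segment[OF square_summable, of n] by (simp add: add.commute)
  then show ?thesis by (simp add: tail_sq_def summable_sums)
qed

lemma sqsum_le_tail: "sqsum n k \<le> tail_sq \<alpha> (Suc n)"
  unfolding sqsum_def sums_unique[OF sums_tail]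
  by (rule sum_le_suminf[OF sums_summable[OF sums_tail]]) auto

lemma sqsum_tendsto: "(\<lambda>k. sqsum n k) \<longlonglongrightarrow> tail_sq \<alpha> (Suc n)"
  using sums_tail unfolding sums_def sqsum_def .

lemma tail_tendsto_0: "(\<lambda>n. tail_sq \<alpha> (Suc n)) \<longlonglongrightarrow> 0"
  using suminf_exist_split2[OF square_summable] by (simp add: tail_sq_def add.commute)

text \<open>The maximal inequality holds on each atom at time \<open>n\<close> with a bound free of
  the atom; averaging over the histories and letting the horizon grow gives the estimate for the
  whole future.\<close>

lemma prob_oscillation_le:
  assumes f: "bdd H f" and \<epsilon>: "0 < \<epsilon>"
  shows "prob {\<omega>\<in>space M. \<exists>j. \<epsilon> \<le> \<bar>integral\<^sup>L (learned (hist (n + j) \<omega>)) f - integral\<^sup>L (learned (hist n \<omega>)) f\<bar>}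
    \<le> 4 * H\<^sup>2 * tail_sq \<alpha> (Suc n) / \<epsilon>\<^sup>2"
proof -
  define A where "A k = {\<omega>\<in>space M. \<exists>j\<le>k. \<epsilon> \<le> \<bar>integral\<^sup>L (learned (hist (n + j) \<omega>)) f - integral\<^sup>L (learned (hist n \<omega>)) f\<bar>}" for k
  have bound: "prob (A k) \<le> 4 * H\<^sup>2 * tail_sq \<alpha> (Suc n) / \<epsilon>\<^sup>2" for k
  proof -
    let ?S = "\<lambda>x. {l'. \<exists>j\<le>k. \<epsilon> \<le> \<bar>integral\<^sup>L (learned (drop j l')) f - x\<bar>}"
    \<comment> \<open>The random reference value at time \<open>n\<close> is recovered from the
      longer history by dropping \<open>k\<close> entries. The event is thus a set of histories, and
      after conditioning on time \<open>n\<close> the reference becomes a constant.\<close>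
    let ?T = "{l'. l' \<in> ?S (integral\<^sup>L (learned (drop k l')) f)}"
    have "hist (n + k) \<omega> \<in> ?T \<longleftrightarrow> (\<exists>j\<le>k. \<epsilon> \<le> \<bar>integral\<^sup>L (learned (hist (n + j) \<omega>)) f - integral\<^sup>L (learned (hist n \<omega>)) f\<bar>)" for \<omega>
    proof -
      have d: "drop j (hist (n + k) \<omega>) = hist (n + (k - j)) \<omega>" if "j \<le> k" for j
        using drop_hist[of j "n + (k - j)" \<omega>] that by simp
      have "hist (n + k) \<omega> \<in> ?T \<longleftrightarrow> (\<exists>j\<le>k. \<epsilon> \<le> \<bar>integral\<^sup>L (learned (hist (n + (k - j)) \<omega>)) f - integral\<^sup>L (learned (hist n \<omega>)) f\<bar>)"
        using d drop_hist by auto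
      also have "\<dots> \<longleftrightarrow> (\<exists>j\<le>k. \<epsilon> \<le> \<bar>integral\<^sup>L (learned (hist (n + j) \<omega>)) f - integral\<^sup>L (learned (hist n \<omega>)) f\<bar>)"
        by (metis diff_diff_cancel diff_le_self)
      finally show ?thesis .
    qed
    then have "A k = hist (n + k) -` ?T \<inter> space M"
      by (auto simp: A_def)
    then have "prob (A k) = measure (distr M (count_space UNIV) (hist (n + k))) ?T"
      by (subst measure_distr) auto
    also have "\<dots> = measure_pmf.expectation (hist_law [] (n + k)) (indicator ?T)"
      unfolding distr_hist_M by simp
    also have "\<dots> = measure_pmf.expectation (hist_law [] n) (\<lambda>l. measure_pmf.expectation (hist_law l k) (indicator ?T))"
      unfolding hist_law_add by (rule integral_bind_pmf_real[where B = 1]) (simp add: indicator_def)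
    also have "\<dots> \<le> measure_pmf.expectation (hist_law [] n) (\<lambda>l. 4 * H\<^sup>2 * tail_sq \<alpha> (Suc n) / \<epsilon>\<^sup>2)"
    proof (rule integral_mono_AE)
      show "integrable (hist_law [] n) (\<lambda>l. measure_pmf.expectation (hist_law l k) (indicator ?T :: _ \<Rightarrow> real))"
        by (rule integrable_measure_pmf_bounded[where B = 1]) simp
      show "AE l in hist_law [] n. measure_pmf.expectation (hist_law l k) (indicator ?T) \<le> 4 * H\<^sup>2 * tail_sq \<alpha> (Suc n) / \<epsilon>\<^sup>2"
      proof (rule AE_pmfI)
        fix l assume "l \<in> set_pmf (hist_law [] n)"
        then have len: "length l = n" using set_hist_law by fastforce
        have "measure_pmf.expectation (hist_law l k) (indicator ?T) = measure_pmf.prob (hist_law l k) ?T" by simp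
        also have "\<dots> = measure_pmf.prob (hist_law l k) (?S (integral\<^sup>L (learned l) f))"
        proof (rule measure_pmf.finite_measure_eq_AE)
          show "AE l' in hist_law l k. (l' \<in> ?T) = (l' \<in> ?S (integral\<^sup>L (learned l) f))"
          proof (rule AE_pmfI)
            fix l' assume "l' \<in> set_pmf (hist_law l k)"
            then have "drop k l' = l" using set_hist_law by blast
            then show "(l' \<in> ?T) = (l' \<in> ?S (integral\<^sup>L (learned l) f))" by simp
          qed
        qed auto
        also have "\<dots> \<le> 4 * H\<^sup>2 * sqsum n k / \<epsilon>\<^sup>2"
          using maximal_inequality[OF f \<epsilon>, of l k "integral\<^sup>L (learned l) f"] len by simp
        also have "\<dots> \<le> 4 * H\<^sup>2 * tail_sq \<alpha> (Suc n) / \<epsilon>\<^sup>2"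
          using sqsum_le_tail by (intro divide_right_mono mult_left_mono) auto
        finally show "measure_pmf.expectation (hist_law l k) (indicator ?T) \<le> 4 * H\<^sup>2 * tail_sq \<alpha> (Suc n) / \<epsilon>\<^sup>2" .
      qed
    qed simp
    finally show ?thesis by (simp add: measure_pmf.prob_space)
  qed
  have A_sets: "A k \<in> sets M" for k
    unfolding A_def
    by (intro sets.sets_Collect_countable_Ex sets.sets_Collect_conj sets.sets_Collect_const increment_ge_measurable)
  have "incseq A" by (auto simp: incseq_def A_def intro: order_trans)
  then have "(\<lambda>k. prob (A k)) \<longlonglongrightarrow> prob (\<Union>k. A k)"
    using A_sets by (intro finite_Lim_measure_incseq) auto
  moreover have "(\<Union>k. A k) = {\<omega>\<in>space M. \<exists>j. \<epsilon> \<le> \<bar>integral\<^sup>L (learned (hist (n + j) \<omega>)) f - integral\<^sup>L (learned (hist n \<omega>)) f\<bar>}"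
    by (auto simp: A_def)
  ultimately show ?thesis
    using bound by (auto intro: LIMSEQ_le_const2)
qed

text \<open>Oscillation of size 1 / (m + 1) after every time n has probability 0, since the tails of
  the squared rates vanish. Off these countably many null sets the sequence is Cauchy; no continuity
  of \<open>f\<close> is involved.\<close>

lemma AE_convergent_learned:
  assumes f: "bdd H f"
  shows "AE \<omega> in M. convergent (\<lambda>n. integral\<^sup>L (learned (hist n \<omega>)) f)"
proof -
  let ?X = "\<lambda>n \<omega>. integral\<^sup>L (learned (hist n \<omega>)) f"
  let ?N = "\<lambda>m n. {\<omega>\<in>space M. \<exists>j. inverse (real (Suc m)) \<le> \<bar>?X (n + j) \<omega> - ?X n \<omega>\<bar>}"
  have N_sets: "?N m n \<in> sets M" for m n
    by (intro sets.sets_Collect_countable_Ex increment_ge_measurable)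
  have "prob (\<Inter>n. ?N m n) = 0" for m
  proof -
    have "prob (\<Inter>n. ?N m n) \<le> 4 * H\<^sup>2 * tail_sq \<alpha> (Suc n) / (inverse (real (Suc m)))\<^sup>2" for n
    proof -
      have "prob (\<Inter>n. ?N m n) \<le> prob (?N m n)"
        using N_sets by (intro finite_measure_mono) auto
      also have "\<dots> \<le> 4 * H\<^sup>2 * tail_sq \<alpha> (Suc n) / (inverse (real (Suc m)))\<^sup>2"
        by (rule prob_oscillation_le[OF f]) simp
      finally show ?thesis .
    qed
    then have le: "\<exists>n0. \<forall>n\<ge>n0. prob (\<Inter>n. ?N m n) \<le> 4 * H\<^sup>2 * tail_sq \<alpha> (Suc n) / (inverse (real (Suc m)))\<^sup>2"
      by blast
    have "(\<lambda>n. 4 * H\<^sup>2 * tail_sq \<alpha> (Suc n) / (inverse (real (Suc m)))\<^sup>2) \<longlonglongrightarrow> 4 * H\<^sup>2 * 0 / (inverse (real (Suc m)))\<^sup>2"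
      by (intro tendsto_intros tail_tendsto_0) simp
    from LIMSEQ_le_const[OF this le]
    have "prob (\<Inter>n. ?N m n) \<le> 4 * H\<^sup>2 * 0 / (inverse (real (Suc m)))\<^sup>2" .
    then show ?thesis by (simp add: measure_le_0_iff)
  qed
  moreover have "(\<Inter>n. ?N m n) \<in> sets M" for m
    using N_sets by (intro sets.countable_INT) auto
  ultimately have "AE \<omega> in M. \<omega> \<notin> (\<Inter>n. ?N m n)" for m
    by (subst AE_iff_measurable[of "\<Inter>n. ?N m n"]) (auto simp: emeasure_eq_measure)
  then have "AE \<omega> in M. \<forall>m. \<omega> \<notin> (\<Inter>n. ?N m n)"
    by (simp only: AE_all_countable) blast
  then show ?thesis
    using AE_space
  proof eventually_elim
    case (elim \<omega>)
    have "Cauchy (\<lambda>n. ?X n \<omega>)"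
    proof (rule metric_CauchyI)
      fix e :: real assume "0 < e"
      then obtain m where m: "inverse (real (Suc m)) < e / 2"
        using reals_Archimedean[of "e / 2"] by auto
      from elim obtain n where n: "\<bar>?X (n + j) \<omega> - ?X n \<omega>\<bar> < inverse (real (Suc m))" for j
        by (auto simp: not_le)
      have "dist (?X i \<omega>) (?X k \<omega>) < e" if "n \<le> i" "n \<le> k" for i k
        using n[of "i - n"] n[of "k - n"] m that by (simp add: dist_real_def)
      then show "\<exists>n. \<forall>i\<ge>n. \<forall>k\<ge>n. dist (?X i \<omega>) (?X k \<omega>) < e" by blast
    qed
    then show ?case by (rule real_Cauchy_convergent)
  qed
qed

end

section \<open>Identification of the limit\<close>

lemma (in poisson_interval) integral_cong_priors:
  assumes G: "G \<in> priors" and "f \<in> borel_measurable borel" "g \<in> borel_measurable borel"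
    and "\<And>x. x \<in> {lo..hi} \<Longrightarrow> f x = (g x :: real)"
  shows "integral\<^sup>L G f = integral\<^sup>L G g"
  using assms by (intro integral_cong_AE AE_priors_I[OF G] priors_measurable[OF G])

lemma isCont_cts_step: "a < b \<Longrightarrow> isCont (cts_step a b) x"
  using uniformly_continuous_imp_continuous[OF cts_step_uniformly_continuous]
  by (simp add: continuous_on_eq_continuous_at)

lemma cts_step_tendsto_indicator:
  "(\<lambda>j. cts_step \<theta> (\<theta> + inverse (real (Suc j))) x) \<longlonglongrightarrow> indicator {..\<theta>} x"
proof (cases "x \<le> \<theta>")
  case True
  then show ?thesis by (simp add: cts_step_def)
next
  case False
  then obtain j where j: "inverse (real (Suc j)) < x - \<theta>"
    using reals_Archimedean[of "x - \<theta>"] by auto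
  have "cts_step \<theta> (\<theta> + inverse (real (Suc i))) x = indicator {..\<theta>} x" if "j \<le> i" for i
  proof -
    have "inverse (real (Suc i)) \<le> inverse (real (Suc j))" using that by simp
    with j have "\<theta> + inverse (real (Suc i)) \<le> x" by linarith
    with False show ?thesis by (simp add: cts_step_def)
  qed
  then show ?thesis
    by (intro tendsto_eventually eventually_sequentiallyI[of j])
qed

lemma cts_step_bounds: "a < b \<Longrightarrow> 0 \<le> cts_step a b x" "a < b \<Longrightarrow> cts_step a b x \<le> 1"
  by (auto simp: cts_step_def)

lemma indicator_le_cts_step: "a < b \<Longrightarrow> indicator {..a} x \<le> cts_step a b x"
  by (auto simp: cts_step_def indicator_def)

locale learning_limit = learning_process lo hi \<alpha> G0 M Y
  for lo hi \<alpha> G0 and M :: "'a measure" and Y +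
  fixes Glim :: "'a \<Rightarrow> real measure"
  assumes Glim: "random_prob_measure_on M {lo..hi} Glim"
    and weak_limit: "AE \<omega> in M. weak_conv_m (\<lambda>n. learn \<alpha> G0 (\<lambda>k. Y k \<omega>) n) (Glim \<omega>)"
begin

lemma Glim_in_priors: "\<omega> \<in> space M \<Longrightarrow> Glim \<omega> \<in> priors"
  using Glim by (simp add: random_prob_measure_on_def)

lemma integral_Glim_measurable:
  fixes f :: "real \<Rightarrow> real"
  assumes "f \<in> borel_measurable borel"
  shows "(\<lambda>\<omega>. integral\<^sup>L (Glim \<omega>) f) \<in> borel_measurable M"
proof (rule measurable_compose[OF _ integral_measurable_subprob_algebra[OF assms]])
  show "Glim \<in> M \<rightarrow>\<^sub>M subprob_algebra borel"
    using Glim by (auto simp: random_prob_measure_on_def intro: measurable_prob_algebraD)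
qed

lemma expectation_learned_hist:
  assumes "bdd H f"
  shows "expectation (\<lambda>\<omega>. integral\<^sup>L (learned (hist n \<omega>)) f) = integral\<^sup>L G0 f"
  using integral_hist_M[of "\<lambda>l. integral\<^sup>L (learned l) f" n] expectation_learned[OF assms, of "[]" n] by simp

lemma AE_tendsto_Glim_continuous:
  fixes f :: "real \<Rightarrow> real"
  assumes "\<And>x. isCont f x" "\<And>x. \<bar>f x\<bar> \<le> B"
  shows "AE \<omega> in M. (\<lambda>n. integral\<^sup>L (learned (hist n \<omega>)) f) \<longlonglongrightarrow> integral\<^sup>L (Glim \<omega>) f"
  using weak_limit AE_space
proof eventually_elim
  case (elim \<omega>)
  have w: "weak_conv_m (\<lambda>n. learned (hist n \<omega>)) (Glim \<omega>)"
    using elim(1) unfolding learned_hist .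
  show ?case
    by (rule weak_conv_imp_integral_bdd_continuous_conv[OF priors_real_distribution[OF learned_in_priors]
          priors_real_distribution[OF Glim_in_priors[OF elim(2)]] w assms(1), where B = B]) (simp add: assms(2))
qed

lemma expectation_Glim_continuous:
  fixes f :: "real \<Rightarrow> real"
  assumes f: "\<And>x. isCont f x" "\<And>x. \<bar>f x\<bar> \<le> B"
  shows "expectation (\<lambda>\<omega>. integral\<^sup>L (Glim \<omega>) f) = integral\<^sup>L G0 f"
proof -
  have fm: "f \<in> borel_measurable borel"
    using f(1) by (intro borel_measurable_continuous_onI) (simp add: continuous_on_eq_continuous_at)
  have b: "bdd B f" using fm f(2) by (auto simp: bdd_def)
  have "(\<lambda>n. expectation (\<lambda>\<omega>. integral\<^sup>L (learned (hist n \<omega>)) f)) \<longlonglongrightarrow> expectation (\<lambda>\<omega>. integral\<^sup>L (Glim \<omega>) f)"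
  proof (rule integral_dominated_convergence)
    show "AE \<omega> in M. (\<lambda>n. integral\<^sup>L (learned (hist n \<omega>)) f) \<longlonglongrightarrow> integral\<^sup>L (Glim \<omega>) f"
      by (rule AE_tendsto_Glim_continuous[OF f])
    show "AE \<omega> in M. norm (integral\<^sup>L (learned (hist n \<omega>)) f) \<le> B" for n
      using abs_learned_le[OF b] by simp
  qed (use fm in \<open>auto intro: integral_Glim_measurable learned_hist_measurable\<close>)
  then show ?thesis
    unfolding expectation_learned_hist[OF b] by (simp add: LIMSEQ_const_iff)
qed

text \<open>Weak convergence only yields an inequality for the upper semicontinuous integrand
  \<open>q * indicator {..\<theta>}\<close>. As the expectations of both sides agree, it is an equality.\<close>

lemma AE_tendsto_Glim:
  assumes q: "\<And>x. isCont q x" "\<forall>x\<in>{lo..hi}. 0 \<le> q x" and K: "bdd K q"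
  shows "AE \<omega> in M. (\<lambda>n. \<integral>x. q x * indicator {..\<theta>} x \<partial>learned (hist n \<omega>)) \<longlonglongrightarrow> (\<integral>x. q x * indicator {..\<theta>} x \<partial>Glim \<omega>)"
proof -
  \<comment> \<open>Clamping to the carrier turns \<open>q\<close> into a function that is
    continuous and bounded on the whole line, as weak convergence requires, without changing any
    integral.\<close>
  define c where "c x = max lo (min hi x)" for x :: real
  define p where "p x = q (c x)" for x
  define g where "g j x = p x * cts_step \<theta> (\<theta> + inverse (real (Suc j))) x" for j x
  define f where "f x = p x * indicator {..\<theta>} x" for x
  have c: "c x \<in> {lo..hi}" for x using lo_le_hi by (auto simp: c_def)
  have pos: "\<theta> < \<theta> + inverse (real (Suc j))" for j by simp
  have "isCont c x" for x unfolding c_def by (intro continuous_intros)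
  then have p_cont: "isCont p x" for x
    unfolding p_def using q(1) by (intro isCont_o2[of x c q])
  have p: "0 \<le> p x" "p x \<le> K" for x
    using bspec[OF q(2) c] K c unfolding p_def bdd_def by (auto simp: abs_le_iff)
  have K0: "0 \<le> K" using p[of 0] by simp
  have g_cont: "isCont (g j) x" for j x
    unfolding g_def by (intro continuous_mult p_cont isCont_cts_step pos)
  have g_bounds: "0 \<le> g j x" "g j x \<le> K" for j x
  proof -
    let ?c = "cts_step \<theta> (\<theta> + inverse (real (Suc j))) x"
    have *: "0 \<le> ?c" "?c \<le> 1" using cts_step_bounds[OF pos] by auto
    show "0 \<le> g j x" unfolding g_def using p(1) * by (intro mult_nonneg_nonneg)
    show "g j x \<le> K" unfolding g_def using mult_mono[OF p(2)[of x] *(2) K0 *(1)] by simp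
  qed
  then have g_abs: "\<bar>g j x\<bar> \<le> K" for j x by simp
  have f_le_g: "f x \<le> g j x" for j x
    unfolding f_def g_def using p(1) indicator_le_cts_step[OF pos[of j], of x] by (rule mult_left_mono[rotated])
  have f_bounds: "0 \<le> f x" "f x \<le> K" for x
    using p[of x] K0 by (auto simp: f_def indicator_def)
  have [measurable]: "p \<in> borel_measurable borel"
    using p_cont by (intro borel_measurable_continuous_onI) (simp add: continuous_on_eq_continuous_at)
  have g_meas [measurable]: "g j \<in> borel_measurable borel" for j
    using g_cont by (intro borel_measurable_continuous_onI) (simp add: continuous_on_eq_continuous_at)
  have f_meas [measurable]: "f \<in> borel_measurable borel" unfolding f_def by measurable
  have f_bdd: "bdd K f" and g_bdd: "bdd K (g j)" for j
    using f_bounds g_abs by (auto simp: bdd_def)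
  have g_lim: "(\<lambda>j. g j x) \<longlonglongrightarrow> f x" for x
    unfolding g_def f_def by (intro tendsto_mult tendsto_const cts_step_tendsto_indicator)
  have int_lim: "(\<lambda>j. integral\<^sup>L G (g j)) \<longlonglongrightarrow> integral\<^sup>L G f" if G: "G \<in> priors" for G
  proof (rule integral_dominated_convergence)
    interpret G: prob_space G by (rule priors_prob_space[OF G])
    show "integrable G (\<lambda>_. K)" by simp
  qed (use g_lim g_abs in \<open>auto intro: priors_measurable[OF G]\<close>)
  \<comment> \<open>The martingale keeps the mean at that of \<open>G0\<close> for each continuous
    \<open>g j\<close>; dominated convergence in j carries this over to the discontinuous
    \<open>f\<close>.\<close>
  have EG: "expectation (\<lambda>\<omega>. integral\<^sup>L (Glim \<omega>) f) = integral\<^sup>L G0 f"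
  proof (rule LIMSEQ_unique)
    show "(\<lambda>j. expectation (\<lambda>\<omega>. integral\<^sup>L (Glim \<omega>) (g j))) \<longlonglongrightarrow> expectation (\<lambda>\<omega>. integral\<^sup>L (Glim \<omega>) f)"
    proof (rule integral_dominated_convergence)
      show "AE \<omega> in M. (\<lambda>j. integral\<^sup>L (Glim \<omega>) (g j)) \<longlonglongrightarrow> integral\<^sup>L (Glim \<omega>) f"
        by (rule AE_I2) (rule int_lim[OF Glim_in_priors])
      show "AE \<omega> in M. norm (integral\<^sup>L (Glim \<omega>) (g j)) \<le> K" for j
        by (rule AE_I2) (simp only: real_norm_def, rule abs_integral_le_priors[OF Glim_in_priors g_bdd])
    qed (auto intro: integral_Glim_measurable)
    show "(\<lambda>j. expectation (\<lambda>\<omega>. integral\<^sup>L (Glim \<omega>) (g j))) \<longlonglongrightarrow> integral\<^sup>L G0 f"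
      unfolding expectation_Glim_continuous[OF g_cont g_abs] by (rule int_lim[OF G0_in_priors])
  qed
  \<comment> \<open>The limit exists almost surely by the oscillation bound; what remains is to show
    that it is the integral against \<open>Glim\<close>.\<close>
  define L where "L \<omega> = lim (\<lambda>n. integral\<^sup>L (learned (hist n \<omega>)) f)" for \<omega>
  have L_lim: "AE \<omega> in M. (\<lambda>n. integral\<^sup>L (learned (hist n \<omega>)) f) \<longlonglongrightarrow> L \<omega>"
    using AE_convergent_learned[OF f_bdd] by (auto simp: L_def convergent_LIMSEQ_iff)
  have L_meas [measurable]: "L \<in> borel_measurable M"
    unfolding L_def by (intro borel_measurable_lim_metric learned_hist_measurable)
  have EL: "expectation L = integral\<^sup>L G0 f"
  proof -
    have "(\<lambda>n. expectation (\<lambda>\<omega>. integral\<^sup>L (learned (hist n \<omega>)) f)) \<longlonglongrightarrow> expectation L"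
    proof (rule integral_dominated_convergence[OF _ _ _ L_lim])
      show "AE \<omega> in M. norm (integral\<^sup>L (learned (hist n \<omega>)) f) \<le> K" for n
        using abs_learned_le[OF f_bdd] by simp
    qed (auto intro: learned_hist_measurable)
    then show ?thesis
      unfolding expectation_learned_hist[OF f_bdd] by (simp add: LIMSEQ_const_iff)
  qed
  have "AE \<omega> in M. \<forall>j. (\<lambda>n. integral\<^sup>L (learned (hist n \<omega>)) (g j)) \<longlonglongrightarrow> integral\<^sup>L (Glim \<omega>) (g j)"
    unfolding AE_all_countable using AE_tendsto_Glim_continuous[OF g_cont g_abs] by blast
  then have le: "AE \<omega> in M. L \<omega> \<le> integral\<^sup>L (Glim \<omega>) f"
    using L_lim AE_space
  proof eventually_elim
    case (elim \<omega>)
    have "L \<omega> \<le> integral\<^sup>L (Glim \<omega>) (g j)" for j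
    proof (rule LIMSEQ_le)
      show "(\<lambda>n. integral\<^sup>L (learned (hist n \<omega>)) f) \<longlonglongrightarrow> L \<omega>" by (rule elim(2))
      show "(\<lambda>n. integral\<^sup>L (learned (hist n \<omega>)) (g j)) \<longlonglongrightarrow> integral\<^sup>L (Glim \<omega>) (g j)" using elim(1) by blast
      show "\<exists>N. \<forall>n\<ge>N. integral\<^sup>L (learned (hist n \<omega>)) f \<le> integral\<^sup>L (learned (hist n \<omega>)) (g j)"
        using integral_mono_priors[OF learned_in_priors f_bdd g_bdd f_le_g] by blast
    qed
    then show ?case
      by (intro LIMSEQ_le_const[OF int_lim[OF Glim_in_priors[OF elim(3)]]]) blast
  qed
  have iG: "integrable M (\<lambda>\<omega>. integral\<^sup>L (Glim \<omega>) f)"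
    by (rule integrable_const_bound[where B = K])
       (auto intro!: AE_I2 integral_Glim_measurable abs_integral_le_priors[OF Glim_in_priors f_bdd])
  have "AE \<omega> in M. \<bar>L \<omega>\<bar> \<le> K"
    using L_lim
  proof eventually_elim
    case (elim \<omega>)
    have "\<bar>integral\<^sup>L (learned (hist n \<omega>)) f\<bar> \<le> K" for n by (rule abs_learned_le[OF f_bdd])
    then show ?case
      by (intro LIMSEQ_le_const2[OF tendsto_rabs[OF elim]]) blast
  qed
  then have iL: "integrable M L"
    by (intro integrable_const_bound[where B = K]) auto
  \<comment> \<open>A nonnegative variable with mean 0 vanishes almost surely.\<close>
  have "AE \<omega> in M. integral\<^sup>L (Glim \<omega>) f - L \<omega> = 0"
    using le iG iL EG EL by (subst integral_nonneg_eq_0_iff_AE[symmetric]) auto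
  with L_lim have "AE \<omega> in M. (\<lambda>n. integral\<^sup>L (learned (hist n \<omega>)) f) \<longlonglongrightarrow> integral\<^sup>L (Glim \<omega>) f"
    by eventually_elim simp
  then show ?thesis
    using AE_space
  proof eventually_elim
    case (elim \<omega>)
    have q_meas: "(\<lambda>x. q x * indicator {..\<theta>} x) \<in> borel_measurable borel"
      using bdd_measurable[OF K] by measurable
    have "(\<integral>x. q x * indicator {..\<theta>} x \<partial>G) = integral\<^sup>L G f" if "G \<in> priors" for G
      using that q_meas f_meas by (rule integral_cong_priors) (auto simp: f_def p_def c_def)
    then show ?case
      using elim learned_in_priors Glim_in_priors by simp
  qed
qed

section \<open>Letting the horizon tend to infinity on an atom\<close>

context
  fixes l f H
  assumes pos: "0 < prob (atom l)" and f: "bdd H f"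
    and conv: "AE \<omega> in M. (\<lambda>n. integral\<^sup>L (learned (hist n \<omega>)) f) \<longlonglongrightarrow> integral\<^sup>L (Glim \<omega>) f"
begin

lemma AE_U_tendsto:
  "AE \<omega> in U l. (\<lambda>k. integral\<^sup>L (learned (hist (length l + k) \<omega>)) f) \<longlonglongrightarrow> integral\<^sup>L (Glim \<omega>) f"
  using AE_U[OF pos conv] by eventually_elim (subst add.commute, rule LIMSEQ_ignore_initial_segment)

lemma second_moment_limit:
  "(\<integral>\<omega>. (integral\<^sup>L (Glim \<omega>) f - integral\<^sup>L (learned l) f)\<^sup>2 \<partial>U l) \<le> 4 * H\<^sup>2 * tail_sq \<alpha> (Suc (length l))"
proof (rule LIMSEQ_le_const2)
  interpret U: prob_space "U l" by (rule prob_space_U[OF pos])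
  let ?x = "integral\<^sup>L (learned l) f"
  show "(\<lambda>k. \<integral>\<omega>. (integral\<^sup>L (learned (hist (length l + k) \<omega>)) f - ?x)\<^sup>2 \<partial>U l)
      \<longlonglongrightarrow> (\<integral>\<omega>. (integral\<^sup>L (Glim \<omega>) f - ?x)\<^sup>2 \<partial>U l)"
  proof (rule integral_dominated_convergence[where w = "\<lambda>_. (H + \<bar>?x\<bar>)\<^sup>2"])
    show "AE \<omega> in U l. (\<lambda>k. (integral\<^sup>L (learned (hist (length l + k) \<omega>)) f - ?x)\<^sup>2) \<longlonglongrightarrow> (integral\<^sup>L (Glim \<omega>) f - ?x)\<^sup>2"
      using AE_U_tendsto by eventually_elim (intro tendsto_intros)
    show "AE \<omega> in U l. norm ((integral\<^sup>L (learned (hist (length l + k) \<omega>)) f - ?x)\<^sup>2) \<le> (H + \<bar>?x\<bar>)\<^sup>2" for k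
      by (rule AE_I2) (simp only: real_norm_def, rule square_learned_diff_le[OF f])
  qed (use integral_Glim_measurable[OF bdd_measurable[OF f]] in auto)
  have "(\<integral>\<omega>. (integral\<^sup>L (learned (hist (length l + k) \<omega>)) f - ?x)\<^sup>2 \<partial>U l) \<le> 4 * H\<^sup>2 * tail_sq \<alpha> (Suc (length l))" for k
  proof -
    have "(\<integral>\<omega>. (integral\<^sup>L (learned (hist (length l + k) \<omega>)) f - ?x)\<^sup>2 \<partial>U l) \<le> 4 * H\<^sup>2 * sqsum (length l) k"
      using integral_hist[OF pos, of "\<lambda>l'. (integral\<^sup>L (learned l') f - ?x)\<^sup>2" k] second_moment_le[OF f, of l k ?x] by simp
    also have "\<dots> \<le> 4 * H\<^sup>2 * tail_sq \<alpha> (Suc (length l))"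
      using sqsum_le_tail by (intro mult_left_mono) auto
    finally show ?thesis .
  qed
  then show "\<exists>N. \<forall>k\<ge>N. (\<integral>\<omega>. (integral\<^sup>L (learned (hist (length l + k) \<omega>)) f - ?x)\<^sup>2 \<partial>U l) \<le> 4 * H\<^sup>2 * tail_sq \<alpha> (Suc (length l))"
    by blast
qed

text \<open>Bounded convergence under the conditional measure replaces the learned integral by the
  one against \<open>Glim\<close>, while \<open>sqsum\<close> increases to the full tail
  \<open>R\<close>. Here \<open>a\<close> bounds all rates still to come.\<close>

lemma char_limit:
  assumes a: "\<And>j. \<alpha> (Suc (length l + j)) \<le> a"
  defines "R \<equiv> tail_sq \<alpha> (Suc (length l))"
  shows "cmod ((\<integral>\<omega>. iexp (s * (integral\<^sup>L (Glim \<omega>) f - integral\<^sup>L (learned l) f)) \<partial>U l) - exp (- (s\<^sup>2 * predictive_variance (learned l) f * R / 2)))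
    \<le> R * (s\<^sup>2 / 2 * ((6 * exp hi + 4) * H\<^sup>2 * sqrt R) + (2 * H * \<bar>s\<bar>) ^ 3 * a / 6 + 2 * s ^ 4 * a\<^sup>2 * H ^ 4)"
proof (rule LIMSEQ_le)
  interpret U: prob_space "U l" by (rule prob_space_U[OF pos])
  let ?x = "integral\<^sup>L (learned l) f" and ?n = "length l"
  let ?u = "\<lambda>k. \<integral>\<omega>. iexp (s * (integral\<^sup>L (learned (hist (length l + k) \<omega>)) f - ?x)) \<partial>U l"
  let ?g = "\<lambda>r. complex_of_real (exp (- (s\<^sup>2 * predictive_variance (learned l) f * r / 2)))"
  let ?err = "s\<^sup>2 / 2 * ((6 * exp hi + 4) * H\<^sup>2 * sqrt R) + (2 * H * \<bar>s\<bar>) ^ 3 * a / 6 + 2 * s ^ 4 * a\<^sup>2 * H ^ 4"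
  have u: "?u \<longlonglongrightarrow> (\<integral>\<omega>. iexp (s * (integral\<^sup>L (Glim \<omega>) f - ?x)) \<partial>U l)"
  proof (rule integral_dominated_convergence[where w = "\<lambda>_. 1"])
    show "AE \<omega> in U l. (\<lambda>k. iexp (s * (integral\<^sup>L (learned (hist (length l + k) \<omega>)) f - ?x))) \<longlonglongrightarrow> iexp (s * (integral\<^sup>L (Glim \<omega>) f - ?x))"
      using AE_U_tendsto by eventually_elim (intro tendsto_intros)
  qed (use integral_Glim_measurable[OF bdd_measurable[OF f]] in auto)
  show "(\<lambda>k. cmod (?u k - ?g (sqsum ?n k))) \<longlonglongrightarrow> cmod ((\<integral>\<omega>. iexp (s * (integral\<^sup>L (Glim \<omega>) f - ?x)) \<partial>U l) - ?g R)"
    using sqsum_tendsto[of ?n] unfolding R_def[symmetric] by (intro tendsto_intros u) auto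
  show "(\<lambda>k. sqsum ?n k * ?err) \<longlonglongrightarrow> R * ?err"
    unfolding R_def by (intro tendsto_mult sqsum_tendsto tendsto_const)
  show "\<exists>N. \<forall>k\<ge>N. cmod (?u k - ?g (sqsum ?n k)) \<le> sqsum ?n k * ?err"
    using char_bound[OF f sqsum_le_tail[of "length l"] a, where s = s] integral_hist[OF pos, of "\<lambda>l'. iexp (s * (integral\<^sup>L (learned l') f - ?x))"]
    by (auto simp: R_def)
qed

end

end

section \<open>The limiting variance\<close>

text \<open>For v > 0 the law is the image of the standard normal law under scaling by sqrt v. The
  point mass at v = 0 obeys the same formula.\<close>

lemma char_centered_gaussian:
  assumes v: "0 \<le> v"
  shows "real_distribution (centered_gaussian v)" "char (centered_gaussian v) t = exp (- (t\<^sup>2 * v / 2))"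
proof -
  have "real_distribution (centered_gaussian v) \<and> char (centered_gaussian v) t = exp (- (t\<^sup>2 * v / 2))"
  proof (cases "v = 0")
    case True
    interpret prob_space "return borel (0::real)" by (rule prob_space_return) simp
    have "real_distribution (return borel (0::real))" by unfold_locales auto
    moreover have "char (return borel 0) t = 1"
      unfolding char_def by (subst integral_return) auto
    ultimately show ?thesis using True by (simp add: centered_gaussian_def)
  next
    case False
    define \<sigma> where "\<sigma> = sqrt v"
    have \<sigma>: "0 < \<sigma>" "\<sigma>\<^sup>2 = v" using v False by (auto simp: \<sigma>_def)
    interpret S: real_distribution std_normal_distribution by (rule real_dist_normal_dist)
    have "distributed std_normal_distribution lborel (\<lambda>x. x) std_normal_density"
      unfolding distributed_def by (auto simp: distr_id2)
    from S.normal_density_affine[OF this, of \<sigma> 0] \<sigma>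
    have "distributed std_normal_distribution lborel (\<lambda>x. \<sigma> * x) (normal_density 0 \<sigma>)"
      by simp
    then have *: "centered_gaussian v = distr std_normal_distribution lborel (\<lambda>x. \<sigma> * x)"
      using False by (simp add: centered_gaussian_def distributed_def \<sigma>_def)
    have "prob_space (distr std_normal_distribution lborel (\<lambda>x. \<sigma> * x))"
      by (rule S.prob_space_distr) simp
    then have rd: "real_distribution (centered_gaussian v)"
      unfolding * real_distribution_def real_distribution_axioms_def by simp
    have "char (centered_gaussian v) t = (CLINT x|std_normal_distribution. iexp (t * (\<sigma> * x)))"
      unfolding * char_def by (rule integral_distr) auto
    also have "\<dots> = char std_normal_distribution (t * \<sigma>)"
      unfolding char_def by (simp add: mult.assoc)
    also have "\<dots> = exp (- (t\<^sup>2 * v / 2))"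
      unfolding char_std_normal_distribution using \<sigma>(2) by (simp add: power_mult_distrib)
    finally show ?thesis using rd by blast
  qed
  then show "real_distribution (centered_gaussian v)" "char (centered_gaussian v) t = exp (- (t\<^sup>2 * v / 2))"
    by auto
qed

lemma cmod_iexp_diff_le: "cmod (iexp x - iexp y) \<le> \<bar>x - y\<bar>"
proof -
  have "iexp x - iexp y = iexp y * (iexp (x - y) - 1)"
    by (simp add: exp_diff right_diff_distrib)
  then have "cmod (iexp x - iexp y) = cmod (iexp (x - y) - 1)"
    by (simp only: norm_mult norm_exp_i_times mult_1)
  then show ?thesis using iexp_approx1[of "x - y" 0] by simp
qed

lemma abs_exp_minus_diff_le:
  fixes x y :: real
  assumes "0 \<le> x" "0 \<le> y"
  shows "\<bar>exp (- x) - exp (- y)\<bar> \<le> \<bar>x - y\<bar>"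
proof -
  have *: "exp (- u) - exp (- w) \<le> w - u" if "0 \<le> u" "u \<le> w" for u w :: real
  proof -
    have "1 - exp (u - w) \<le> w - u"
      using exp_ge_add_one_self[of "u - w"] by linarith
    then have "exp (- u) * (1 - exp (u - w)) \<le> 1 * (w - u)"
      using that by (intro mult_mono) auto
    then show ?thesis by (simp add: right_diff_distrib exp_add[symmetric])
  qed
  show ?thesis
    using *[of x y] *[of y x] assms by (cases "x \<le> y") (auto simp: abs_if)
qed

context poisson_interval
begin

text \<open>The function h of the overview with \<open>c\<close> in place of the posterior
  distribution function. Clearing the denominator makes the comparison of that function with
  \<open>c\<close> linear in the measure; keeping \<open>c\<close> free allows a value that depends
  on the history.\<close>

definition cdf_score :: "real \<Rightarrow> nat \<Rightarrow> real \<Rightarrow> real \<Rightarrow> real" where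
  "cdf_score \<theta> y c x = poisson y x * indicator {..\<theta>} x - c * poisson y x"

lemma bdd_indicator: "bdd 1 (indicator {..\<theta>})"
  by (auto simp: bdd_def indicator_def)

text \<open>The factor \<open>indicator {..\<theta>} x - c\<close> stays within [-1, 1], so one
  bound serves all histories.\<close>

lemma bdd_cdf_score: "0 \<le> c \<Longrightarrow> c \<le> 1 \<Longrightarrow> bdd (pois_ub y) (cdf_score \<theta> y c)"
proof -
  assume c: "0 \<le> c" "c \<le> 1"
  have "\<bar>cdf_score \<theta> y c x\<bar> \<le> pois_ub y" if "x \<in> {lo..hi}" for x
  proof -
    have p: "0 < poisson y x" "poisson y x \<le> pois_ub y" using poisson_bounds[OF that] by auto
    have "cdf_score \<theta> y c x = poisson y x * (indicator {..\<theta>} x - c)" by (simp add: cdf_score_def algebra_simps)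
    also have "\<bar>\<dots>\<bar> \<le> poisson y x * 1"
      unfolding abs_mult using c p by (intro mult_mono) (auto simp: indicator_def)
    finally show ?thesis using p by simp
  qed
  moreover have "cdf_score \<theta> y c \<in> borel_measurable borel"
    unfolding cdf_score_def by measurable
  ultimately show ?thesis by (simp add: bdd_def)
qed

context
  fixes G assumes G: "G \<in> priors"
begin

text \<open>The intervals {0<..\<theta>} and {..\<theta>} meet the carrier in the same set because
  \<open>lo\<close> is positive.\<close>

lemma post_cdf_eq: "post_cdf G \<theta> y = (\<integral>x. poisson y x * indicator {..\<theta>} x \<partial>G) / marg G y"
proof -
  have "(LINT t:{0<..\<theta>}|G. poisson y t) = (\<integral>x. poisson y x * indicator {..\<theta>} x \<partial>G)"
    unfolding set_lebesgue_integral_def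
  proof (rule integral_cong_priors[OF G])
    show "(\<lambda>x. indicator {0<..\<theta>} x *\<^sub>R poisson y x) \<in> borel_measurable borel" by measurable
    show "(\<lambda>x. poisson y x * indicator {..\<theta>} x) \<in> borel_measurable borel" by measurable
  qed (use lo_pos in \<open>auto simp: indicator_def\<close>)
  then show ?thesis by (simp add: post_cdf_def marg_def)
qed

lemma post_cdf_bounds: "0 \<le> post_cdf G \<theta> y" "post_cdf G \<theta> y \<le> 1"
proof -
  have b: "bdd (pois_ub y * 1) (\<lambda>x. poisson y x * indicator {..\<theta>} x)"
    by (intro bdd_mult bdd_poisson bdd_indicator)
  have "0 \<le> (\<integral>x. poisson y x * indicator {..\<theta>} x \<partial>G)"
    using b poisson_bounds(3) by (intro integral_ge_priors[OF G]) (auto simp: indicator_def less_imp_le)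
  moreover have "(\<integral>x. poisson y x * indicator {..\<theta>} x \<partial>G) \<le> marg G y"
    unfolding marg_def
    using poisson_bounds(3) by (intro integral_mono_priors[OF G b bdd_poisson]) (auto simp: indicator_def less_imp_le)
  ultimately show "0 \<le> post_cdf G \<theta> y" "post_cdf G \<theta> y \<le> 1"
    using marg_bounds(3)[OF G, of y] by (auto simp: post_cdf_eq)
qed

lemma integral_mult_cdf_score:
  assumes g: "bdd K g"
  shows "(\<integral>x. g x * cdf_score \<theta> y c x \<partial>G)
    = (\<integral>x. g x * poisson y x * indicator {..\<theta>} x \<partial>G) - c * (\<integral>x. g x * poisson y x \<partial>G)"
proof -
  have "(\<integral>x. g x * cdf_score \<theta> y c x \<partial>G)
      = (\<integral>x. g x * poisson y x * indicator {..\<theta>} x - c * (g x * poisson y x) \<partial>G)"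
    by (simp add: cdf_score_def algebra_simps)
  also have "\<dots> = (\<integral>x. g x * poisson y x * indicator {..\<theta>} x \<partial>G) - (\<integral>x. c * (g x * poisson y x) \<partial>G)"
    by (intro Bochner_Integration.integral_diff integrable_mult_right
        integrable_bdd[OF G bdd_mult[OF bdd_mult[OF g bdd_poisson] bdd_indicator]]
        integrable_bdd[OF G bdd_mult[OF g bdd_poisson]])
  finally show ?thesis by simp
qed

lemma integral_cdf_score: "integral\<^sup>L G (cdf_score \<theta> y c) = marg G y * (post_cdf G \<theta> y - c)"
  using integral_mult_cdf_score[OF bdd_const[of 1], of \<theta> y c] marg_bounds(3)[OF G, of y]
  by (simp add: post_cdf_eq marg_def algebra_simps)

end

text \<open>\<open>h\<close> has integral 0 under \<open>G\<close>, and under the posterior given z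
  its integral is the posterior marginal times the difference of the two distribution functions.
  Hence the stated series is the second moment of the posterior means of \<open>h\<close>, divided
  by the squared marginal.\<close>

lemma limit_variance_eq:
  fixes y :: nat and \<theta> :: real
  assumes G: "G \<in> priors"
  defines "h \<equiv> cdf_score \<theta> y (post_cdf G \<theta> y)"
  shows "limit_variance G y \<theta> = predictive_variance G h / (marg G y)\<^sup>2"
    and "limit_variance G y \<theta> = (\<Sum>z. (\<integral>x. poisson z x * h x \<partial>G)\<^sup>2 / marg G z) / (marg G y)\<^sup>2"
proof -
  have h: "bdd (pois_ub y) h"
    unfolding h_def by (intro bdd_cdf_score post_cdf_bounds[OF G])
  have h0: "integral\<^sup>L G h = 0"
    unfolding h_def by (simp add: integral_cdf_score[OF G])
  let ?D = "marg G y"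
  have D: "0 < ?D" by (rule marg_bounds(3)[OF G])
  have trm: "marg G z * ((marg (posterior z G) y)\<^sup>2 / ?D\<^sup>2) * (post_cdf (posterior z G) \<theta> y - post_cdf G \<theta> y)\<^sup>2
      = (\<integral>x. poisson z x * h x \<partial>G)\<^sup>2 / marg G z / ?D\<^sup>2" for z
  proof -
    have m: "0 < marg G z" by (rule marg_bounds(3)[OF G])
    have "(\<integral>x. poisson z x * h x \<partial>G) / marg G z = integral\<^sup>L (posterior z G) h"
      by (rule integral_posterior[OF G h, symmetric])
    also have "\<dots> = marg (posterior z G) y * (post_cdf (posterior z G) \<theta> y - post_cdf G \<theta> y)"
      unfolding h_def by (rule integral_cdf_score[OF posterior_in_priors[OF G]])
    finally have "(\<integral>x. poisson z x * h x \<partial>G) = marg G z * (marg (posterior z G) y * (post_cdf (posterior z G) \<theta> y - post_cdf G \<theta> y))"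
      using m by (simp add: field_simps)
    then show ?thesis using m by (simp add: power_mult_distrib power2_eq_square)
  qed
  have "(\<lambda>z. (\<integral>x. poisson z x * h x \<partial>G)\<^sup>2 / marg G z) sums predictive_variance G h"
    using sums_predictive_variance[OF G h] by (simp add: h0)
  from sums_divide[OF this, of "?D\<^sup>2"]
  show 1: "limit_variance G y \<theta> = predictive_variance G h / ?D\<^sup>2"
    unfolding limit_variance_def trm by (rule sums_unique[symmetric])
  show "limit_variance G y \<theta> = (\<Sum>z. (\<integral>x. poisson z x * h x \<partial>G)\<^sup>2 / marg G z) / ?D\<^sup>2"
    unfolding 1 using \<open>_ sums predictive_variance G h\<close> by (simp add: sums_iff)
qed

lemma limit_variance_nonneg: "G \<in> priors \<Longrightarrow> 0 \<le> limit_variance G y \<theta>"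
  unfolding limit_variance_eq(1)
  by (rule divide_nonneg_nonneg[OF predictive_variance_nonneg[OF _ bdd_cdf_score[OF post_cdf_bounds]]]) auto

end

context learning_limit
begin

text \<open>The threshold \<open>hi\<close> makes the indicator equal to 1 on the carrier.\<close>

lemma AE_tendsto_Glim_total:
  assumes q: "\<And>x. isCont q x" "\<forall>x\<in>{lo..hi}. 0 \<le> q x" and K: "bdd K q"
  shows "AE \<omega> in M. (\<lambda>n. integral\<^sup>L (learned (hist n \<omega>)) q) \<longlonglongrightarrow> integral\<^sup>L (Glim \<omega>) q"
  using AE_tendsto_Glim[OF q K, of hi] AE_space
proof eventually_elim
  case (elim \<omega>)
  have "(\<integral>x. q x * indicator {..hi} x \<partial>G) = integral\<^sup>L G q" if "G \<in> priors" for G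
    using that bdd_measurable[OF K] by (intro integral_cong_priors) auto
  then show ?case using elim learned_in_priors Glim_in_priors by simp
qed

lemma isCont_poisson_mult: "isCont (\<lambda>x. poisson z x * poisson y x) x"
  by (intro continuous_mult isCont_poisson)

lemma AE_tendsto_cdf_score:
  "AE \<omega> in M. (\<lambda>n. integral\<^sup>L (learned (hist n \<omega>)) (cdf_score \<theta> y c)) \<longlonglongrightarrow> integral\<^sup>L (Glim \<omega>) (cdf_score \<theta> y c)"
proof -
  have nn: "\<forall>x\<in>{lo..hi}. 0 \<le> poisson y x" using poisson_bounds(3) by (simp add: less_imp_le)
  show ?thesis
    using AE_tendsto_Glim[OF isCont_poisson nn bdd_poisson, of \<theta>]
      AE_tendsto_Glim_total[OF isCont_poisson nn bdd_poisson] AE_space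
  proof eventually_elim
    case (elim \<omega>)
    have "integral\<^sup>L G (cdf_score \<theta> y c) = (\<integral>x. poisson y x * indicator {..\<theta>} x \<partial>G) - c * integral\<^sup>L G (poisson y)"
      if "G \<in> priors" for G
      using integral_mult_cdf_score[OF that bdd_const[of 1], of \<theta> y c] by simp
    then show ?case
      using elim by (simp add: learned_in_priors Glim_in_priors) (intro tendsto_intros)
  qed
qed

text \<open>The integrand varies with n through its centring constant only, so it is split into
  integrals of fixed functions, one pair for each z. These converge outside a common null set, and
  the series follows by dominated summation (Tannery).\<close>

lemma AE_limit_variance_tendsto:
  "AE \<omega> in M. (\<lambda>n. limit_variance (learned (hist n \<omega>)) y \<theta>) \<longlonglongrightarrow> limit_variance (Glim \<omega>) y \<theta>"
proof -
  have nn: "\<forall>x\<in>{lo..hi}. 0 \<le> poisson z x" for z using poisson_bounds(3) by (simp add: less_imp_le)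
  have nn2: "\<forall>x\<in>{lo..hi}. 0 \<le> poisson z x * poisson y x" for z using nn by simp
  note b2 = bdd_mult[OF bdd_poisson bdd_poisson]
  have 1: "AE \<omega> in M. \<forall>z. (\<lambda>n. \<integral>x. poisson z x * poisson y x * indicator {..\<theta>} x \<partial>learned (hist n \<omega>))
      \<longlonglongrightarrow> (\<integral>x. poisson z x * poisson y x * indicator {..\<theta>} x \<partial>Glim \<omega>)"
    unfolding AE_all_countable using AE_tendsto_Glim[OF isCont_poisson_mult nn2 b2] by blast
  have 2: "AE \<omega> in M. \<forall>z. (\<lambda>n. \<integral>x. poisson z x * poisson y x \<partial>learned (hist n \<omega>))
      \<longlonglongrightarrow> (\<integral>x. poisson z x * poisson y x \<partial>Glim \<omega>)"
    unfolding AE_all_countable using AE_tendsto_Glim_total[OF isCont_poisson_mult nn2 b2] by blast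
  have 3: "AE \<omega> in M. \<forall>z. (\<lambda>n. marg (learned (hist n \<omega>)) z) \<longlonglongrightarrow> marg (Glim \<omega>) z"
    unfolding AE_all_countable marg_def using AE_tendsto_Glim_total[OF isCont_poisson nn bdd_poisson] by blast
  have 4: "AE \<omega> in M. (\<lambda>n. \<integral>x. poisson y x * indicator {..\<theta>} x \<partial>learned (hist n \<omega>))
      \<longlonglongrightarrow> (\<integral>x. poisson y x * indicator {..\<theta>} x \<partial>Glim \<omega>)"
    by (rule AE_tendsto_Glim[OF isCont_poisson nn bdd_poisson])
  show ?thesis
    using 1 2 3 4 AE_space
  proof eventually_elim
    case (elim \<omega>)
    let ?G = "\<lambda>n. learned (hist n \<omega>)"
    have L: "Glim \<omega> \<in> priors" by (rule Glim_in_priors[OF elim(5)])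
    have m0: "marg (Glim \<omega>) z \<noteq> 0" for z using marg_bounds(3)[OF L, of z] by simp
    have m: "(\<lambda>n. marg (?G n) z) \<longlonglongrightarrow> marg (Glim \<omega>) z" for z using elim(3) by blast
    have c: "(\<lambda>n. post_cdf (?G n) \<theta> y) \<longlonglongrightarrow> post_cdf (Glim \<omega>) \<theta> y"
      unfolding post_cdf_eq[OF learned_in_priors] post_cdf_eq[OF L] by (intro tendsto_divide elim(4) m m0)
    define A where "A G z = (\<integral>x. poisson z x * cdf_score \<theta> y (post_cdf G \<theta> y) x \<partial>G)\<^sup>2 / marg G z" for G z
    have "(\<lambda>n. \<integral>x. poisson z x * cdf_score \<theta> y (post_cdf (?G n) \<theta> y) x \<partial>?G n)
        \<longlonglongrightarrow> (\<integral>x. poisson z x * cdf_score \<theta> y (post_cdf (Glim \<omega>) \<theta> y) x \<partial>Glim \<omega>)" for z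
      unfolding integral_mult_cdf_score[OF learned_in_priors bdd_poisson] integral_mult_cdf_score[OF L bdd_poisson]
      using elim(1,2) by (intro tendsto_diff tendsto_mult c) auto
    then have lim: "(\<lambda>n. A (?G n) z) \<longlonglongrightarrow> A (Glim \<omega>) z" for z
      unfolding A_def by (intro tendsto_divide tendsto_power m m0)
    have bound: "norm (A (?G n) z) \<le> (pois_ub y)\<^sup>2 * pois_ub z" for n z
    proof -
      let ?h = "cdf_score \<theta> y (post_cdf (?G n) \<theta> y)"
      have h: "bdd (pois_ub y) ?h" by (intro bdd_cdf_score post_cdf_bounds learned_in_priors)
      have mz: "0 < marg (?G n) z" "marg (?G n) z \<le> pois_ub z" using marg_bounds[OF learned_in_priors] by auto
      \<comment> \<open>As \<open>marg\<close> times a squared posterior mean, the term no longer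
        has the small denominator and is bounded by a multiple of \<open>pois_ub z\<close>.\<close>
      have A_eq: "A (?G n) z = marg (?G n) z * (integral\<^sup>L (posterior z (?G n)) ?h)\<^sup>2"
        unfolding A_def marg_mult_posterior[OF learned_in_priors h, symmetric]
        using mz(1) by (simp add: power2_eq_square)
      have eq: "norm (A (?G n) z) = marg (?G n) z * \<bar>integral\<^sup>L (posterior z (?G n)) ?h\<bar>\<^sup>2"
        unfolding A_eq using mz(1) by (simp add: abs_mult)
      have "\<bar>integral\<^sup>L (posterior z (?G n)) ?h\<bar>\<^sup>2 \<le> (pois_ub y)\<^sup>2"
      proof (rule power_mono)
        show "\<bar>integral\<^sup>L (posterior z (?G n)) ?h\<bar> \<le> pois_ub y"
          by (rule abs_posterior_le[OF learned_in_priors h])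
        show "0 \<le> \<bar>integral\<^sup>L (posterior z (?G n)) ?h\<bar>"
          by simp
      qed
      then have "marg (?G n) z * \<bar>integral\<^sup>L (posterior z (?G n)) ?h\<bar>\<^sup>2 \<le> pois_ub z * (pois_ub y)\<^sup>2"
        using pois_ub_pos[of z] by (intro mult_mono mz(2)) (simp_all only: zero_le_power2 less_imp_le)
      then show ?thesis unfolding eq by (simp only: mult.commute)
    qed
    have sm: "summable (\<lambda>z. (pois_ub y)\<^sup>2 * pois_ub z)"
      using sums_pois_ub by (intro summable_mult) (rule sums_summable)
    have "(\<lambda>n. \<Sum>z. A (?G n) z) \<longlonglongrightarrow> (\<Sum>z. A (Glim \<omega>) z)"
      using tannerys_theorem[of "\<lambda>z n. A (?G n) z" "A (Glim \<omega>)" sequentially "\<lambda>z. (pois_ub y)\<^sup>2 * pois_ub z", OF lim _ sm]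
        bound by (simp add: always_eventually)
    then show ?case
      unfolding limit_variance_eq(2)[OF learned_in_priors] limit_variance_eq(2)[OF L] A_def[symmetric]
      using m0 by (intro tendsto_divide tendsto_power m) auto
  qed
qed

end

section \<open>Conditional convergence\<close>

locale learning_clt = learning_limit lo hi \<alpha> G0 M Y Glim
  for lo hi \<alpha> G0 and M :: "'a measure" and Y Glim +
  fixes y :: nat and \<theta> :: real
  assumes rate_pos: "\<And>n. 0 < \<alpha> (Suc n)"
    and rate_mono: "\<And>m n. m \<le> n \<Longrightarrow> \<alpha> (Suc n) \<le> \<alpha> (Suc m)"
    and ratio_summable: "summable (\<lambda>n. ((\<alpha> (Suc n))\<^sup>2 / tail_sq \<alpha> (Suc n))\<^sup>2)"
begin

definition ratio :: "nat \<Rightarrow> real" where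
  "ratio n = (\<alpha> (Suc n))\<^sup>2 / tail_sq \<alpha> (Suc n)"

definition rescaled_error :: "nat \<Rightarrow> 'a \<Rightarrow> real" where
  "rescaled_error n \<omega> = sqrt (b_seq \<alpha> n) * (post_cdf (learned (hist n \<omega>)) \<theta> y - post_cdf (Glim \<omega>) \<theta> y)"

lemma tail_Suc: "tail_sq \<alpha> (Suc n) = (\<alpha> (Suc n))\<^sup>2 + tail_sq \<alpha> (Suc (Suc n))"
proof -
  have "(\<lambda>j. (\<alpha> (Suc (n + Suc j)))\<^sup>2) sums (tail_sq \<alpha> (Suc n) - (\<alpha> (Suc n))\<^sup>2)"
    using sums_tail[of n] by (subst sums_Suc_iff) simp
  then have "tail_sq \<alpha> (Suc n) - (\<alpha> (Suc n))\<^sup>2 = tail_sq \<alpha> (Suc (Suc n))"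
    using sums_tail[of "Suc n"] by (simp add: sums_unique2)
  then show ?thesis by simp
qed

lemma tail_pos: "0 < tail_sq \<alpha> (Suc n)"
proof -
  have "0 \<le> tail_sq \<alpha> (Suc (Suc n))"
    using sqsum_le_tail[of "Suc n" 0] by (simp add: sqsum_def)
  then show ?thesis using rate_pos[of n] unfolding tail_Suc[of n] by (simp add: add_pos_nonneg)
qed

lemma ratio_nonneg: "0 \<le> ratio n"
  using tail_pos[of n] by (simp add: ratio_def)

lemma ratio_tendsto_0: "ratio \<longlonglongrightarrow> 0"
proof -
  have "(\<lambda>n. sqrt ((ratio n)\<^sup>2)) \<longlonglongrightarrow> sqrt 0"
    using summable_LIMSEQ_zero[OF ratio_summable] by (intro tendsto_real_sqrt) (simp add: ratio_def)
  then show ?thesis using ratio_nonneg by simp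
qed

text \<open>The three summands pay, in order, for replacing the limiting marginal by the current
  one, for the Gaussian expansion, and for the tail that starts one index later. Here
  \<open>r\<close> bounds \<bar>t\<bar> divided by the marginal, uniformly over histories.\<close>

definition char_err :: "real \<Rightarrow> nat \<Rightarrow> real" where
  "char_err t m = (let H = pois_ub y; c = pois_lb y; r = \<bar>t\<bar> / c;
      R = tail_sq \<alpha> (Suc (Suc m)); \<delta> = sqrt (ratio (Suc m)) in
    4 * H\<^sup>2 * r / c * sqrt R
    + (r\<^sup>2 / 2 * ((6 * exp hi + 4) * H\<^sup>2 * sqrt R) + (2 * H * r) ^ 3 * \<delta> / 6 + 2 * r ^ 4 * \<delta>\<^sup>2 * H ^ 4)
    + 2 * H\<^sup>2 * r\<^sup>2 * ratio m)"

lemma char_err_tendsto_0: "char_err t \<longlonglongrightarrow> 0"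
proof -
  have R: "(\<lambda>m. sqrt (tail_sq \<alpha> (Suc (Suc m)))) \<longlonglongrightarrow> 0"
    using tendsto_real_sqrt[OF LIMSEQ_Suc[OF tail_tendsto_0]] by simp
  have d: "(\<lambda>m. sqrt (ratio (Suc m))) \<longlonglongrightarrow> 0"
    using tendsto_real_sqrt[OF LIMSEQ_Suc[OF ratio_tendsto_0]] by simp
  have lim: "(\<lambda>m. A * sqrt (tail_sq \<alpha> (Suc (Suc m)))
      + (B * (C * sqrt (tail_sq \<alpha> (Suc (Suc m)))) + D * sqrt (ratio (Suc m)) / 6 + E * (sqrt (ratio (Suc m)))\<^sup>2 * K)
      + L * ratio m) \<longlonglongrightarrow> 0" for A B C D E K L
  proof (rule tendsto_eq_rhs)
    show "(\<lambda>m. A * sqrt (tail_sq \<alpha> (Suc (Suc m)))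
        + (B * (C * sqrt (tail_sq \<alpha> (Suc (Suc m)))) + D * sqrt (ratio (Suc m)) / 6 + E * (sqrt (ratio (Suc m)))\<^sup>2 * K)
        + L * ratio m) \<longlonglongrightarrow> A * 0 + (B * (C * 0) + D * 0 / 6 + E * 0\<^sup>2 * K) + L * 0"
      by (intro tendsto_add tendsto_mult tendsto_power tendsto_divide tendsto_const R d ratio_tendsto_0) simp
  qed simp
  show ?thesis
    unfolding char_err_def Let_def by (rule lim)
qed

lemma post_cdf_Glim_measurable [measurable]: "(\<lambda>\<omega>. post_cdf (Glim \<omega>) \<theta> y) \<in> borel_measurable M"
  unfolding post_cdf_def set_lebesgue_integral_def
  by (intro borel_measurable_divide integral_Glim_measurable) measurable

lemma rescaled_error_measurable [measurable]: "rescaled_error n \<in> borel_measurable M"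
proof -
  have [measurable]: "(\<lambda>\<omega>. post_cdf (learned (hist n \<omega>)) \<theta> y) \<in> borel_measurable M"
    by (rule measurable_compose[OF hist_measurable]) simp
  show ?thesis unfolding rescaled_error_def by measurable
qed

text \<open>On a fixed atom, \<open>h\<close>, the marginal \<open>D\<close> and the scale
  \<open>\<beta>\<close> are constants, so \<open>X'\<close> is a multiple of the centred integral
  of \<open>h\<close> and \<open>char_limit\<close> applies to it. The three errors below match the
  summands of \<open>char_err\<close>.\<close>

lemma char_rescaled_error:
  assumes pos: "0 < prob (atom l)" and len: "length l = Suc m"
  shows "cmod ((\<integral>\<omega>. iexp (t * rescaled_error (Suc m) \<omega>) \<partial>U l) - exp (- (t\<^sup>2 * limit_variance (learned l) y \<theta> / 2)))
    \<le> char_err t m"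
proof -
  interpret U: prob_space "U l" by (rule prob_space_U[OF pos])
  define H where "H = pois_ub y"
  define c where "c = pois_lb y"
  define D where "D = marg (learned l) y"
  define h where "h = cdf_score \<theta> y (post_cdf (learned l) \<theta> y)"
  define T where "T = tail_sq \<alpha> (Suc m)"
  define R where "R = tail_sq \<alpha> (Suc (Suc m))"
  define a where "a = \<alpha> (Suc (Suc m))"
  define \<beta> where "\<beta> = sqrt (b_seq \<alpha> (Suc m))"
  \<comment> \<open>Chosen so that \<open>t * X' \<omega>\<close> is s times the deviation of the
    integral of \<open>h\<close>; the sign is that of F_n - F = - G h / D.\<close>
  define s where "s = - (t * \<beta> / D)"
  define r where "r = \<bar>t\<bar> / c"
  define \<delta> where "\<delta> = sqrt (ratio (Suc m))"
  define V where "V = limit_variance (learned l) y \<theta>"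
  define W where "W \<omega> = integral\<^sup>L (Glim \<omega>) h" for \<omega>
  define Dlim where "Dlim \<omega> = marg (Glim \<omega>) y" for \<omega>
  define X' where "X' \<omega> = - (\<beta> * W \<omega> / D)" for \<omega>
  have c: "0 < c" by (simp add: c_def pois_lb_pos)
  have H: "0 < H" by (simp add: H_def pois_ub_pos)
  have D: "c \<le> D" "0 < D" "D \<le> H" using marg_bounds[OF learned_in_priors] by (auto simp: c_def D_def H_def)
  have T: "0 < T" and R: "0 < R" and TR: "T = (\<alpha> (Suc m))\<^sup>2 + R"
    unfolding T_def R_def by (rule tail_pos tail_Suc)+
  have a: "0 < a" by (simp add: a_def rate_pos)
  have \<beta>: "0 \<le> \<beta>" "\<beta>\<^sup>2 = 1 / T" "\<beta> * sqrt R \<le> 1" "\<beta> * a \<le> \<delta>" "\<beta>\<^sup>2 * R \<le> 1"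
  proof -
    have be: "\<beta> = 1 / sqrt T"
      by (simp add: \<beta>_def b_seq_def T_def real_sqrt_inverse inverse_eq_divide real_sqrt_divide)
    show "0 \<le> \<beta>" unfolding be using T by simp
    show "\<beta>\<^sup>2 = 1 / T" unfolding be using T by (simp add: power_divide)
    then show "\<beta>\<^sup>2 * R \<le> 1" using T R TR by (simp add: divide_le_eq)
    show "\<beta> * sqrt R \<le> 1" unfolding be using T TR by (simp add: divide_le_eq)
    \<comment> \<open>Passing from \<open>T\<close> to the smaller tail \<open>R\<close> gives
      exactly the square root of \<open>ratio (Suc m)\<close>.\<close>
    have "a / sqrt T \<le> a / sqrt R"
      using a R T TR by (intro divide_left_mono) auto
    also have "\<dots> = \<delta>"
      using a unfolding \<delta>_def ratio_def a_def[symmetric] R_def[symmetric] by (simp add: real_sqrt_divide)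
    finally show "\<beta> * a \<le> \<delta>" unfolding be by simp
  qed
  have r0: "0 \<le> r" using c by (simp add: r_def)
  have sr: "\<bar>s\<bar> \<le> r * \<beta>"
  proof -
    have "\<bar>s\<bar> = \<bar>t\<bar> * \<beta> / D" using D \<beta>(1) by (simp add: s_def abs_mult)
    also have "\<dots> \<le> \<bar>t\<bar> * \<beta> / c" using D c \<beta>(1) by (intro divide_left_mono) auto
    finally show ?thesis by (simp add: r_def)
  qed
  have h: "bdd H h" unfolding h_def H_def by (intro bdd_cdf_score post_cdf_bounds learned_in_priors)
  have h0: "integral\<^sup>L (learned l) h = 0" unfolding h_def by (simp add: integral_cdf_score[OF learned_in_priors])
  have conv: "AE \<omega> in M. (\<lambda>n. integral\<^sup>L (learned (hist n \<omega>)) h) \<longlonglongrightarrow> integral\<^sup>L (Glim \<omega>) h"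
    unfolding h_def by (rule AE_tendsto_cdf_score)
  have convD: "AE \<omega> in M. (\<lambda>n. integral\<^sup>L (learned (hist n \<omega>)) (poisson y)) \<longlonglongrightarrow> integral\<^sup>L (Glim \<omega>) (poisson y)"
    using poisson_bounds(3)
    by (intro AE_tendsto_Glim_total[OF _ _ bdd_poisson] isCont_poisson) (simp add: less_imp_le)
  have W_meas [measurable]: "W \<in> borel_measurable M"
    unfolding W_def by (rule integral_Glim_measurable[OF bdd_measurable[OF h]])
  have Dlim_meas [measurable]: "Dlim \<in> borel_measurable M"
    unfolding Dlim_def marg_def by (rule integral_Glim_measurable[OF borel_measurable_poisson])
  have W_bound: "\<bar>W \<omega>\<bar> \<le> H" and Dlim_bounds: "c \<le> Dlim \<omega>" "0 < Dlim \<omega>" "Dlim \<omega> \<le> H"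
    if "\<omega> \<in> space M" for \<omega>
    using abs_integral_le_priors[OF Glim_in_priors[OF that] h] marg_bounds[OF Glim_in_priors[OF that]]
    by (auto simp: W_def Dlim_def c_def H_def)
  have EW: "(\<integral>\<omega>. (W \<omega>)\<^sup>2 \<partial>U l) \<le> 4 * H\<^sup>2 * R"
    using second_moment_limit[OF pos h conv] by (simp add: W_def h0 R_def len)
  have ED: "(\<integral>\<omega>. (Dlim \<omega> - D)\<^sup>2 \<partial>U l) \<le> 4 * H\<^sup>2 * R"
    using second_moment_limit[OF pos bdd_poisson convD] by (simp add: Dlim_def D_def marg_def R_def len H_def)
  have iW: "integrable (U l) (\<lambda>\<omega>. (W \<omega>)\<^sup>2)"
  proof (rule U.integrable_const_bound)
    show "AE \<omega> in U l. norm ((W \<omega>)\<^sup>2) \<le> H\<^sup>2"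
    proof (rule AE_I2)
      fix \<omega> assume "\<omega> \<in> space (U l)"
      then have "\<bar>W \<omega>\<bar>\<^sup>2 \<le> H\<^sup>2" by (intro power_mono W_bound) auto
      then show "norm ((W \<omega>)\<^sup>2) \<le> H\<^sup>2" by simp
    qed
  qed simp
  have iD: "integrable (U l) (\<lambda>\<omega>. (Dlim \<omega> - D)\<^sup>2)"
  proof (rule U.integrable_const_bound)
    show "AE \<omega> in U l. norm ((Dlim \<omega> - D)\<^sup>2) \<le> H\<^sup>2"
    proof (rule AE_I2)
      fix \<omega> assume "\<omega> \<in> space (U l)"
      then have "\<bar>Dlim \<omega> - D\<bar> \<le> H" using Dlim_bounds[of \<omega>] D by auto
      then have "\<bar>Dlim \<omega> - D\<bar>\<^sup>2 \<le> H\<^sup>2" by (intro power_mono) auto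
      then show "norm ((Dlim \<omega> - D)\<^sup>2) \<le> H\<^sup>2" by simp
    qed
  qed simp
  have X_meas: "(\<lambda>\<omega>. iexp (t * rescaled_error (Suc m) \<omega>)) \<in> borel_measurable M"
    by measurable
  have X'_meas: "(\<lambda>\<omega>. iexp (t * X' \<omega>)) \<in> borel_measurable M"
    unfolding X'_def by measurable
  have pw: "cmod (iexp (t * rescaled_error (Suc m) \<omega>) - iexp (t * X' \<omega>))
      \<le> \<bar>t\<bar> * \<beta> / c\<^sup>2 / 2 * ((W \<omega>)\<^sup>2 + (Dlim \<omega> - D)\<^sup>2)"
    if \<omega>: "\<omega> \<in> atom l" for \<omega>
  proof -
    have sp: "\<omega> \<in> space M" and hi: "hist (Suc m) \<omega> = l" using \<omega> len by (auto simp: atom_def)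
    have "W \<omega> = Dlim \<omega> * (post_cdf (Glim \<omega>) \<theta> y - post_cdf (learned l) \<theta> y)"
      unfolding W_def h_def Dlim_def by (rule integral_cdf_score[OF Glim_in_priors[OF sp]])
    then have "post_cdf (Glim \<omega>) \<theta> y - post_cdf (learned l) \<theta> y = W \<omega> / Dlim \<omega>"
      using Dlim_bounds(2)[OF sp] by simp
    then have "post_cdf (learned l) \<theta> y - post_cdf (Glim \<omega>) \<theta> y = - (W \<omega> / Dlim \<omega>)" by simp
    then have X: "rescaled_error (Suc m) \<omega> = - (\<beta> * W \<omega> / Dlim \<omega>)"
      unfolding rescaled_error_def hi \<beta>_def[symmetric] by simp
    \<comment> \<open>The difference is a product of two deviations, \<open>W\<close> and
      \<open>Dlim - D\<close>, each of mean square at most 4 * H^2 * R.\<close>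
    have "t * rescaled_error (Suc m) \<omega> - t * X' \<omega> = t * \<beta> * (W \<omega> * (Dlim \<omega> - D)) / (Dlim \<omega> * D)"
      unfolding X X'_def using Dlim_bounds(2)[OF sp] D(2) by (simp add: field_simps)
    then have "\<bar>t * rescaled_error (Suc m) \<omega> - t * X' \<omega>\<bar> = \<bar>t\<bar> * \<beta> * \<bar>W \<omega> * (Dlim \<omega> - D)\<bar> / (Dlim \<omega> * D)"
      using Dlim_bounds(2)[OF sp] D(2) \<beta>(1) by (simp add: abs_mult)
    also have "\<dots> \<le> \<bar>t\<bar> * \<beta> * \<bar>W \<omega> * (Dlim \<omega> - D)\<bar> / c\<^sup>2"
      using Dlim_bounds[OF sp] D c \<beta>(1) unfolding power2_eq_square
      by (intro divide_left_mono mult_mono mult_nonneg_nonneg mult_pos_pos) auto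
    also have "\<dots> = \<bar>t\<bar> * \<beta> / c\<^sup>2 * \<bar>W \<omega> * (Dlim \<omega> - D)\<bar>" by simp
    \<comment> \<open>Bounding the product by half the sum of squares reduces its mean to the second
      moments \<open>EW\<close> and \<open>ED\<close>.\<close>
    also have "\<dots> \<le> \<bar>t\<bar> * \<beta> / c\<^sup>2 * (((W \<omega>)\<^sup>2 + (Dlim \<omega> - D)\<^sup>2) / 2)"
    proof (rule mult_left_mono)
      show "\<bar>W \<omega> * (Dlim \<omega> - D)\<bar> \<le> ((W \<omega>)\<^sup>2 + (Dlim \<omega> - D)\<^sup>2) / 2"
        using sum_squares_bound[of "\<bar>W \<omega>\<bar>" "\<bar>Dlim \<omega> - D\<bar>"] by (simp add: abs_mult)
    qed (use \<beta>(1) in simp)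
    finally show ?thesis
      using cmod_iexp_diff_le[of "t * rescaled_error (Suc m) \<omega>" "t * X' \<omega>"] by simp
  qed
  have iX: "integrable (U l) (\<lambda>\<omega>. iexp (t * rescaled_error (Suc m) \<omega>))"
    using X_meas by (intro U.integrable_const_bound[where B = 1]) auto
  have iX': "integrable (U l) (\<lambda>\<omega>. iexp (t * X' \<omega>))"
    using X'_meas by (intro U.integrable_const_bound[where B = 1]) auto
  have err1: "cmod ((\<integral>\<omega>. iexp (t * rescaled_error (Suc m) \<omega>) \<partial>U l) - (\<integral>\<omega>. iexp (t * X' \<omega>) \<partial>U l))
      \<le> 4 * H\<^sup>2 * r / c * sqrt R"
  proof -
    have "cmod ((\<integral>\<omega>. iexp (t * rescaled_error (Suc m) \<omega>) \<partial>U l) - (\<integral>\<omega>. iexp (t * X' \<omega>) \<partial>U l))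
        = cmod (\<integral>\<omega>. iexp (t * rescaled_error (Suc m) \<omega>) - iexp (t * X' \<omega>) \<partial>U l)"
      by (subst Bochner_Integration.integral_diff[OF iX iX']) rule
    also have "\<dots> \<le> (\<integral>\<omega>. cmod (iexp (t * rescaled_error (Suc m) \<omega>) - iexp (t * X' \<omega>)) \<partial>U l)"
      by (rule integral_norm_bound)
    also have "\<dots> \<le> (\<integral>\<omega>. \<bar>t\<bar> * \<beta> / c\<^sup>2 / 2 * ((W \<omega>)\<^sup>2 + (Dlim \<omega> - D)\<^sup>2) \<partial>U l)"
    proof (rule integral_mono_AE)
      show "AE \<omega> in U l. cmod (iexp (t * rescaled_error (Suc m) \<omega>) - iexp (t * X' \<omega>))
          \<le> \<bar>t\<bar> * \<beta> / c\<^sup>2 / 2 * ((W \<omega>)\<^sup>2 + (Dlim \<omega> - D)\<^sup>2)"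
        by (rule AE_uniform_measureI[OF atom_measurable]) (rule AE_I2, rule impI, rule pw)
    qed (intro integrable_norm Bochner_Integration.integrable_diff iX iX'
        integrable_mult_right Bochner_Integration.integrable_add iW iD)+
    also have "\<dots> = \<bar>t\<bar> * \<beta> / c\<^sup>2 / 2 * ((\<integral>\<omega>. (W \<omega>)\<^sup>2 \<partial>U l) + (\<integral>\<omega>. (Dlim \<omega> - D)\<^sup>2 \<partial>U l))"
      by (simp only: Bochner_Integration.integral_mult_right_zero Bochner_Integration.integral_add[OF iW iD])
    also have "\<dots> \<le> \<bar>t\<bar> * \<beta> / c\<^sup>2 / 2 * (4 * H\<^sup>2 * R + 4 * H\<^sup>2 * R)"
      using EW ED \<beta>(1) by (intro mult_left_mono add_mono) auto
    also have "\<dots> = 4 * H\<^sup>2 * r / c * (\<beta> * R)"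
      using c by (simp add: r_def power2_eq_square)
    also have "\<dots> \<le> 4 * H\<^sup>2 * r / c * sqrt R"
    proof (rule mult_left_mono)
      \<comment> \<open>The product of deviations has order R and the scale is at most R^(-1/2), so
        sqrt R remains and tends to 0.\<close>
      have "\<beta> * R = (\<beta> * sqrt R) * sqrt R" using R by simp
      also have "\<dots> \<le> 1 * sqrt R" using \<beta>(3) R by (intro mult_right_mono) auto
      finally show "\<beta> * R \<le> sqrt R" by simp
    qed (use c r0 in simp)
    finally show ?thesis .
  qed
  have sX: "t * X' \<omega> = s * (integral\<^sup>L (Glim \<omega>) h - integral\<^sup>L (learned l) h)" for \<omega>
    by (simp add: X'_def s_def W_def h0)
  have err2: "cmod ((\<integral>\<omega>. iexp (t * X' \<omega>) \<partial>U l) - exp (- (s\<^sup>2 * predictive_variance (learned l) h * R / 2)))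
      \<le> r\<^sup>2 / 2 * ((6 * exp hi + 4) * H\<^sup>2 * sqrt R) + (2 * H * r) ^ 3 * \<delta> / 6 + 2 * r ^ 4 * \<delta>\<^sup>2 * H ^ 4"
  proof -
    have mono: "\<alpha> (Suc (length l + j)) \<le> a" for j
      unfolding a_def len by (intro rate_mono) simp
    have "cmod ((\<integral>\<omega>. iexp (t * X' \<omega>) \<partial>U l) - exp (- (s\<^sup>2 * predictive_variance (learned l) h * R / 2)))
      \<le> R * (s\<^sup>2 / 2 * ((6 * exp hi + 4) * H\<^sup>2 * sqrt R) + (2 * H * \<bar>s\<bar>) ^ 3 * a / 6 + 2 * s ^ 4 * a\<^sup>2 * H ^ 4)"
      using char_limit[OF pos h conv mono, of s] unfolding sX len R_def[symmetric] by simp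
    also have "\<dots> \<le> R * ((r * \<beta>)\<^sup>2 / 2 * ((6 * exp hi + 4) * H\<^sup>2 * sqrt R) + (2 * H * (r * \<beta>)) ^ 3 * a / 6 + 2 * (r * \<beta>) ^ 4 * a\<^sup>2 * H ^ 4)"
    proof -
      have s2: "s\<^sup>2 \<le> (r * \<beta>)\<^sup>2" using power_mono[OF sr abs_ge_zero, of 2] by simp
      have s4: "s ^ 4 \<le> (r * \<beta>) ^ 4" using power_mono[OF sr abs_ge_zero, of 4] by simp
      have s3: "(2 * H * \<bar>s\<bar>) ^ 3 \<le> (2 * H * (r * \<beta>)) ^ 3" using H sr by (intro power_mono mult_left_mono) auto
      have "0 \<le> (6 * exp hi + 4) * H\<^sup>2 * sqrt R" using R by (intro mult_nonneg_nonneg add_nonneg_nonneg) auto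
      then show ?thesis
        using s2 s3 s4 a H R
        by (intro mult_left_mono add_mono divide_right_mono mult_right_mono) auto
    qed
    \<comment> \<open>Every summand carries at least two factors \<open>\<beta>\<close>. They absorb
      \<open>R\<close>; each further one pairs with a factor \<open>a\<close>, giving a quantity at
      most \<open>\<delta>\<close>.\<close>
    also have "\<dots> = (\<beta>\<^sup>2 * R) * (r\<^sup>2 / 2 * ((6 * exp hi + 4) * H\<^sup>2 * sqrt R) + (2 * H * r) ^ 3 * (\<beta> * a) / 6 + 2 * r ^ 4 * (\<beta> * a)\<^sup>2 * H ^ 4)"
      by (simp add: power2_eq_square power3_eq_cube power4_eq_xxxx algebra_simps)
    also have "\<dots> \<le> 1 * (r\<^sup>2 / 2 * ((6 * exp hi + 4) * H\<^sup>2 * sqrt R) + (2 * H * r) ^ 3 * \<delta> / 6 + 2 * r ^ 4 * \<delta>\<^sup>2 * H ^ 4)"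
    proof (rule mult_mono)
      have "0 \<le> \<beta> * a" using \<beta>(1) a by simp
      then have "(\<beta> * a)\<^sup>2 \<le> \<delta>\<^sup>2" using \<beta>(4) by (intro power_mono) auto
      then show "r\<^sup>2 / 2 * ((6 * exp hi + 4) * H\<^sup>2 * sqrt R) + (2 * H * r) ^ 3 * (\<beta> * a) / 6 + 2 * r ^ 4 * (\<beta> * a)\<^sup>2 * H ^ 4
        \<le> r\<^sup>2 / 2 * ((6 * exp hi + 4) * H\<^sup>2 * sqrt R) + (2 * H * r) ^ 3 * \<delta> / 6 + 2 * r ^ 4 * \<delta>\<^sup>2 * H ^ 4"
        using \<beta>(4) r0 H by (intro add_mono divide_right_mono mult_left_mono mult_right_mono) auto
      show "0 \<le> r\<^sup>2 / 2 * ((6 * exp hi + 4) * H\<^sup>2 * sqrt R) + (2 * H * r) ^ 3 * (\<beta> * a) / 6 + 2 * r ^ 4 * (\<beta> * a)\<^sup>2 * H ^ 4"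
        using r0 H R \<beta>(1) a by (intro add_nonneg_nonneg mult_nonneg_nonneg divide_nonneg_nonneg zero_le_power) auto
    qed (use \<beta>(5) in auto)
    finally show ?thesis by simp
  qed
  have err3: "\<bar>exp (- (s\<^sup>2 * predictive_variance (learned l) h * R / 2)) - exp (- (t\<^sup>2 * V / 2))\<bar> \<le> 2 * H\<^sup>2 * r\<^sup>2 * ratio m"
  proof -
    have v: "0 \<le> predictive_variance (learned l) h" "predictive_variance (learned l) h \<le> 4 * H\<^sup>2"
      using predictive_variance_nonneg[OF learned_in_priors h] predictive_variance_le[OF learned_in_priors h] by auto
    have V: "V = predictive_variance (learned l) h / D\<^sup>2"
      unfolding V_def h_def D_def by (rule limit_variance_eq(1)[OF learned_in_priors])
    have s2: "s\<^sup>2 = t\<^sup>2 / D\<^sup>2 / T"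
      using \<beta>(2) by (simp add: s_def power_divide power_mult_distrib)
    have "s\<^sup>2 * predictive_variance (learned l) h * R / 2 - t\<^sup>2 * V / 2 = - (t\<^sup>2 / D\<^sup>2 * predictive_variance (learned l) h * (1 - R / T) / 2)"
      unfolding s2 V by (simp add: algebra_simps diff_divide_distrib)
    \<comment> \<open>The offset by one index: the scale uses the tail from \<open>Suc m\<close>,
      the remaining randomness the tail from \<open>Suc (Suc m)\<close>.\<close>
    also have "1 - R / T = ratio m"
      using T unfolding ratio_def T_def[symmetric] by (simp add: TR field_simps)
    finally have "\<bar>s\<^sup>2 * predictive_variance (learned l) h * R / 2 - t\<^sup>2 * V / 2\<bar> = t\<^sup>2 / D\<^sup>2 * predictive_variance (learned l) h * ratio m / 2"
      using v(1) ratio_nonneg[of m] by simp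
    also have "\<dots> \<le> r\<^sup>2 * (4 * H\<^sup>2) * ratio m / 2"
    proof -
      have "t\<^sup>2 / D\<^sup>2 \<le> t\<^sup>2 / c\<^sup>2" using D c by (intro divide_left_mono power_mono) auto
      then have "t\<^sup>2 / D\<^sup>2 \<le> r\<^sup>2" by (simp add: r_def power_divide)
      then show ?thesis using v ratio_nonneg[of m] by (intro divide_right_mono mult_right_mono mult_mono) auto
    qed
    finally have "\<bar>s\<^sup>2 * predictive_variance (learned l) h * R / 2 - t\<^sup>2 * V / 2\<bar> \<le> 2 * H\<^sup>2 * r\<^sup>2 * ratio m" by (simp add: mult_ac)
    moreover have "0 \<le> s\<^sup>2 * predictive_variance (learned l) h * R / 2" "0 \<le> t\<^sup>2 * V / 2"
      using v(1) R V by auto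
    ultimately show ?thesis using abs_exp_minus_diff_le order_trans by blast
  qed
  have tri: "cmod (u - complex_of_real x) \<le> cmod (u - w) + cmod (w - complex_of_real z) + \<bar>z - x\<bar>" for u w x z
  proof -
    have split: "u - complex_of_real x = (u - w) + (w - complex_of_real z) + complex_of_real (z - x)" by simp
    show ?thesis
      unfolding split
      using norm_triangle_ineq[of "u - w" "w - complex_of_real z"]
        norm_triangle_ineq[of "(u - w) + (w - complex_of_real z)" "complex_of_real (z - x)"]
      unfolding norm_of_real by linarith
  qed
  show ?thesis
    using tri[of "\<integral>\<omega>. iexp (t * rescaled_error (Suc m) \<omega>) \<partial>U l" "exp (- (t\<^sup>2 * V / 2))"
        "\<integral>\<omega>. iexp (t * X' \<omega>) \<partial>U l" "exp (- (s\<^sup>2 * predictive_variance (learned l) h * R / 2))"] err1 err2 err3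
    unfolding char_err_def Let_def V_def[symmetric] H_def[symmetric] c_def[symmetric] r_def[symmetric]
      R_def[symmetric] \<delta>_def[symmetric]
    by linarith
qed

section \<open>Regular conditional distributions on atoms and the convergence\<close>

lemma in_atom_hist: "\<omega> \<in> space M \<Longrightarrow> \<omega> \<in> atom (hist n \<omega>)"
  by (simp add: atom_def)

text \<open>There are countably many histories, so the null atoms together form a null set.\<close>

lemma AE_atom_pos: "AE \<omega> in M. \<forall>n. 0 < prob (atom (hist n \<omega>))"
proof -
  have "AE \<omega> in M. \<omega> \<in> atom l \<longrightarrow> 0 < prob (atom l)" for l
  proof (cases "prob (atom l) = 0")
    case True
    then have "AE \<omega> in M. \<omega> \<notin> atom l"
      by (subst AE_iff_measurable[of "atom l"]) (auto simp: atom_def emeasure_eq_measure)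
    then show ?thesis by eventually_elim simp
  qed (simp add: zero_less_measure_iff)
  then have "AE \<omega> in M. \<forall>l. \<omega> \<in> atom l \<longrightarrow> 0 < prob (atom l)"
    by (simp add: AE_all_countable)
  then show ?thesis
    using AE_space by eventually_elim (use in_atom_hist in blast)
qed

text \<open>For each Borel set the defining identity holds at some point of the atom, and
  measurability of the kernel makes it constant there. Although the exceptional null set depends on
  the Borel set, every version is therefore determined on atoms of positive probability.\<close>

lemma regular_cond_distr_atom:
  assumes K: "regular_cond_distr M (F n) X K" and X: "X \<in> borel_measurable M"
    and \<omega>: "\<omega> \<in> space M" and pos: "0 < prob (atom (hist n \<omega>))"
  shows "K \<omega> = distr (U (hist n \<omega>)) borel X"
proof -
  have Km: "K \<in> F n \<rightarrow>\<^sub>M prob_algebra borel" using K by (simp add: regular_cond_distr_def)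
  have "K \<omega> \<in> space (prob_algebra borel)"
    using measurable_space[OF Km] \<omega> by simp
  then have Ks: "sets (K \<omega>) = sets borel" and Kp: "prob_space (K \<omega>)" by (auto simp: space_prob_algebra)
  interpret K: prob_space "K \<omega>" by (rule Kp)
  interpret U: prob_space "U (hist n \<omega>)" by (rule prob_space_U[OF pos])
  have XU: "X \<in> borel_measurable (U (hist n \<omega>))" using X by simp
  show ?thesis
  proof (rule measure_eqI)
    fix B assume "B \<in> sets (K \<omega>)"
    then have B: "B \<in> sets borel" using Ks by simp
    let ?E = "X -` B \<inter> space M"
    have E: "?E \<in> sets M" using X B by (rule measurable_sets)
    have ae: "AE \<omega> in M. measure (K \<omega>) B = real_cond_exp M (F n) (indicator ?E) \<omega>"
      using K B by (simp add: regular_cond_distr_def)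
    obtain \<omega>' where \<omega>': "\<omega>' \<in> atom (hist n \<omega>)" "measure (K \<omega>') B = real_cond_exp M (F n) (indicator ?E) \<omega>'"
      using ex_atom_AE[OF _ ae, of "hist n \<omega>"] pos by auto
    have "(\<lambda>\<omega>. measure (K \<omega>) B) \<in> borel_measurable (F n)"
      by (rule measurable_compose[OF Km]) (rule measurable_measure_prob_algebra[OF B])
    then have "measure (K \<omega>) B = measure (K \<omega>') B"
      using \<omega>'(1) \<omega> by (intro measurable_F_const[of _ n \<omega>' \<omega>]) (auto simp: atom_def)
    then have "measure (K \<omega>) B * prob (atom (hist n \<omega>)) = prob (atom (hist n \<omega>) \<inter> ?E)"
      using real_cond_exp_atom[OF E \<omega>'(1)] \<omega>'(2) by simp
    then have "measure (K \<omega>) B = measure (U (hist n \<omega>)) ?E"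
      using pos by (simp add: measure_U[OF pos E] field_simps)
    also have "\<dots> = measure (distr (U (hist n \<omega>)) borel X) B"
      using XU B by (simp add: measure_distr)
    finally show "emeasure (K \<omega>) B = emeasure (distr (U (hist n \<omega>)) borel X) B"
      using XU B by (simp add: K.emeasure_eq_measure U.emeasure_eq_measure emeasure_distr measure_distr)
  qed (use Ks in simp)
qed

lemma ex_regular_cond_distr:
  assumes X: "X \<in> borel_measurable M"
  shows "\<exists>K. regular_cond_distr M (F n) X K"
proof -
  \<comment> \<open>On null atoms the value is arbitrary; a point mass keeps it a probability
    measure.\<close>
  define k where "k l = (if 0 < prob (atom l) then distr (U l) borel X else return borel 0)" for l
  have "k l \<in> space (prob_algebra borel)" for l
  proof (cases "0 < prob (atom l)")
    case True
    interpret U: prob_space "U l" by (rule prob_space_U[OF True])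
    show ?thesis
      using X True by (auto simp: k_def space_prob_algebra intro!: U.prob_space_distr)
  next
    case False
    then show ?thesis by (simp add: k_def space_prob_algebra prob_space_return)
  qed
  then have "(\<lambda>\<omega>. k (hist n \<omega>)) \<in> F n \<rightarrow>\<^sub>M prob_algebra borel"
    by (intro measurable_compose[OF hist_measurable_F[OF order_refl]]) simp
  moreover have "AE \<omega> in M. measure (k (hist n \<omega>)) B = real_cond_exp M (F n) (indicator (X -` B \<inter> space M)) \<omega>"
    if B: "B \<in> sets borel" for B
    using AE_atom_pos AE_space
  proof eventually_elim
    case (elim \<omega>)
    have pos: "0 < prob (atom (hist n \<omega>))" using elim by blast
    have E: "X -` B \<inter> space M \<in> sets M" using X B by (rule measurable_sets)
    have k_eq: "measure (k (hist n \<omega>)) B = prob (atom (hist n \<omega>) \<inter> (X -` B \<inter> space M)) / prob (atom (hist n \<omega>))"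
      unfolding measure_U[OF pos E, symmetric] using pos X B by (simp add: k_def measure_distr)
    show ?case
      unfolding k_eq using real_cond_exp_atom[OF E in_atom_hist[OF elim(2), of n]] pos
      by (simp add: divide_eq_eq)
  qed
  ultimately show ?thesis unfolding regular_cond_distr_def by blast
qed

text \<open>Levy's continuity theorem is applied for each fixed \<omega>. The bound
  \<open>char_err\<close> is free of \<omega>, so the only exceptional sets are the null atoms and
  the failure of convergence of the variances.\<close>

lemma cond_distr_converges:
  "cond_distr_converges_gaussian M F rescaled_error (\<lambda>\<omega>. limit_variance (Glim \<omega>) y \<theta>)"
  unfolding cond_distr_converges_gaussian_def
proof (intro conjI allI impI)
  show "\<exists>K. \<forall>n. regular_cond_distr M (F n) (rescaled_error n) (K n)"
    by (intro choice allI ex_regular_cond_distr rescaled_error_measurable)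
next
  fix K assume K: "\<forall>n. regular_cond_distr M (F n) (rescaled_error n) (K n)"
  show "AE \<omega> in M. weak_conv_m (\<lambda>n. K n \<omega>) (centered_gaussian (limit_variance (Glim \<omega>) y \<theta>))"
    using AE_atom_pos AE_limit_variance_tendsto[of y \<theta>] AE_space
  proof eventually_elim
    case (elim \<omega>)
    let ?V = "\<lambda>n. limit_variance (learned (hist n \<omega>)) y \<theta>" and ?W = "limit_variance (Glim \<omega>) y \<theta>"
    have W: "0 \<le> ?W" by (rule limit_variance_nonneg[OF Glim_in_priors[OF elim(3)]])
    have Keq: "K n \<omega> = distr (U (hist n \<omega>)) borel (rescaled_error n)" for n
      using K elim by (intro regular_cond_distr_atom rescaled_error_measurable) auto
    show ?case
    proof (rule levy_continuity)
      fix n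
      interpret U: prob_space "U (hist n \<omega>)" using elim(1) by (intro prob_space_U) blast
      have "rescaled_error n \<in> borel_measurable (U (hist n \<omega>))" by simp
      then have "prob_space (K n \<omega>)" unfolding Keq by (rule U.prob_space_distr)
      then show "real_distribution (K n \<omega>)"
        by (simp add: real_distribution_def real_distribution_axioms_def Keq)
    next
      show "real_distribution (centered_gaussian ?W)" by (rule char_centered_gaussian(1)[OF W])
    next
      fix t
      have char_eq: "char (K n \<omega>) t = (\<integral>\<omega>. iexp (t * rescaled_error n \<omega>) \<partial>U (hist n \<omega>))" for n
        unfolding Keq char_def by (rule integral_distr) simp_all
      \<comment> \<open>The index 0 is skipped because \<open>b_seq \<alpha> 0\<close> would involve
        \<alpha> 0; the limit does not depend on it.\<close>
      have "cmod (char (K (Suc m) \<omega>) t - exp (- (t\<^sup>2 * ?V (Suc m) / 2))) \<le> char_err t m" for m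
        unfolding char_eq using elim(1) by (intro char_rescaled_error length_hist) blast
      then have "(\<lambda>m. char (K (Suc m) \<omega>) t - exp (- (t\<^sup>2 * ?V (Suc m) / 2))) \<longlonglongrightarrow> 0"
        by (intro Lim_null_comparison[OF _ char_err_tendsto_0[of t]] always_eventually) blast
      moreover have "(\<lambda>m. complex_of_real (exp (- (t\<^sup>2 * ?V (Suc m) / 2)))) \<longlonglongrightarrow> complex_of_real (exp (- (t\<^sup>2 * ?W / 2)))"
        by (intro tendsto_intros LIMSEQ_Suc[OF elim(2)]) auto
      ultimately have "(\<lambda>m. char (K (Suc m) \<omega>) t) \<longlonglongrightarrow> complex_of_real (exp (- (t\<^sup>2 * ?W / 2)))"
        using tendsto_add[of "\<lambda>m. char (K (Suc m) \<omega>) t - exp (- (t\<^sup>2 * ?V (Suc m) / 2))" 0] by fastforce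
      then show "(\<lambda>n. char (K n \<omega>) t) \<longlonglongrightarrow> char (centered_gaussian ?W) t"
        unfolding char_centered_gaussian(2)[OF W] by (rule LIMSEQ_imp_Suc)
    qed
  qed
qed

end

section \<open>From a compact set to the interval between its extremes\<close>

lemma prob_measures_on_mono:
  assumes "\<Theta> \<subseteq> \<Theta>'" "\<Theta>' \<in> sets borel"
  shows "prob_measures_on \<Theta> \<subseteq> prob_measures_on \<Theta>'"
proof
  fix G assume G: "G \<in> prob_measures_on \<Theta>"
  interpret prob_space G using G by (simp add: prob_measures_on_def)
  have "emeasure G \<Theta> \<le> emeasure G \<Theta>'"
    using assms G by (intro emeasure_mono) (auto simp: prob_measures_on_def)
  then show "G \<in> prob_measures_on \<Theta>'"
    using G emeasure_le_1[of \<Theta>'] by (auto simp: prob_measures_on_def)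
qed

theorem theorem2p3:
  fixes M :: "'a measure" and \<Theta> :: "real set" and G0 :: "real measure"
    and \<alpha> :: "nat \<Rightarrow> real" and Y :: "nat \<Rightarrow> 'a \<Rightarrow> nat" and Glim :: "'a \<Rightarrow> real measure"
  assumes "\<Theta> \<subseteq> {0<..}" and "compact \<Theta>"
    and "G0 \<in> prob_measures_on \<Theta>"
    and "\<forall>n\<ge>1. 0 < \<alpha> n \<and> \<alpha> n < 1"
    and "\<forall>m n. 1 \<le> m \<longrightarrow> m \<le> n \<longrightarrow> \<alpha> n \<le> \<alpha> m"
    and "\<not> summable (\<lambda>n. \<alpha> (Suc n))"
    and "summable (\<lambda>n. (\<alpha> (Suc n))\<^sup>2)"
    and "summable (\<lambda>n. ((\<alpha> (Suc n))\<^sup>2 / tail_sq \<alpha> (Suc n))\<^sup>2)"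
    and "learning_model M \<alpha> G0 Y"
    and "random_prob_measure_on M \<Theta> Glim"
    and "AE \<omega> in M. weak_conv_m (\<lambda>n. learn \<alpha> G0 (\<lambda>k. Y k \<omega>) n) (Glim \<omega>)"
  shows "\<forall>y. \<forall>\<theta>\<in>\<Theta>.
    cond_distr_converges_gaussian M (gen_filtration M Y)
      (\<lambda>n \<omega>. sqrt (b_seq \<alpha> n)
         * (post_cdf (learn \<alpha> G0 (\<lambda>k. Y k \<omega>) n) \<theta> y - post_cdf (Glim \<omega>) \<theta> y))
      (\<lambda>\<omega>. limit_variance (Glim \<omega>) y \<theta>)"
proof (intro allI ballI)
  fix y \<theta> assume "\<theta> \<in> \<Theta>"
  then have ne: "\<Theta> \<noteq> {}" by auto
  \<comment> \<open>The minimum belongs to \<Theta> and is therefore positive, so the enclosing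
    interval stays inside the positive half line.\<close>
  obtain lo where lo: "lo \<in> \<Theta>" "\<And>x. x \<in> \<Theta> \<Longrightarrow> lo \<le> x"
    using compact_attains_inf[OF assms(2) ne] by blast
  obtain hi where hi: "hi \<in> \<Theta>" "\<And>x. x \<in> \<Theta> \<Longrightarrow> x \<le> hi"
    using compact_attains_sup[OF assms(2) ne] by blast
  have sub: "prob_measures_on \<Theta> \<subseteq> prob_measures_on {lo..hi}"
    using lo(2) hi(2) by (intro prob_measures_on_mono) auto
  interpret learning_clt lo hi \<alpha> G0 M Y Glim y \<theta>
  proof unfold_locales
    show "0 < lo" "lo \<le> hi" using lo hi assms(1) by auto
    show "G0 \<in> prob_measures_on {lo..hi}" using sub assms(3) by blast
    show "0 \<le> \<alpha> (Suc n)" "\<alpha> (Suc n) \<le> 1" "0 < \<alpha> (Suc n)" for n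
      using assms(4)[rule_format, of "Suc n"] by auto
    show "\<alpha> (Suc n) \<le> \<alpha> (Suc m)" if "m \<le> n" for m n
      using assms(5) that by simp
    show "random_prob_measure_on M {lo..hi} Glim"
      using assms(10) sub by (auto simp: random_prob_measure_on_def)
  qed (use assms in auto)
  show "cond_distr_converges_gaussian M (gen_filtration M Y)
      (\<lambda>n \<omega>. sqrt (b_seq \<alpha> n)
         * (post_cdf (learn \<alpha> G0 (\<lambda>k. Y k \<omega>) n) \<theta> y - post_cdf (Glim \<omega>) \<theta> y))
      (\<lambda>\<omega>. limit_variance (Glim \<omega>) y \<theta>)"
    using cond_distr_converges by (simp add: rescaled_error_def[abs_def] learned_hist)
qed

end
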